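(* Assume (A1), (A2), (A3) of the context. Let $u^*$ be a local minimiser of $J$ over $\mathcal U_{\mathrm{ad}}$, let $X^*=X^{u^*}$ be the corresponding state, and let $(p,\bar p,q)$ be the solution of the adapted adjoint equation along $(X^*,u^* )$. Then for every bounded feasible perturbation $v$, $$DJ(u^* )v=h\sum_{n=0}^{N-1}\mathbb E\Bigl\langle b_u(n)^*\bar p_n+\ell_u(n)+h^{-1/2}\sigma_u(n)^*\bigl(\zeta_n^H\bar p_n+\beta_n q_n\bigr),\,v_n\Bigr\rangle,$$ where all derivatives are evaluated at $(n,X_n^*,u_n^* )$. Consequently, if $u_n^*$ is an interior point of $\mathcal U$ almost surely, then $$b_u(n)^*\bar p_n+\ell_u(n)+h^{-1/2}\sigma_u(n)^*\bigl(\zeta_n^H\bar p_n+\beta_n q_n\bigr)=0\quad\text{a.s.}$$ For a general closed convex control set $\mathcal U$, this last identity is replaced by the normal cone inclusion $$-\Bigl[b_u(n)^*\bar p_n+\ell_u(n)+h^{-1/2}\sigma_u(n)^*\bigl(\zeta_n^H\bar p_n+\beta_n q_n\bigr)\Bigr]\in N_{\mathcal U}(u_n^* )\quad\text{a.s.}$$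
   Context: Noise. Fix $H\in(0,1)$, an integer $N\ge1$, a step size $h>0$, $T=Nh$, $t_n=nh$, and a scalar fractional Brownian motion $B^H$ of Hurst exponent $H$ on a complete probability space $(\Omega,\mathcal F,\mathbb P)$. For $0\le n<N$ put $\xi_n^H=h^{-H}(B^H_{t_{n+1}}-B^H_{t_n})$; these are centred Gaussian with covariance $\rho(i,j)=\tfrac12(|i-j+1|^{2H}+|i-j-1|^{2H}-2|i-j|^{2H})$. The covariance matrix $\Sigma_N=[\rho(i,j)]_{0\le i,j<N}$ is strictly positive definite; $\beta=(\beta(n,k))_{0\le k\le n<N}$ is its unique lower triangular Cholesky factor with $\beta(n,n)>0$, i.e. $\rho(n,m)=\sum_{k=0}^{\min(n,m)}\beta(n,k)\beta(m,k)$, and $\gamma=\beta^{-1}$. Set $\eta_n=\sum_{k=0}^n\gamma(n,k)\xi_k^H$ (i.i.d. standard normal), so $\xi_n^H=\sum_{k=0}^n\beta(n,k)\eta_k$. Let $\mathcal F_n=\sigma(\eta_0,\dots,\eta_{n-1})$, $\mathcal F_0=\{\emptyset,\Omega\}$, $\zeta_n^H=\mathbb E[\xi_n^H\mid\mathcal F_n]=\sum_{k=0}^{n-1}\beta(n,k)\eta_k$ and $\beta_n=\beta(n,n)$, so $\xi_n^H=\zeta_n^H+\beta_n\eta_n$. State equation. Let $\mathcal U\subset\mathbb R^p$ be closed, convex, containing the origin, $x_0\in\mathbb R^d$, and $b,\sigma:\{0,\dots,N-1\}\times\mathbb R^d\times\mathbb R^p\to\mathbb R^d$ deterministic. For a control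 $u=(u_n)$, $X=X^u$ solves $X_{n+1}=X_n+h\,b(n,X_n,u_n)+\sqrt h\,\sigma(n,X_n,u_n)\xi_n^H$, $X_0=x_0$, $0\le n\le N-1$. Cost. $J(u)=\mathbb E\bigl[\Phi(X_N^u)+h\sum_{n=0}^{N-1}\ell(n,X_n^u,u_n)\bigr]$ with $\Phi:\mathbb R^d\to\mathbb R$, $\ell:\{0,\dots,N-1\}\times\mathbb R^d\times\mathbb R^p\to\mathbb R$. Assumptions. (A1) $b,\sigma,\Phi,\ell$ are twice continuously differentiable in $(x,u)$ and their partial derivatives up to order two are bounded by a constant $L>0$ and globally Lipschitz in $(x,u)$, uniformly in $n$. (A2) There is $L'>0$ with $\|b(n,x,u)\|\le L'(1+\|x\|+\|u\|)$ and $\|\sigma(n,x,u)\|\le L'$ for all $(n,x,u)$. (A3) $\mathcal H_{\mathrm{ad}}$ is the Hilbert space of sequences $u=(u_n)_{n=0}^{N-1}$ with $u_n\in L^2(\Omega,\mathcal F_n;\mathbb R^p)$ and norm $\|u\|^2_{\mathcal H_{\mathrm{ad}}}=h\sum_{n=0}^{N-1}\mathbb E\|u_n\|^2$; the admissible set is $\mathcal U_{\mathrm{ad}}=\{u\in\mathcal H_{\mathrm{ad}}:u_n\in\mathcal U\text{ a.s. for every }n\}$. Adapted adjoint equation along $(X,u)$. With $A_n=I_d+h\,b_x(n,X_n,u_n)$, $B_n=\sqrt h\,\sigma_x(n,X_n,u_n)$, $\Lambda_n=\ell_x(n,X_n,u_n)$, $$p_N=\Phi_x(X_N),\qquad p_n=A_n^*\bar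 p_n+B_n^*(\zeta_n^H\bar p_n+\beta_nq_n)+h\Lambda_n,\quad n=N-1,\dots,0,$$ where $\bar p_n=\mathbb E[p_{n+1}\mid\mathcal F_n]$ and $q_n=\mathbb E[p_{n+1}\eta_n\mid\mathcal F_n]$. Notation. Subscripts $x,u$ denote partial derivatives, $^*$ the transpose, $b_u(n)=b_u(n,X_n^*,u_n^* )$ and similarly for $\sigma_u(n)$, $\ell_u(n)$. $DJ(u)v$ is the directional derivative of $J$ at $u$ in direction $v$. A bounded feasible perturbation is a bounded $v\in\mathcal H_{\mathrm{ad}}$ with $u^*+\varepsilon v\in\mathcal U_{\mathrm{ad}}$ for all sufficiently small $\varepsilon>0$. $N_{\mathcal U}(w)$ is the normal cone of convex analysis to $\mathcal U$ at $w$. *)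

theory Defs
  imports "HOL-Probability.Probability"
begin

text \<open>A constant random variable counts as (degenerate) Gaussian.\<close>

definition gaussian_rv :: "'w measure \<Rightarrow> ('w \<Rightarrow> real) \<Rightarrow> bool" where
  "gaussian_rv M Y \<longleftrightarrow> Y \<in> borel_measurable M \<and>
     ((\<exists>m s. s > 0 \<and> distributed M lborel Y (\<lambda>y. ennreal (normal_density m s y)))
      \<or> (\<exists>m. AE \<omega> in M. Y \<omega> = m))"

definition gaussian_process :: "'w measure \<Rightarrow> 't set \<Rightarrow> ('t \<Rightarrow> 'w \<Rightarrow> real) \<Rightarrow> bool" where
  "gaussian_process M T Y \<longleftrightarrow>
     (\<forall>I c. finite I \<and> I \<subseteq> T \<longrightarrow> gaussian_rv M (\<lambda>\<omega>. \<Sum>t\<in>I. c t * Y t \<omega>))"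

text \<open>No path regularity is required: only the finite-dimensional laws matter here.\<close>

definition fractional_brownian_motion ::
    "'w measure \<Rightarrow> real \<Rightarrow> (real \<Rightarrow> 'w \<Rightarrow> real) \<Rightarrow> bool" where
  "fractional_brownian_motion M H B \<longleftrightarrow>
     gaussian_process M {0..} B \<and>
     (\<forall>t\<ge>0. (\<integral>\<omega>. B t \<omega> \<partial>M) = 0) \<and>
     (\<forall>s\<ge>0. \<forall>t\<ge>0. (\<integral>\<omega>. B s \<omega> * B t \<omega> \<partial>M)
        = (s powr (2 * H) + t powr (2 * H) - \<bar>t - s\<bar> powr (2 * H)) / 2)"

definition fgn :: "real \<Rightarrow> real \<Rightarrow> (real \<Rightarrow> 'w \<Rightarrow> real) \<Rightarrow> nat \<Rightarrow> 'w \<Rightarrow> real" where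
  "fgn H h B n \<omega> = h powr (- H) * (B (real (Suc n) * h) \<omega> - B (real n * h) \<omega>)"

definition fgn_cov :: "real \<Rightarrow> nat \<Rightarrow> nat \<Rightarrow> real" where
  "fgn_cov H i j =
     (\<bar>real i - real j + 1\<bar> powr (2 * H) + \<bar>real i - real j - 1\<bar> powr (2 * H)
       - 2 * \<bar>real i - real j\<bar> powr (2 * H)) / 2"

text \<open>\<open>N\<close>-by-\<open>N\<close> matrices are functions on \<open>nat \<times> nat\<close> of which only the entries with both
  indices below \<open>N\<close> are constrained.\<close>

definition cholesky_factor :: "nat \<Rightarrow> (nat \<Rightarrow> nat \<Rightarrow> real) \<Rightarrow> (nat \<Rightarrow> nat \<Rightarrow> real) \<Rightarrow> bool" where
  "cholesky_factor N S \<beta> \<longleftrightarrow>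
     (\<forall>n<N. \<forall>k<N. n < k \<longrightarrow> \<beta> n k = 0) \<and>
     (\<forall>n<N. \<beta> n n > 0) \<and>
     (\<forall>n<N. \<forall>m<N. S n m = (\<Sum>k\<le>min n m. \<beta> n k * \<beta> m k))"

definition inverse_matrices :: "nat \<Rightarrow> (nat \<Rightarrow> nat \<Rightarrow> real) \<Rightarrow> (nat \<Rightarrow> nat \<Rightarrow> real) \<Rightarrow> bool" where
  "inverse_matrices N \<beta> \<gamma> \<longleftrightarrow>
     (\<forall>n<N. \<forall>m<N. (\<Sum>k<N. \<beta> n k * \<gamma> k m) = (if n = m then 1 else 0)) \<and>
     (\<forall>n<N. \<forall>m<N. (\<Sum>k<N. \<gamma> n k * \<beta> k m) = (if n = m then 1 else 0))"

definition innovation ::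
    "(nat \<Rightarrow> nat \<Rightarrow> real) \<Rightarrow> (nat \<Rightarrow> 'w \<Rightarrow> real) \<Rightarrow> nat \<Rightarrow> 'w \<Rightarrow> real" where
  "innovation \<gamma> \<xi> n \<omega> = (\<Sum>k\<le>n. \<gamma> n k * \<xi> k \<omega>)"

text \<open>Generated by \<open>\<eta> 0, \<dots>, \<eta> (n - 1)\<close>; trivial for \<open>n = 0\<close>, and not augmented by null sets.\<close>

definition noise_filtration :: "'w measure \<Rightarrow> (nat \<Rightarrow> 'w \<Rightarrow> real) \<Rightarrow> nat \<Rightarrow> 'w measure" where
  "noise_filtration M \<eta> n =
     sigma (space M) {\<eta> k -` A \<inter> space M | k A. k < n \<and> A \<in> sets borel}"

definition vec_cond_exp ::
    "'w measure \<Rightarrow> 'w measure \<Rightarrow> ('w \<Rightarrow> real ^ 'd) \<Rightarrow> 'w \<Rightarrow> real ^ 'd" where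
  "vec_cond_exp M F Y \<omega> = (\<chi> i. real_cond_exp M F (\<lambda>\<omega>'. Y \<omega>' $ i) \<omega>)"

definition gradient :: "(real ^ 'n \<Rightarrow> real) \<Rightarrow> real ^ 'n \<Rightarrow> real ^ 'n" where
  "gradient f x = (\<chi> i. frechet_derivative f (at x) (axis i 1))"

text \<open>Evaluating the derivatives at elements of \<open>Basis\<close> gives the partial derivatives of \<open>f\<close>.\<close>

definition C2_bounded_lipschitz ::
    "real \<Rightarrow> real \<Rightarrow> ('a::euclidean_space \<Rightarrow> 'b::real_normed_vector) \<Rightarrow> bool" where
  "C2_bounded_lipschitz L K f \<longleftrightarrow>
     (\<exists>(D1 :: 'a \<Rightarrow> 'a \<Rightarrow>\<^sub>L 'b) (D2 :: 'a \<Rightarrow> 'a \<Rightarrow>\<^sub>L 'a \<Rightarrow>\<^sub>L 'b).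
        (\<forall>z. (f has_derivative blinfun_apply (D1 z)) (at z)) \<and>
        (\<forall>z. (D1 has_derivative blinfun_apply (D2 z)) (at z)) \<and>
        continuous_on UNIV D2 \<and>
        (\<forall>i\<in>Basis. (\<forall>z. norm (D1 z i) \<le> L) \<and> K-lipschitz_on UNIV (\<lambda>z. D1 z i)) \<and>
        (\<forall>i\<in>Basis. \<forall>j\<in>Basis.
           (\<forall>z. norm (D2 z i j) \<le> L) \<and> K-lipschitz_on UNIV (\<lambda>z. D2 z i j)))"

definition normal_cone :: "'a::real_inner set \<Rightarrow> 'a \<Rightarrow> 'a set" where
  "normal_cone U w = {z. w \<in> U \<and> (\<forall>y\<in>U. z \<bullet> (y - w) \<le> 0)}"

primrec state ::
    "real \<Rightarrow> (nat \<Rightarrow> real ^ 'd \<Rightarrow> real ^ 'p \<Rightarrow> real ^ 'd) \<Rightarrow> (nat \<Rightarrow> real ^ 'd \<Rightarrow> real ^ 'p \<Rightarrow> real ^ 'd)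
      \<Rightarrow> real ^ 'd \<Rightarrow> (nat \<Rightarrow> 'w \<Rightarrow> real) \<Rightarrow> (nat \<Rightarrow> 'w \<Rightarrow> real ^ 'p) \<Rightarrow> nat \<Rightarrow> 'w \<Rightarrow> real ^ 'd" where
  "state h b \<sigma> x0 \<xi> u 0 = (\<lambda>\<omega>. x0)"
| "state h b \<sigma> x0 \<xi> u (Suc n) = (\<lambda>\<omega>.
     let X = state h b \<sigma> x0 \<xi> u n \<omega>
     in X + h *\<^sub>R b n X (u n \<omega>) + (sqrt h * \<xi> n \<omega>) *\<^sub>R \<sigma> n X (u n \<omega>))"

definition cost ::
    "'w measure \<Rightarrow> nat \<Rightarrow> real \<Rightarrow> (nat \<Rightarrow> real ^ 'd \<Rightarrow> real ^ 'p \<Rightarrow> real ^ 'd)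
      \<Rightarrow> (nat \<Rightarrow> real ^ 'd \<Rightarrow> real ^ 'p \<Rightarrow> real ^ 'd) \<Rightarrow> real ^ 'd
      \<Rightarrow> (real ^ 'd \<Rightarrow> real) \<Rightarrow> (nat \<Rightarrow> real ^ 'd \<Rightarrow> real ^ 'p \<Rightarrow> real)
      \<Rightarrow> (nat \<Rightarrow> 'w \<Rightarrow> real) \<Rightarrow> (nat \<Rightarrow> 'w \<Rightarrow> real ^ 'p) \<Rightarrow> real" where
  "cost M N h b \<sigma> x0 \<Phi> l \<xi> u =
     (\<integral>\<omega>. \<Phi> (state h b \<sigma> x0 \<xi> u N \<omega>)
           + h * (\<Sum>n<N. l n (state h b \<sigma> x0 \<xi> u n \<omega>) (u n \<omega>)) \<partial>M)"

text \<open>Controls are represented by functions rather than almost-everywhere classes; only the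
  components with index below \<open>N\<close> matter.\<close>

definition adapted_controls ::
    "'w measure \<Rightarrow> (nat \<Rightarrow> 'w measure) \<Rightarrow> nat \<Rightarrow> (nat \<Rightarrow> 'w \<Rightarrow> real ^ 'p) set" where
  "adapted_controls M F N =
     {u. \<forall>n<N. u n \<in> borel_measurable (F n) \<and> integrable M (\<lambda>\<omega>. (norm (u n \<omega>))\<^sup>2)}"

definition control_norm ::
    "'w measure \<Rightarrow> nat \<Rightarrow> real \<Rightarrow> (nat \<Rightarrow> 'w \<Rightarrow> real ^ 'p) \<Rightarrow> real" where
  "control_norm M N h u = sqrt (h * (\<Sum>n<N. \<integral>\<omega>. (norm (u n \<omega>))\<^sup>2 \<partial>M))"

definition admissible_controls ::
    "'w measure \<Rightarrow> (nat \<Rightarrow> 'w measure) \<Rightarrow> nat \<Rightarrow> (real ^ 'p) set \<Rightarrow> (nat \<Rightarrow> 'w \<Rightarrow> real ^ 'p) set" where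
  "admissible_controls M F N U =
     {u \<in> adapted_controls M F N. \<forall>n<N. AE \<omega> in M. u n \<omega> \<in> U}"

definition local_minimiser ::
    "'w measure \<Rightarrow> (nat \<Rightarrow> 'w measure) \<Rightarrow> nat \<Rightarrow> real \<Rightarrow> (real ^ 'p) set
      \<Rightarrow> ((nat \<Rightarrow> 'w \<Rightarrow> real ^ 'p) \<Rightarrow> real) \<Rightarrow> (nat \<Rightarrow> 'w \<Rightarrow> real ^ 'p) \<Rightarrow> bool" where
  "local_minimiser M F N h U J u \<longleftrightarrow>
     u \<in> admissible_controls M F N U \<and>
     (\<exists>\<delta>>0. \<forall>w \<in> admissible_controls M F N U.
        control_norm M N h (\<lambda>n \<omega>. w n \<omega> - u n \<omega>) < \<delta> \<longrightarrow> J u \<le> J w)"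

definition perturb ::
    "(nat \<Rightarrow> 'w \<Rightarrow> real ^ 'p) \<Rightarrow> real \<Rightarrow> (nat \<Rightarrow> 'w \<Rightarrow> real ^ 'p) \<Rightarrow> nat \<Rightarrow> 'w \<Rightarrow> real ^ 'p" where
  "perturb u \<epsilon> v = (\<lambda>n \<omega>. u n \<omega> + \<epsilon> *\<^sub>R v n \<omega>)"

definition bounded_feasible_perturbation ::
    "'w measure \<Rightarrow> (nat \<Rightarrow> 'w measure) \<Rightarrow> nat \<Rightarrow> (real ^ 'p) set
      \<Rightarrow> (nat \<Rightarrow> 'w \<Rightarrow> real ^ 'p) \<Rightarrow> (nat \<Rightarrow> 'w \<Rightarrow> real ^ 'p) \<Rightarrow> bool" where
  "bounded_feasible_perturbation M F N U u v \<longleftrightarrow>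
     v \<in> adapted_controls M F N \<and>
     (\<exists>C. \<forall>n<N. AE \<omega> in M. norm (v n \<omega>) \<le> C) \<and>
     (\<forall>\<^sub>F \<epsilon> in at_right 0. perturb u \<epsilon> v \<in> admissible_controls M F N U)"

text \<open>The limit is two-sided in \<open>\<epsilon>\<close>.\<close>

definition has_directional_derivative ::
    "((nat \<Rightarrow> 'w \<Rightarrow> real ^ 'p) \<Rightarrow> real) \<Rightarrow> (nat \<Rightarrow> 'w \<Rightarrow> real ^ 'p) \<Rightarrow> (nat \<Rightarrow> 'w \<Rightarrow> real ^ 'p)
      \<Rightarrow> real \<Rightarrow> bool" where
  "has_directional_derivative J u v D \<longleftrightarrow>
     ((\<lambda>\<epsilon>. (J (perturb u \<epsilon> v) - J u) / \<epsilon>) \<longlongrightarrow> D) (at 0)"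

text \<open>Here \<open>X\<close> is the state along the control \<open>u\<close>, and \<open>\<zeta>\<close>, \<open>\<eta>\<close>, \<open>\<beta>\<close> are the predictable part,
  the innovations and the Cholesky factor of the noise.  All identities hold almost surely,
  so that any versions of the conditional expectations are allowed.\<close>

definition adjoint_solution ::
    "'w measure \<Rightarrow> (nat \<Rightarrow> 'w measure) \<Rightarrow> nat \<Rightarrow> real
      \<Rightarrow> (nat \<Rightarrow> real ^ 'd \<Rightarrow> real ^ 'p \<Rightarrow> real ^ 'd) \<Rightarrow> (nat \<Rightarrow> real ^ 'd \<Rightarrow> real ^ 'p \<Rightarrow> real ^ 'd)
      \<Rightarrow> (real ^ 'd \<Rightarrow> real) \<Rightarrow> (nat \<Rightarrow> real ^ 'd \<Rightarrow> real ^ 'p \<Rightarrow> real)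
      \<Rightarrow> (nat \<Rightarrow> nat \<Rightarrow> real) \<Rightarrow> (nat \<Rightarrow> 'w \<Rightarrow> real) \<Rightarrow> (nat \<Rightarrow> 'w \<Rightarrow> real)
      \<Rightarrow> (nat \<Rightarrow> 'w \<Rightarrow> real ^ 'd) \<Rightarrow> (nat \<Rightarrow> 'w \<Rightarrow> real ^ 'p)
      \<Rightarrow> (nat \<Rightarrow> 'w \<Rightarrow> real ^ 'd) \<Rightarrow> (nat \<Rightarrow> 'w \<Rightarrow> real ^ 'd) \<Rightarrow> (nat \<Rightarrow> 'w \<Rightarrow> real ^ 'd) \<Rightarrow> bool" where
  "adjoint_solution M F N h b \<sigma> \<Phi> l \<beta> \<eta> \<zeta> X u p pbar q \<longleftrightarrow>
     (\<forall>n\<le>N. p n \<in> borel_measurable (F n)) \<and>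
     (\<forall>n<N. pbar n \<in> borel_measurable (F n) \<and> q n \<in> borel_measurable (F n)) \<and>
     (AE \<omega> in M. p N \<omega> = gradient \<Phi> (X N \<omega>)) \<and>
     (\<forall>n<N. AE \<omega> in M. pbar n \<omega> = vec_cond_exp M (F n) (p (Suc n)) \<omega>) \<and>
     (\<forall>n<N. AE \<omega> in M. q n \<omega> = vec_cond_exp M (F n) (\<lambda>\<omega>'. \<eta> n \<omega>' *\<^sub>R p (Suc n) \<omega>') \<omega>) \<and>
     (\<forall>n<N. AE \<omega> in M.
        (let A = mat 1 + h *\<^sub>R jacobian (\<lambda>x. b n x (u n \<omega>)) (at (X n \<omega>));
             B = sqrt h *\<^sub>R jacobian (\<lambda>x. \<sigma> n x (u n \<omega>)) (at (X n \<omega>));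
             \<Lambda> = gradient (\<lambda>x. l n x (u n \<omega>)) (X n \<omega>)
         in p n \<omega> = transpose A *v pbar n \<omega>
                   + transpose B *v (\<zeta> n \<omega> *\<^sub>R pbar n \<omega> + \<beta> n n *\<^sub>R q n \<omega>)
                   + h *\<^sub>R \<Lambda>))"

end

theory Submission
  imports Defs
begin

text \<open>Let \<open>\<psi>\<close> solve the adjoint recursion pathwise, with \<open>\<xi> n *\<^sub>R \<psi> (n + 1)\<close> in place of
  \<open>\<zeta> n *\<^sub>R pbar n + \<beta> n n *\<^sub>R q n\<close> and without any conditioning. For fixed \<open>\<omega>\<close>, discrete summation by
  parts against the linearised state turns the derivative of the cost into \<open>h * (\<Sum>n<N. \<Gamma> n \<bullet> v n)\<close>,
  where \<open>\<Gamma> n\<close> is \<open>G n\<close> with the same replacement, and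
  a power of \<open>1 + (\<Sum>k<N. \<bar>\<xi> k\<bar>)\<close> dominates everything in sight, so differentiation passes under the
  expectation. The innovation \<open>\<eta> n\<close> has conditional mean zero given \<open>F n\<close>, hence
  \<open>\<xi> n = \<zeta> n + \<beta> n n * \<eta> n\<close>, and backward induction with the tower property shows that the adapted
  adjoint \<open>p n\<close> is the conditional expectation of \<open>\<psi> n\<close> given \<open>F n\<close>; likewise \<open>G n\<close> is that of \<open>\<Gamma> n\<close>.
  The normal cone inclusion follows by testing with truncated perturbations \<open>y - us n\<close>, for \<open>y\<close> in a
  countable dense subset of \<open>U\<close>, restricted to the event where the inequality would fail.\<close>

section \<open>Centred Gaussian families\<close>

text \<open>Two obstacles shape the proof. An adjoint solution comes with measurability but with no
  integrability of \<open>p\<close>, \<open>pbar\<close> and \<open>q\<close>, whereas pulling a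
  factor out of a conditional expectation requires integrable products. All estimates are therefore
  made for the pathwise adjoint, and the adapted processes are only compared with it almost
  everywhere. Moreover the noise is unbounded, so a time step is Lipschitz in the state only with a
  random constant; at most \<open>N\<close> such constants are multiplied, which is harmless because
  Gaussian variables have all moments. The Cholesky factorisation makes the innovations orthonormal.
  Passing from there to conditional mean zero uses joint Gaussianity, in the form of an equality of
  one-dimensional laws; independence itself is never established. The weight
  \<open>h powr (- 1 / 2)\<close> is the factor \<open>sqrt h\<close> of the noise term divided by
  the weight \<open>h\<close> of the control space. The interior case is read off from the cone
  inclusion, the normal cone at an interior point being trivial.\<close>

context prob_space
begin

text \<open>\<open>gaussian_rv\<close> admits constants, which do occur, for instance as the empty
  linear combination. The second moment is recorded because it tells the two cases apart.\<close>

lemma centred_gaussian_cases: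
  assumes "gaussian_rv M Y" and "expectation Y = 0"
  shows "(AE \<omega> in M. Y \<omega> = 0) \<and> expectation (\<lambda>\<omega>. (Y \<omega>)\<^sup>2) = 0
    \<or> (\<exists>s>0. distributed M lborel Y (normal_density 0 s) \<and> expectation (\<lambda>\<omega>. (Y \<omega>)\<^sup>2) = s\<^sup>2)"
proof -
  have [measurable]: "Y \<in> borel_measurable M" using assms by (simp add: gaussian_rv_def)
  consider m s where "s > 0" "distributed M lborel Y (normal_density m s)"
    | m where "AE \<omega> in M. Y \<omega> = m"
    using assms by (auto simp: gaussian_rv_def)
  then show ?thesis
  proof cases
    case 1
    then have "m = 0" using normal_distributed_expectation[OF 1] assms by simp
    then show ?thesis using 1 normal_distributed_variance[OF 1] assms(2) by auto
  next
    case 2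
    have "expectation Y = expectation (\<lambda>_. m)" using 2 by (intro integral_cong_AE) auto
    then have "m = 0" using assms by (simp add: prob_space)
    moreover have "expectation (\<lambda>\<omega>. (Y \<omega>)\<^sup>2) = expectation (\<lambda>_. m\<^sup>2)"
      using 2 by (intro integral_cong_AE) auto
    ultimately show ?thesis using 2 by auto
  qed
qed

text \<open>A centred Gaussian law is determined by its second moment. A degenerate variable cannot
  be paired with a nondegenerate one, since the latter has second moment \<open>s\<^sup>2\<close>
  with \<open>s > 0\<close>.\<close>

lemma centred_gaussian_same_law:
  fixes f :: "real \<Rightarrow> real"
  assumes "gaussian_rv M Y" "expectation Y = 0" "gaussian_rv M Z" "expectation Z = 0"
    and "expectation (\<lambda>\<omega>. (Y \<omega>)\<^sup>2) = expectation (\<lambda>\<omega>. (Z \<omega>)\<^sup>2)"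
    and [measurable]: "f \<in> borel_measurable borel"
  shows "expectation (\<lambda>\<omega>. f (Y \<omega>)) = expectation (\<lambda>\<omega>. f (Z \<omega>))"
proof -
  have [measurable]: "Y \<in> borel_measurable M" "Z \<in> borel_measurable M"
    using assms by (simp_all add: gaussian_rv_def)
  consider "AE \<omega> in M. Y \<omega> = 0" "AE \<omega> in M. Z \<omega> = 0"
    | s where "s > 0" "distributed M lborel Y (normal_density 0 s)" "distributed M lborel Z (normal_density 0 s)"
    using centred_gaussian_cases[OF assms(1,2)] centred_gaussian_cases[OF assms(3,4)] assms(5)
    by (smt (verit) power2_eq_imp_eq zero_eq_power2)
  then show ?thesis
  proof cases
    case 1
    have "AE \<omega> in M. f (Y \<omega>) = f (Z \<omega>)" using 1 by eventually_elim simp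
    then show ?thesis by (intro integral_cong_AE) auto
  next
    case 2
    show ?thesis
      using distributed_integral[OF 2(2), of f] distributed_integral[OF 2(3), of f] by simp
  qed
qed

lemma centred_gaussian_moments:
  assumes "gaussian_rv M Y" "expectation Y = 0"
  shows "integrable M (\<lambda>\<omega>. \<bar>Y \<omega>\<bar> ^ k)"
proof -
  have [measurable]: "Y \<in> borel_measurable M" using assms by (simp add: gaussian_rv_def)
  consider "AE \<omega> in M. Y \<omega> = 0" | s where "s > 0" "distributed M lborel Y (normal_density 0 s)"
    using centred_gaussian_cases[OF assms] by auto
  then show ?thesis
  proof cases
    case 1
    \<comment> \<open>The constant stays \<open>0 ^ k\<close> because it equals 1 for
      \<open>k = 0\<close>.\<close>
    then have "AE \<omega> in M. \<bar>Y \<omega>\<bar> ^ k = 0 ^ k" by eventually_elim simp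
    then have "integrable M (\<lambda>\<omega>. \<bar>Y \<omega>\<bar> ^ k) \<longleftrightarrow> integrable M (\<lambda>\<omega>. 0 ^ k :: real)"
      by (intro integrable_cong_AE) auto
    then show ?thesis by simp
  next
    case 2
    show ?thesis
      using distributed_integrable[OF 2(2), of "\<lambda>x. \<bar>x\<bar> ^ k"] integrable_normal_moment_abs[OF 2(1), of 0 k]
      by simp
  qed
qed

lemma integrable_power_add:
  fixes f g :: "'a \<Rightarrow> real"
  assumes [measurable]: "f \<in> borel_measurable M" "g \<in> borel_measurable M"
    and "\<And>\<omega>. 0 \<le> f \<omega>" "\<And>\<omega>. 0 \<le> g \<omega>"
    and "integrable M (\<lambda>\<omega>. f \<omega> ^ k)" "integrable M (\<lambda>\<omega>. g \<omega> ^ k)"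
  shows "integrable M (\<lambda>\<omega>. (f \<omega> + g \<omega>) ^ k)"
proof (rule Bochner_Integration.integrable_bound)
  show "integrable M (\<lambda>\<omega>. 2 ^ k * (f \<omega> ^ k + g \<omega> ^ k))" using assms by simp
  have "(f \<omega> + g \<omega>) ^ k \<le> 2 ^ k * (f \<omega> ^ k + g \<omega> ^ k)" for \<omega>
  proof -
    have "(f \<omega> + g \<omega>) ^ k \<le> (2 * max (f \<omega>) (g \<omega>)) ^ k"
      using assms(3,4)[of \<omega>] by (intro power_mono) auto
    also have "\<dots> \<le> 2 ^ k * (f \<omega> ^ k + g \<omega> ^ k)"
      using assms(3,4)[of \<omega>] by (auto simp: power_mult_distrib max_def)
    finally show ?thesis .
  qed
  then show "AE \<omega> in M. norm ((f \<omega> + g \<omega>) ^ k) \<le> norm (2 ^ k * (f \<omega> ^ k + g \<omega> ^ k))"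
    using assms(3,4) by (intro always_eventually allI) (simp add: order_trans[OF _ abs_ge_self])
qed measurable

lemma integrable_power_sum:
  fixes f :: "'b \<Rightarrow> 'a \<Rightarrow> real"
  assumes "finite I"
    and "\<And>i. i \<in> I \<Longrightarrow> f i \<in> borel_measurable M"
    and "\<And>i \<omega>. i \<in> I \<Longrightarrow> 0 \<le> f i \<omega>"
    and "\<And>i. i \<in> I \<Longrightarrow> integrable M (\<lambda>\<omega>. f i \<omega> ^ k)"
  shows "integrable M (\<lambda>\<omega>. (1 + (\<Sum>i\<in>I. f i \<omega>)) ^ k)"
  using assms
proof (induction I rule: finite_induct)
  case (insert i I)
  have "integrable M (\<lambda>\<omega>. ((1 + (\<Sum>i\<in>I. f i \<omega>)) + f i \<omega>) ^ k)"
    by (rule integrable_power_add)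
      (use insert in \<open>auto intro!: add_nonneg_nonneg sum_nonneg borel_measurable_add borel_measurable_sum\<close>)
  then show ?case using insert by (simp add: algebra_simps)
qed simp

section \<open>Uniqueness of Fourier transforms for weighted laws\<close>

text \<open>The density \<open>1 + W\<close> defines a second probability measure under which \<open>Y\<close> has the same
  characteristic function, so Levy's uniqueness theorem applies.\<close>

lemma integral_indicator_eq_0_if_fourier:
  fixes W Y :: "'a \<Rightarrow> real"
  assumes [measurable]: "W \<in> borel_measurable M" "Y \<in> borel_measurable M"
    and bound: "\<And>\<omega>. \<bar>W \<omega>\<bar> \<le> 1"
    and c: "\<And>t. expectation (\<lambda>\<omega>. W \<omega> * cos (t * Y \<omega>)) = 0"
    and s: "\<And>t. expectation (\<lambda>\<omega>. W \<omega> * sin (t * Y \<omega>)) = 0"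
    and [measurable]: "A \<in> sets borel"
  shows "expectation (\<lambda>\<omega>. W \<omega> * indicator A (Y \<omega>)) = 0"
proof -
  define P where "P = density M (\<lambda>\<omega>. ennreal (1 + W \<omega>))"
  have nn: "0 \<le> 1 + W \<omega>" for \<omega> using bound[of \<omega>] by (simp add: abs_le_iff)
  have P_int: "(\<integral>\<omega>. g \<omega> \<partial>P) = expectation g + expectation (\<lambda>\<omega>. W \<omega> * g \<omega>)"
    if [measurable]: "g \<in> borel_measurable M" and g: "\<And>\<omega>. \<bar>g \<omega>\<bar> \<le> 1" for g :: "'a \<Rightarrow> real"
  proof -
    have "\<bar>W \<omega> * g \<omega>\<bar> \<le> 1" for \<omega>
      using mult_mono[OF bound[of \<omega>] g[of \<omega>]] by (simp add: abs_mult)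
    then have "integrable M g" "integrable M (\<lambda>\<omega>. W \<omega> * g \<omega>)"
      using g by (auto intro!: integrable_const_bound[where B = 1])
    then have "expectation (\<lambda>\<omega>. g \<omega> + W \<omega> * g \<omega>) = expectation g + expectation (\<lambda>\<omega>. W \<omega> * g \<omega>)" by simp
    then show ?thesis unfolding P_def
      by (subst integral_real_density) (use nn in \<open>auto simp: algebra_simps\<close>)
  qed
  \<comment> \<open>The cosine hypothesis at frequency 0 gives \<open>W\<close> mean zero, so that
    \<open>P\<close> has total mass one.\<close>
  have W0: "expectation W = 0" using c[of 0] by simp
  have iW: "integrable M W" using bound by (auto intro!: integrable_const_bound[where B = 1])
  have "prob_space P"
  proof
    have "emeasure P (space P) = (\<integral>\<^sup>+ \<omega>. ennreal (1 + W \<omega>) \<partial>M)"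
      by (simp add: P_def emeasure_density cong: nn_integral_cong)
    also have "\<dots> = ennreal (expectation (\<lambda>\<omega>. 1 + W \<omega>))"
      using iW nn by (intro nn_integral_eq_integral) auto
    also have "\<dots> = 1" using iW W0 by (simp add: prob_space)
    finally show "emeasure P (space P) = 1" .
  qed
  then interpret P: prob_space P .
  have [measurable]: "Y \<in> borel_measurable P" by (simp add: P_def)
  interpret dM: real_distribution "distr M borel Y" by (rule real_distribution_distr) simp
  interpret dP: real_distribution "distr P borel Y" by (rule P.real_distribution_distr) simp
  have "char (distr M borel Y) t = char (distr P borel Y) t" for t
  proof -
    have *: "char (distr Q borel Y) t = Complex (\<integral>\<omega>. cos (t * Y \<omega>) \<partial>Q) (\<integral>\<omega>. sin (t * Y \<omega>) \<partial>Q)"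
      if "prob_space Q" and [measurable]: "Y \<in> borel_measurable Q" for Q
    proof -
      interpret Q: prob_space Q by fact
      have i: "integrable Q (\<lambda>\<omega>. iexp (t * Y \<omega>))"
        by (rule Q.integrable_const_bound[where B = 1]) (auto simp: cis_conv_exp[symmetric])
      have "char (distr Q borel Y) t = (CLINT \<omega>|Q. iexp (t * Y \<omega>))"
        unfolding char_def by (subst integral_distr) auto
      moreover have "Re (CLINT \<omega>|Q. iexp (t * Y \<omega>)) = (\<integral>\<omega>. cos (t * Y \<omega>) \<partial>Q)"
        using integral_Re[OF i] by (simp add: Re_exp)
      moreover have "Im (CLINT \<omega>|Q. iexp (t * Y \<omega>)) = (\<integral>\<omega>. sin (t * Y \<omega>) \<partial>Q)"
        using integral_Im[OF i] by (simp add: Im_exp)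
      ultimately show ?thesis by (simp add: complex_eq_iff)
    qed
    show ?thesis
      by (simp add: *[OF prob_space_axioms] *[OF P.prob_space_axioms] P_int c s)
  qed
  then have "distr M borel Y = distr P borel Y"
    by (intro Levy_uniqueness dM.real_distribution_axioms dP.real_distribution_axioms ext)
  moreover have "(\<integral>\<omega>. indicat_real A (Y \<omega>) \<partial>Q) = (\<integral>x. indicat_real A x \<partial>distr Q borel Y)"
    if "Y \<in> borel_measurable Q" for Q :: "'a measure"
    using that by (subst integral_distr) auto
  ultimately have "(\<integral>\<omega>. indicat_real A (Y \<omega>) \<partial>P) = expectation (\<lambda>\<omega>. indicat_real A (Y \<omega>))"
    by simp
  \<comment> \<open>By \<open>P_int\<close> the two integrals of the indicator differ exactly by its
    integral against \<open>W\<close>.\<close>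
  then show ?thesis using P_int[of "\<lambda>\<omega>. indicator A (Y \<omega>)"] by (auto simp: indicator_def)
qed

text \<open>Induction on the number of variables, for all weights at once. With the first
  \<open>n\<close> frequencies fixed, \<open>W\<close> times the cosine or sine of their combination
  is again a bounded weight, and the one-variable lemma trades the frequency of \<open>Y n\<close>
  for an indicator. This indicator is then absorbed into the weight to which the induction
  hypothesis is applied.\<close>

lemma integral_prod_indicator_eq_0_if_fourier:
  fixes W :: "'a \<Rightarrow> real" and Y :: "nat \<Rightarrow> 'a \<Rightarrow> real"
  assumes "W \<in> borel_measurable M" and [measurable]: "\<And>k. Y k \<in> borel_measurable M"
    and "\<And>\<omega>. \<bar>W \<omega>\<bar> \<le> 1"
    and "\<And>t. expectation (\<lambda>\<omega>. W \<omega> * cos (\<Sum>k<n. t k * Y k \<omega>)) = 0"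
    and "\<And>t. expectation (\<lambda>\<omega>. W \<omega> * sin (\<Sum>k<n. t k * Y k \<omega>)) = 0"
    and [measurable]: "\<And>k. A k \<in> sets borel"
  shows "expectation (\<lambda>\<omega>. W \<omega> * (\<Prod>k<n. indicator (A k) (Y k \<omega>))) = 0"
  using assms(1,3,4,5)
proof (induction n arbitrary: W)
  case 0
  then show ?case using "0.prems"(3) by simp
next
  case (Suc n)
  note [measurable] = Suc.prems(1)
  note bound = Suc.prems(2)
  let ?Z = "\<lambda>t \<omega>. \<Sum>k<n. t k * Y k \<omega>"
  have iW: "integrable M (\<lambda>\<omega>. W \<omega> * g \<omega>)" if [measurable]: "g \<in> borel_measurable M" and g: "\<And>\<omega>. \<bar>g \<omega>\<bar> \<le> 1" for g
  proof -
    have "\<bar>W \<omega> * g \<omega>\<bar> \<le> 1" for \<omega>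
      using mult_mono[OF bound[of \<omega>] g[of \<omega>]] by (simp add: abs_mult)
    then show ?thesis by (auto intro!: integrable_const_bound[where B = 1])
  qed
  \<comment> \<open>Setting the last frequency to \<open>s\<close> splits \<open>Y n\<close> off the
    sum; product-to-sum formulas then reduce the products of trigonometric functions below to these
    integrals.\<close>
  have ext: "expectation (\<lambda>\<omega>. W \<omega> * cos (?Z t \<omega> + s * Y n \<omega>)) = 0"
      "expectation (\<lambda>\<omega>. W \<omega> * sin (?Z t \<omega> + s * Y n \<omega>)) = 0" for t s
    using Suc.prems(3,4)[of "t(n := s)"] by simp_all
  have ext': "expectation (\<lambda>\<omega>. W \<omega> * cos (?Z t \<omega> - s * Y n \<omega>)) = 0"
      "expectation (\<lambda>\<omega>. W \<omega> * sin (?Z t \<omega> - s * Y n \<omega>)) = 0" for t s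
    using ext[of t "- s"] by simp_all
  have split: "expectation (\<lambda>\<omega>. (W \<omega> * f \<omega> + a * (W \<omega> * g \<omega>)) / 2) = 0"
    if "f \<in> borel_measurable M" "\<And>\<omega>. \<bar>f \<omega>\<bar> \<le> 1" "g \<in> borel_measurable M" "\<And>\<omega>. \<bar>g \<omega>\<bar> \<le> 1"
      "expectation (\<lambda>\<omega>. W \<omega> * f \<omega>) = 0" "expectation (\<lambda>\<omega>. W \<omega> * g \<omega>) = 0" for f g and a :: real
    using iW[OF that(1,2)] iW[OF that(3,4)] that(5,6) by simp
  have cosZ: "expectation (\<lambda>\<omega>. W \<omega> * cos (?Z t \<omega>) * indicator (A n) (Y n \<omega>)) = 0" for t
  proof (rule integral_indicator_eq_0_if_fourier)
    show "\<bar>W \<omega> * cos (?Z t \<omega>)\<bar> \<le> 1" for \<omega>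
      using mult_mono[OF bound[of \<omega>] abs_cos_le_one] by (simp add: abs_mult)
    show "expectation (\<lambda>\<omega>. W \<omega> * cos (?Z t \<omega>) * cos (s * Y n \<omega>)) = 0" for s
      using split[of "\<lambda>\<omega>. cos (?Z t \<omega> - s * Y n \<omega>)" "\<lambda>\<omega>. cos (?Z t \<omega> + s * Y n \<omega>)" 1] ext[of t s] ext'[of t s]
      by (simp add: mult.assoc cos_times_cos distrib_left)
    show "expectation (\<lambda>\<omega>. W \<omega> * cos (?Z t \<omega>) * sin (s * Y n \<omega>)) = 0" for s
      using split[of "\<lambda>\<omega>. sin (?Z t \<omega> + s * Y n \<omega>)" "\<lambda>\<omega>. sin (?Z t \<omega> - s * Y n \<omega>)" "-1"] ext[of t s] ext'[of t s]
      by (simp add: mult.assoc cos_times_sin right_diff_distrib)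
  qed simp_all
  have sinZ: "expectation (\<lambda>\<omega>. W \<omega> * sin (?Z t \<omega>) * indicator (A n) (Y n \<omega>)) = 0" for t
  proof (rule integral_indicator_eq_0_if_fourier)
    show "\<bar>W \<omega> * sin (?Z t \<omega>)\<bar> \<le> 1" for \<omega>
      using mult_mono[OF bound[of \<omega>] abs_sin_le_one] by (simp add: abs_mult)
    show "expectation (\<lambda>\<omega>. W \<omega> * sin (?Z t \<omega>) * cos (s * Y n \<omega>)) = 0" for s
      using split[of "\<lambda>\<omega>. sin (?Z t \<omega> + s * Y n \<omega>)" "\<lambda>\<omega>. sin (?Z t \<omega> - s * Y n \<omega>)" 1] ext[of t s] ext'[of t s]
      by (simp add: mult.assoc sin_times_cos distrib_left)
    show "expectation (\<lambda>\<omega>. W \<omega> * sin (?Z t \<omega>) * sin (s * Y n \<omega>)) = 0" for s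
      using split[of "\<lambda>\<omega>. cos (?Z t \<omega> - s * Y n \<omega>)" "\<lambda>\<omega>. cos (?Z t \<omega> + s * Y n \<omega>)" "-1"] ext[of t s] ext'[of t s]
      by (simp add: mult.assoc sin_times_sin right_diff_distrib)
  qed simp_all
  have "expectation (\<lambda>\<omega>. W \<omega> * indicator (A n) (Y n \<omega>) * (\<Prod>k<n. indicator (A k) (Y k \<omega>))) = 0"
  proof (rule Suc.IH)
    show "\<bar>W \<omega> * indicator (A n) (Y n \<omega>)\<bar> \<le> 1" for \<omega> using bound[of \<omega>] by (simp add: indicator_def)
  qed (use cosZ sinZ in \<open>simp_all add: ac_simps\<close>)
  then show ?case by (simp add: ac_simps)
qed

end

section \<open>The filtration generated by a sequence of random variables\<close>

lemma space_noise_filtration [simp]: "space (noise_filtration M Y n) = space M"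
  by (simp add: noise_filtration_def space_measure_of_conv)

lemma sets_noise_filtration:
  "sets (noise_filtration M Y n) =
    sigma_sets (space M) {Y k -` A \<inter> space M | k A. k < n \<and> A \<in> sets borel}"
  unfolding noise_filtration_def by (rule sets_measure_of) auto

lemma measurable_noise_filtration:
  "k < n \<Longrightarrow> Y k \<in> borel_measurable (noise_filtration M Y n)"
  unfolding measurable_def by (auto simp: sets_noise_filtration)

lemma subalgebra_noise_filtration:
  assumes "\<And>k. k < n \<Longrightarrow> Y k \<in> borel_measurable M"
  shows "subalgebra M (noise_filtration M Y n)"
  unfolding subalgebra_def sets_noise_filtration
  using assms by (auto intro!: sets.sigma_sets_subset measurable_sets)

lemma subalgebra_noise_filtration_mono:
  assumes "m \<le> n"
  shows "subalgebra (noise_filtration M Y n) (noise_filtration M Y m)"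
proof -
  have "sets (noise_filtration M Y m) \<subseteq> sets (noise_filtration M Y n)"
    unfolding sets_noise_filtration by (rule sigma_sets_mono') (use assms in fastforce)
  then show ?thesis by (simp add: subalgebra_def)
qed

text \<open>Dynkin argument: the cylinder sets generate the sigma-algebra and are stable under
  intersection, and the events over which \<open>W\<close> integrates to zero are closed under
  complements, as \<open>W\<close> has mean zero, and under countable disjoint unions.\<close>

lemma (in prob_space) integral_indicator_filtration_eq_0_if_fourier:
  fixes W :: "'a \<Rightarrow> real" and Y :: "nat \<Rightarrow> 'a \<Rightarrow> real"
  assumes [measurable]: "W \<in> borel_measurable M" and [measurable]: "\<And>k. Y k \<in> borel_measurable M"
    and bound: "\<And>\<omega>. \<bar>W \<omega>\<bar> \<le> 1"
    and c: "\<And>t. expectation (\<lambda>\<omega>. W \<omega> * cos (\<Sum>k<n. t k * Y k \<omega>)) = 0"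
    and s: "\<And>t. expectation (\<lambda>\<omega>. W \<omega> * sin (\<Sum>k<n. t k * Y k \<omega>)) = 0"
    and A: "A \<in> sets (noise_filtration M Y n)"
  shows "expectation (\<lambda>\<omega>. W \<omega> * indicator A \<omega>) = 0"
proof -
  define \<G> where "\<G> = {{\<omega> \<in> space M. \<forall>k<n. Y k \<omega> \<in> A k} | A. \<forall>k. A k \<in> sets borel}"
  have G_sub: "\<G> \<subseteq> sets M" unfolding \<G>_def by auto
  have stable: "Int_stable \<G>"
  proof (rule Int_stableI)
    fix a b assume "a \<in> \<G>" "b \<in> \<G>"
    then obtain A B where "\<forall>k. A k \<in> sets borel" "\<forall>k. B k \<in> sets borel"
      and ab: "a = {\<omega> \<in> space M. \<forall>k<n. Y k \<omega> \<in> A k}" "b = {\<omega> \<in> space M. \<forall>k<n. Y k \<omega> \<in> B k}"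
      unfolding \<G>_def by blast
    then have "\<forall>k. A k \<inter> B k \<in> sets borel" by blast
    moreover have "a \<inter> b = {\<omega> \<in> space M. \<forall>k<n. Y k \<omega> \<in> A k \<inter> B k}" unfolding ab by blast
    ultimately show "a \<inter> b \<in> \<G>"
      unfolding \<G>_def by (intro CollectI exI[of _ "\<lambda>k. A k \<inter> B k"] conjI)
  qed
  have "{Y k -` A \<inter> space M | k A. k < n \<and> A \<in> sets borel} \<subseteq> \<G>"
  proof clarify
    fix k and A :: "real set" assume "k < n" "A \<in> sets borel"
    then have "Y k -` A \<inter> space M = {\<omega> \<in> space M. \<forall>j<n. Y j \<omega> \<in> (if j = k then A else UNIV)}"
      "\<forall>j. (if j = k then A else UNIV) \<in> sets borel" by auto
    then show "Y k -` A \<inter> space M \<in> \<G>"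
      unfolding \<G>_def by (intro CollectI exI[of _ "\<lambda>j. if j = k then A else UNIV"] conjI)
  qed
  then have A: "A \<in> sigma_sets (space M) \<G>"
    using A sigma_sets_mono' unfolding sets_noise_filtration by blast
  have sub: "sigma_sets (space M) \<G> \<subseteq> sets M"
    using G_sub by (rule sets.sigma_sets_subset)
  have int: "integrable M (\<lambda>\<omega>. W \<omega> * indicator a \<omega>)" if [measurable]: "a \<in> sets M" for a
    by (rule integrable_const_bound[where B = 1]) (use bound in \<open>auto simp: indicator_def\<close>)
  have basic: "expectation (\<lambda>\<omega>. W \<omega> * indicator a \<omega>) = 0" if "a \<in> \<G>" for a
  proof -
    from that obtain A where A [measurable]: "\<And>k. A k \<in> sets borel" and
      a: "a = {\<omega> \<in> space M. \<forall>k<n. Y k \<omega> \<in> A k}"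
      by (auto simp: \<G>_def)
    have "expectation (\<lambda>\<omega>. W \<omega> * indicator a \<omega>) = expectation (\<lambda>\<omega>. W \<omega> * (\<Prod>k<n. indicator (A k) (Y k \<omega>)))"
      by (intro Bochner_Integration.integral_cong refl arg_cong2[where f = "(*)"])
        (auto simp: a indicator_def prod.neutral)
    also have "\<dots> = 0" by (rule integral_prod_indicator_eq_0_if_fourier[OF _ _ bound c s]) auto
    finally show ?thesis .
  qed
  have W0: "expectation W = 0" using c[of "\<lambda>_. 0"] by simp
  have iW: "integrable M W" by (rule integrable_const_bound[where B = 1]) (simp_all add: bound)
  show ?thesis
  proof (rule sigma_sets_induct_disjoint[OF stable _ A])
    show "\<G> \<subseteq> Pow (space M)" using G_sub sets.sets_into_space by blast
    show "expectation (\<lambda>\<omega>. W \<omega> * indicator {} \<omega>) = 0" by simp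
  next
    fix a assume a: "a \<in> sigma_sets (space M) \<G>" "expectation (\<lambda>\<omega>. W \<omega> * indicator a \<omega>) = 0"
    have "expectation (\<lambda>\<omega>. W \<omega> * indicator (space M - a) \<omega>) = expectation (\<lambda>\<omega>. W \<omega> - W \<omega> * indicator a \<omega>)"
      by (intro Bochner_Integration.integral_cong) (auto simp: indicator_def)
    also have "\<dots> = 0"
      using int[of a] iW a sub W0 by (subst Bochner_Integration.integral_diff) auto
    finally show "expectation (\<lambda>\<omega>. W \<omega> * indicator (space M - a) \<omega>) = 0" .
  next
    fix a :: "nat \<Rightarrow> 'a set"
    assume a: "disjoint_family a" "range a \<subseteq> sigma_sets (space M) \<G>"
      "\<And>i. expectation (\<lambda>\<omega>. W \<omega> * indicator (a i) \<omega>) = 0"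
    have ai: "a i \<in> events" for i using a(2) sub by blast
    have "(LINT x:(\<Union>i. a i)|M. W x) = (\<Sum>i. (LINT x:(a i)|M. W x))"
    proof (rule lebesgue_integral_countable_add)
      show "set_integrable M (\<Union>i. a i) W"
        using int[of "\<Union>i. a i"] ai by (auto simp: set_integrable_def mult.commute)
    qed (use a(1) ai in \<open>auto simp: disjoint_family_on_def\<close>)
    then show "expectation (\<lambda>\<omega>. W \<omega> * indicator (\<Union>i. a i) \<omega>) = 0"
      using a(3) by (simp add: set_lebesgue_integral_def mult.commute)
  qed (rule basic)
qed

text \<open>By symmetry \<open>s * Z + S\<close> and \<open>- s * Z + S\<close> have the same law for every combination \<open>S\<close> of the \<open>Y k\<close>,
  which makes \<open>sin (s * Z)\<close> orthogonal to all events of the filtration; then let \<open>s\<close> tend to \<open>0\<close>.\<close>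

lemma (in prob_space) cond_exp_orthogonal_gaussian:
  fixes Z :: "'a \<Rightarrow> real" and Y :: "nat \<Rightarrow> 'a \<Rightarrow> real"
  assumes gauss: "\<And>s t. gaussian_rv M (\<lambda>\<omega>. s * Z \<omega> + (\<Sum>k<n. t k * Y k \<omega>))"
    and Ym [measurable]: "\<And>k. Y k \<in> borel_measurable M"
    and mean: "\<And>s t. expectation (\<lambda>\<omega>. s * Z \<omega> + (\<Sum>k<n. t k * Y k \<omega>)) = 0"
    and orth: "\<And>t. expectation (\<lambda>\<omega>. Z \<omega> * (\<Sum>k<n. t k * Y k \<omega>)) = 0"
  shows "AE \<omega> in M. real_cond_exp M (noise_filtration M Y n) Z \<omega> = 0"
proof -
  let ?F = "noise_filtration M Y n"
  let ?S = "\<lambda>t \<omega>. \<Sum>k<n. t k * Y k \<omega>"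
  interpret finite_measure_subalgebra M ?F
    by unfold_locales (intro subalgebra_noise_filtration Ym)
  have gZ: "gaussian_rv M Z" "expectation Z = 0"
    using gauss[of 1 "\<lambda>_. 0"] mean[of 1 "\<lambda>_. 0"] by simp_all
  have gS: "gaussian_rv M (?S t)" and mS: "expectation (?S t) = 0" for t
    using gauss[of 0 t] mean[of 0 t] by simp_all
  have [measurable]: "Z \<in> borel_measurable M" using gZ by (simp add: gaussian_rv_def)
  have iZ: "integrable M Z"
    using centred_gaussian_moments[OF gZ, of 1] by (simp add: integrable_abs_iff)
  have sq: "integrable M (\<lambda>\<omega>. (Z \<omega>)\<^sup>2)" "integrable M (\<lambda>\<omega>. (?S t \<omega>)\<^sup>2)" for t
    using centred_gaussian_moments[OF gZ, of 2] centred_gaussian_moments[OF gS mS, where k = 2] by simp_all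
  have prod: "integrable M (\<lambda>\<omega>. Z \<omega> * ?S t \<omega>)" for t
  proof (rule Bochner_Integration.integrable_bound)
    show "integrable M (\<lambda>\<omega>. (Z \<omega>)\<^sup>2 + (?S t \<omega>)\<^sup>2)" using sq by simp
    have "\<bar>x * y\<bar> \<le> x\<^sup>2 + y\<^sup>2" for x y :: real
    proof -
      have "2 * \<bar>x * y\<bar> \<le> x\<^sup>2 + y\<^sup>2" using sum_squares_bound[of "\<bar>x\<bar>" "\<bar>y\<bar>"] by (simp add: abs_mult)
      then show ?thesis using zero_le_power2[of x] zero_le_power2[of y] by linarith
    qed
    then show "AE \<omega> in M. norm (Z \<omega> * ?S t \<omega>) \<le> norm ((Z \<omega>)\<^sup>2 + (?S t \<omega>)\<^sup>2)"
      by (intro always_eventually allI) (simp add: order_trans[OF _ abs_ge_self])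
  qed simp
  \<comment> \<open>Orthogonality removes the cross term, so the second moment depends on
    \<open>s\<close> only through \<open>s\<^sup>2\<close> and is unchanged under
    \<open>s \<mapsto> - s\<close>.\<close>
  have second: "expectation (\<lambda>\<omega>. (s * Z \<omega> + ?S t \<omega>)\<^sup>2) = s\<^sup>2 * expectation (\<lambda>\<omega>. (Z \<omega>)\<^sup>2) + expectation (\<lambda>\<omega>. (?S t \<omega>)\<^sup>2)" for s t
  proof -
    have "expectation (\<lambda>\<omega>. (s * Z \<omega> + ?S t \<omega>)\<^sup>2)
      = expectation (\<lambda>\<omega>. s\<^sup>2 * (Z \<omega>)\<^sup>2 + 2 * s * (Z \<omega> * ?S t \<omega>) + (?S t \<omega>)\<^sup>2)"
      by (simp add: power2_sum power_mult_distrib algebra_simps)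
    also have "\<dots> = s\<^sup>2 * expectation (\<lambda>\<omega>. (Z \<omega>)\<^sup>2) + 2 * s * expectation (\<lambda>\<omega>. Z \<omega> * ?S t \<omega>) + expectation (\<lambda>\<omega>. (?S t \<omega>)\<^sup>2)"
      using sq(1) sq(2)[of t] prod[of t] by simp
    finally show ?thesis using orth[of t] by simp
  qed
  have law: "expectation (\<lambda>\<omega>. f (s * Z \<omega> + ?S t \<omega>)) = expectation (\<lambda>\<omega>. f ((- s) * Z \<omega> + ?S t \<omega>))"
    if "f \<in> borel_measurable borel" for f :: "real \<Rightarrow> real" and s t
  proof -
    have "expectation (\<lambda>\<omega>. (s * Z \<omega> + ?S t \<omega>)\<^sup>2) = expectation (\<lambda>\<omega>. ((- s) * Z \<omega> + ?S t \<omega>)\<^sup>2)"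
      by (simp only: second power2_minus)
    then show ?thesis by (rule centred_gaussian_same_law[OF gauss mean gauss mean _ that])
  qed
  have bnd: "integrable M (\<lambda>\<omega>. sin (Q \<omega>))" "integrable M (\<lambda>\<omega>. cos (Q \<omega>))"
    if "Q \<in> borel_measurable M" for Q :: "'a \<Rightarrow> real"
    using that by (auto intro!: integrable_const_bound[where B = 1])
  \<comment> \<open>The Fourier lemma needs a weight bounded by 1, which \<open>Z\<close> is not but
    \<open>sin (s * Z)\<close> is. Its products with \<open>cos\<close> and \<open>sin\<close> of a
    combination are half differences of functions of \<open>s * Z + S\<close> and
    \<open>- s * Z + S\<close>, which have equal expectations.\<close>
  have zero: "expectation (\<lambda>\<omega>. sin (s * Z \<omega>) * indicator A \<omega>) = 0" if "A \<in> sets ?F" for s A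
  proof (rule integral_indicator_filtration_eq_0_if_fourier[OF _ _ _ _ _ that])
    fix t
    have "expectation (\<lambda>\<omega>. sin (s * Z \<omega>) * cos (?S t \<omega>))
      = expectation (\<lambda>\<omega>. (sin (s * Z \<omega> + ?S t \<omega>) - sin ((- s) * Z \<omega> + ?S t \<omega>)) / 2)"
      by (intro Bochner_Integration.integral_cong refl) (simp add: sin_add sin_diff)
    also have "\<dots> = (expectation (\<lambda>\<omega>. sin (s * Z \<omega> + ?S t \<omega>)) - expectation (\<lambda>\<omega>. sin ((- s) * Z \<omega> + ?S t \<omega>))) / 2"
      using bnd by simp
    also have "\<dots> = 0" using law[of sin s t] by simp
    finally show "expectation (\<lambda>\<omega>. sin (s * Z \<omega>) * cos (?S t \<omega>)) = 0" .
    have "expectation (\<lambda>\<omega>. sin (s * Z \<omega>) * sin (?S t \<omega>))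
      = expectation (\<lambda>\<omega>. (cos ((- s) * Z \<omega> + ?S t \<omega>) - cos (s * Z \<omega> + ?S t \<omega>)) / 2)"
      by (intro Bochner_Integration.integral_cong refl) (simp add: cos_add cos_diff)
    also have "\<dots> = (expectation (\<lambda>\<omega>. cos ((- s) * Z \<omega> + ?S t \<omega>)) - expectation (\<lambda>\<omega>. cos (s * Z \<omega> + ?S t \<omega>))) / 2"
      using bnd by simp
    also have "\<dots> = 0" using law[of cos s t] by simp
    finally show "expectation (\<lambda>\<omega>. sin (s * Z \<omega>) * sin (?S t \<omega>)) = 0" .
  qed simp_all
  show ?thesis
  proof (rule real_cond_exp_charact)
    fix A assume A: "A \<in> sets ?F"
    then have [measurable]: "A \<in> sets M" using subalg by (auto simp: subalgebra_def)
    \<comment> \<open>These are the rescaled weights \<open>sin (s * Z) / s\<close> at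
      \<open>s = 1 / (i + 1)\<close>; they converge to \<open>Z\<close> on \<open>A\<close> and are
      dominated by \<open>\<bar>Z\<bar>\<close>.\<close>
    let ?s = "\<lambda>i \<omega>. real (Suc i) * sin (inverse (real (Suc i)) * Z \<omega>) * indicator A \<omega>"
    have "(\<lambda>i. expectation (?s i)) \<longlonglongrightarrow> expectation (\<lambda>\<omega>. Z \<omega> * indicator A \<omega>)"
    proof (rule integral_dominated_convergence)
      show "integrable M (\<lambda>\<omega>. \<bar>Z \<omega>\<bar>)" using iZ by simp
      have "((\<lambda>x. sin (x * z) / x) \<longlongrightarrow> z) (at 0)" for z :: real
      proof -
        have "((\<lambda>x. sin (x * z)) has_field_derivative z) (at 0)"
          by (auto intro!: derivative_eq_intros)
        then show ?thesis by (simp add: has_field_derivative_iff)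
      qed
      moreover have "filterlim (\<lambda>i. inverse (real (Suc i))) (at 0) sequentially"
        using LIMSEQ_inverse_real_of_nat by (rule filterlim_atI) simp
      ultimately have "(\<lambda>i. sin (inverse (real (Suc i)) * z) / inverse (real (Suc i))) \<longlonglongrightarrow> z" for z :: real
        by (rule filterlim_compose)
      then have "(\<lambda>i. real (Suc i) * sin (inverse (real (Suc i)) * z)) \<longlonglongrightarrow> z" for z :: real
        by (simp add: divide_inverse mult.commute)
      then show "AE \<omega> in M. (\<lambda>i. ?s i \<omega>) \<longlonglongrightarrow> Z \<omega> * indicator A \<omega>"
        by (intro always_eventually allI tendsto_mult_right)
      have "norm (?s i \<omega>) \<le> \<bar>Z \<omega>\<bar>" for i \<omega>
      proof -
        have "\<bar>sin (inverse (real (Suc i)) * Z \<omega>)\<bar> \<le> inverse (real (Suc i)) * \<bar>Z \<omega>\<bar>"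
          using abs_sin_x_le_abs_x[of "inverse (real (Suc i)) * Z \<omega>"] by (simp add: abs_mult)
        then have "real (Suc i) * \<bar>sin (inverse (real (Suc i)) * Z \<omega>)\<bar> \<le> \<bar>Z \<omega>\<bar>"
          by (simp add: field_simps)
        then show ?thesis by (auto simp: abs_mult indicator_def)
      qed
      then show "AE \<omega> in M. norm (?s i \<omega>) \<le> \<bar>Z \<omega>\<bar>" for i by simp
    qed simp_all
    moreover have "expectation (?s i) = 0" for i
      using zero[OF A, of "inverse (real (Suc i))"] by (simp add: mult.assoc)
    ultimately have "expectation (\<lambda>\<omega>. Z \<omega> * indicator A \<omega>) = 0"
      by (simp add: LIMSEQ_const_iff)
    then show "(LINT x:A|M. Z x) = (LINT x:A|M. 0)"
      by (simp add: set_lebesgue_integral_def mult.commute)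
  qed (use iZ in auto)
qed

section \<open>Innovations of fractional Gaussian noise\<close>

text \<open>Backward induction on the column \<open>m\<close>. In entry \<open>(n, m)\<close> of the
  product of \<open>\<gamma>\<close> and \<open>\<beta>\<close>, the terms with \<open>k < m\<close>
  vanish by triangularity of \<open>\<beta>\<close> and those with \<open>k > m\<close> by
  induction, which leaves \<open>\<gamma> n m * \<beta> m m = 0\<close>. This reconciles the sum
  over \<open>k \<le> n\<close> in \<open>innovation\<close> with the full matrix products.\<close>

lemma inverse_lower_triangular:
  fixes \<beta> \<gamma> :: "nat \<Rightarrow> nat \<Rightarrow> real"
  assumes inv: "inverse_matrices N \<beta> \<gamma>"
    and tri: "\<And>n k. n < N \<Longrightarrow> k < N \<Longrightarrow> n < k \<Longrightarrow> \<beta> n k = 0"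
    and diag: "\<And>n. n < N \<Longrightarrow> \<beta> n n \<noteq> 0"
    and "n < m" "m < N"
  shows "\<gamma> n m = 0"
  using \<open>n < m\<close> \<open>m < N\<close>
proof (induction "N - m" arbitrary: m rule: less_induct)
  case less
  have "\<gamma> n k * \<beta> k m = (if k = m then \<gamma> n m * \<beta> m m else 0)" if "k < N" for k
  proof (cases k m rule: linorder_cases)
    case less
    then show ?thesis using tri[OF \<open>k < N\<close> \<open>m < N\<close>] by simp
  next
    case greater
    then have "\<gamma> n k = 0" using less.hyps[of k] less.prems that by simp
    then show ?thesis using greater by simp
  qed simp
  then have "(\<Sum>k<N. \<gamma> n k * \<beta> k m) = (\<Sum>k<N. if k = m then \<gamma> n m * \<beta> m m else 0)"
    by (intro sum.cong) auto
  then have "(\<Sum>k<N. \<gamma> n k * \<beta> k m) = \<gamma> n m * \<beta> m m"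
    using less.prems by simp
  moreover have "(\<Sum>k<N. \<gamma> n k * \<beta> k m) = 0"
    using inv less.prems by (auto simp: inverse_matrices_def)
  ultimately show ?case using diag[OF less.prems(2)] by simp
qed

section \<open>Gaussian variables in the linear span of the driving process\<close>

text \<open>The linear span of the process. Its members are exactly the sums that
  \<open>gaussian_process\<close> declares Gaussian, so closure of this set under linear operations
  yields joint Gaussianity of increments and innovations.\<close>

definition finite_combinations :: "'t set \<Rightarrow> ('t \<Rightarrow> 'w \<Rightarrow> real) \<Rightarrow> ('w \<Rightarrow> real) set" where
  "finite_combinations T B = {\<lambda>\<omega>. \<Sum>t\<in>I. c t * B t \<omega> | I c. finite I \<and> I \<subseteq> T}"

lemma finite_combinations_base: "t \<in> T \<Longrightarrow> B t \<in> finite_combinations T B"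
  unfolding finite_combinations_def
  by (intro CollectI exI[of _ "{t}"] exI[of _ "\<lambda>_. 1"]) simp

lemma finite_combinations_cmult:
  assumes "Y \<in> finite_combinations T B"
  shows "(\<lambda>\<omega>. a * Y \<omega>) \<in> finite_combinations T B"
proof -
  obtain I c where I: "finite I" "I \<subseteq> T" and Y: "Y = (\<lambda>\<omega>. \<Sum>t\<in>I. c t * B t \<omega>)"
    using assms unfolding finite_combinations_def by blast
  have "(\<lambda>\<omega>. a * Y \<omega>) = (\<lambda>\<omega>. \<Sum>t\<in>I. (a * c t) * B t \<omega>)"
    by (simp add: Y sum_distrib_left mult.assoc)
  then show ?thesis using I unfolding finite_combinations_def
    by (intro CollectI exI[of _ I] exI[of _ "\<lambda>t. a * c t"]) simp
qed

text \<open>The two index sets may overlap, so both coefficient families are extended by zero to the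
  union and added there.\<close>

lemma finite_combinations_add:
  assumes "Y \<in> finite_combinations T B" "Z \<in> finite_combinations T B"
  shows "(\<lambda>\<omega>. Y \<omega> + Z \<omega>) \<in> finite_combinations T B"
proof -
  obtain I c where I: "finite I" "I \<subseteq> T" and Y: "Y = (\<lambda>\<omega>. \<Sum>t\<in>I. c t * B t \<omega>)"
    using assms unfolding finite_combinations_def by blast
  obtain J d where J: "finite J" "J \<subseteq> T" and Z: "Z = (\<lambda>\<omega>. \<Sum>t\<in>J. d t * B t \<omega>)"
    using assms unfolding finite_combinations_def by blast
  let ?e = "\<lambda>t. (if t \<in> I then c t else 0) + (if t \<in> J then d t else 0)"
  have "Y \<omega> + Z \<omega> = (\<Sum>t\<in>I \<union> J. ?e t * B t \<omega>)" for \<omega>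
  proof -
    have "Y \<omega> = (\<Sum>t\<in>I \<union> J. if t \<in> I then c t * B t \<omega> else 0)"
      using I J by (simp add: Y sum.If_cases Int_absorb1)
    moreover have "Z \<omega> = (\<Sum>t\<in>I \<union> J. if t \<in> J then d t * B t \<omega> else 0)"
      using I J by (simp add: Z sum.If_cases Int_absorb1)
    ultimately show ?thesis
      by (simp add: sum.distrib[symmetric] distrib_right if_distrib[of "\<lambda>x. x * _"] cong: if_cong)
  qed
  then show ?thesis using I J unfolding finite_combinations_def
    by (intro CollectI exI[of _ "I \<union> J"] exI[of _ ?e]) auto
qed

lemma finite_combinations_sum:
  assumes "finite K" "\<And>k. k \<in> K \<Longrightarrow> Y k \<in> finite_combinations T B"
  shows "(\<lambda>\<omega>. \<Sum>k\<in>K. a k * Y k \<omega>) \<in> finite_combinations T B"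
  using assms
proof (induction K rule: finite_induct)
  case empty
  then show ?case unfolding finite_combinations_def by (intro CollectI exI[of _ "{}"]) simp
next
  case (insert k K)
  then have "(\<lambda>\<omega>. a k * Y k \<omega> + (\<Sum>k\<in>K. a k * Y k \<omega>)) \<in> finite_combinations T B"
    by (intro finite_combinations_add finite_combinations_cmult) auto
  then show ?case using insert by simp
qed

locale fractional_noise = prob_space M
  for M :: "'w measure" +
  fixes B :: "real \<Rightarrow> 'w \<Rightarrow> real" and H h :: real and N :: nat and \<beta> \<gamma> :: "nat \<Rightarrow> nat \<Rightarrow> real"
  assumes fbm: "fractional_brownian_motion M H B"
    and h_pos: "0 < h"
    and cholesky: "cholesky_factor N (fgn_cov H) \<beta>"
    and inverse: "inverse_matrices N \<beta> \<gamma>"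
begin

abbreviation "\<xi> \<equiv> fgn H h B"
abbreviation "\<eta> \<equiv> innovation \<gamma> \<xi>"
abbreviation "F \<equiv> noise_filtration M \<eta>"
abbreviation "\<B> \<equiv> finite_combinations {0..} B"

lemma gaussian_combination: "Y \<in> \<B> \<Longrightarrow> gaussian_rv M Y"
  using fbm unfolding finite_combinations_def fractional_brownian_motion_def gaussian_process_def by blast

lemma gaussian_B: "0 \<le> t \<Longrightarrow> gaussian_rv M (B t)"
  by (intro gaussian_combination finite_combinations_base) simp

lemma expectation_B: "0 \<le> t \<Longrightarrow> expectation (B t) = 0"
  using fbm by (simp add: fractional_brownian_motion_def)

lemma integrable_B: "0 \<le> t \<Longrightarrow> integrable M (B t)"
  using centred_gaussian_moments[OF gaussian_B[of t] expectation_B[of t], where k = 1] gaussian_B[of t]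
  by (simp add: integrable_abs_iff gaussian_rv_def)

lemma expectation_combination: "Y \<in> \<B> \<Longrightarrow> expectation Y = 0"
  unfolding finite_combinations_def using integrable_B expectation_B
  by (auto simp: subset_eq Bochner_Integration.integral_sum intro!: sum.neutral)

lemma moments_combination: "Y \<in> \<B> \<Longrightarrow> integrable M (\<lambda>\<omega>. \<bar>Y \<omega>\<bar> ^ k)"
  by (intro centred_gaussian_moments gaussian_combination expectation_combination)

lemma measurable_combination: "Y \<in> \<B> \<Longrightarrow> Y \<in> borel_measurable M"
  using gaussian_combination by (simp add: gaussian_rv_def)

lemma integrable_combination: "Y \<in> \<B> \<Longrightarrow> integrable M Y"
  using moments_combination[of Y 1] measurable_combination[of Y] by (simp add: integrable_abs_iff)

text \<open>Polarisation: the product is half of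
  \<open>(Y + Z)\<^sup>2 - Y\<^sup>2 - Z\<^sup>2\<close>, and all three squares are integrable
  because \<open>Y + Z\<close> stays in the Gaussian span.\<close>

lemma integrable_combination_mult:
  assumes "Y \<in> \<B>" "Z \<in> \<B>"
  shows "integrable M (\<lambda>\<omega>. Y \<omega> * Z \<omega>)"
proof -
  have "(\<lambda>\<omega>. Y \<omega> + Z \<omega>) \<in> \<B>" using assms by (rule finite_combinations_add)
  then have "integrable M (\<lambda>\<omega>. ((Y \<omega> + Z \<omega>)\<^sup>2 - (Y \<omega>)\<^sup>2 - (Z \<omega>)\<^sup>2) / 2)"
    using assms moments_combination[of _ 2] by (auto intro!: Bochner_Integration.integrable_diff)
  then show ?thesis by (simp add: power2_sum)
qed

lemma \<xi>_combination: "\<xi> n \<in> \<B>"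
proof -
  have "(\<lambda>\<omega>. h powr (- H) * (B (real (Suc n) * h) \<omega> + (- 1) * B (real n * h) \<omega>)) \<in> \<B>"
    using h_pos by (intro finite_combinations_cmult finite_combinations_add finite_combinations_base) auto
  then show ?thesis by (simp add: fgn_def[abs_def])
qed

lemma \<eta>_combination: "\<eta> n \<in> \<B>"
  unfolding innovation_def[abs_def] by (rule finite_combinations_sum) (auto intro: \<xi>_combination)

lemma measurable_\<xi> [measurable]: "\<xi> n \<in> borel_measurable M"
  by (rule measurable_combination[OF \<xi>_combination])

lemma measurable_\<eta> [measurable]: "\<eta> n \<in> borel_measurable M"
  by (rule measurable_combination[OF \<eta>_combination])

text \<open>On the grid every covariance of \<open>B\<close> carries the factor
  \<open>h powr (2 * H)\<close>, which the normalisation of \<open>fgn\<close> cancels. In the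
  second difference the powers depending on one index alone drop out.\<close>

lemma expectation_\<xi>_mult: "expectation (\<lambda>\<omega>. \<xi> i \<omega> * \<xi> j \<omega>) = fgn_cov H i j"
proof -
  let ?R = "\<lambda>i j. expectation (\<lambda>\<omega>. B (real i * h) \<omega> * B (real j * h) \<omega>)"
  have R: "?R i j = h powr (2 * H) * ((real i powr (2 * H) + real j powr (2 * H) - \<bar>real j - real i\<bar> powr (2 * H)) / 2)" for i j
  proof -
    have "\<bar>real j * h - real i * h\<bar> = \<bar>real j - real i\<bar> * h"
      using h_pos by (simp add: left_diff_distrib[symmetric] abs_mult)
    moreover have "?R i j = ((real i * h) powr (2 * H) + (real j * h) powr (2 * H) - \<bar>real j * h - real i * h\<bar> powr (2 * H)) / 2"
      using fbm h_pos by (simp add: fractional_brownian_motion_def)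
    ultimately show ?thesis using h_pos by (simp add: powr_mult algebra_simps)
  qed
  have int: "integrable M (\<lambda>\<omega>. B (real i * h) \<omega> * B (real j * h) \<omega>)" for i j
    using h_pos by (intro integrable_combination_mult finite_combinations_base) auto
  have "expectation (\<lambda>\<omega>. \<xi> i \<omega> * \<xi> j \<omega>) = expectation (\<lambda>\<omega>. (h powr (- H))\<^sup>2 *
      (B (real (Suc i) * h) \<omega> * B (real (Suc j) * h) \<omega> - B (real (Suc i) * h) \<omega> * B (real j * h) \<omega>
       - B (real i * h) \<omega> * B (real (Suc j) * h) \<omega> + B (real i * h) \<omega> * B (real j * h) \<omega>))"
    by (intro Bochner_Integration.integral_cong refl) (simp only: fgn_def power2_eq_square, simp add: algebra_simps)
  also have "\<dots> = (h powr (- H))\<^sup>2 * (?R (Suc i) (Suc j) - ?R (Suc i) j - ?R i (Suc j) + ?R i j)"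
    using int by (simp del: of_nat_Suc)
  also have "\<dots> = ((h powr (- H))\<^sup>2 * h powr (2 * H)) * fgn_cov H i j"
  proof -
    have eqs: "\<bar>real (Suc j) - real (Suc i)\<bar> = \<bar>real i - real j\<bar>" "\<bar>real j - real i\<bar> = \<bar>real i - real j\<bar>"
      "\<bar>real j - real (Suc i)\<bar> = \<bar>real i - real j + 1\<bar>" "\<bar>real (Suc j) - real i\<bar> = \<bar>real i - real j - 1\<bar>" by auto
    show ?thesis unfolding R fgn_cov_def eqs by (simp del: of_nat_Suc add: field_simps)
  qed
  also have "(h powr (- H))\<^sup>2 * h powr (2 * H) = 1"
    using h_pos by (simp add: power2_eq_square powr_add[symmetric])
  finally show ?thesis by simp
qed

lemma \<beta>_triangular: "n < N \<Longrightarrow> k < N \<Longrightarrow> n < k \<Longrightarrow> \<beta> n k = 0"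
  using cholesky by (simp add: cholesky_factor_def)

lemma \<gamma>_triangular: "n < k \<Longrightarrow> k < N \<Longrightarrow> \<gamma> n k = 0"
  using cholesky
  by (intro inverse_lower_triangular[OF inverse]) (simp_all add: cholesky_factor_def, metis less_irrefl)

lemma fgn_cov_eq: "n < N \<Longrightarrow> m < N \<Longrightarrow> fgn_cov H n m = (\<Sum>k<N. \<beta> n k * \<beta> m k)"
proof -
  assume nm: "n < N" "m < N"
  have "fgn_cov H n m = (\<Sum>k\<le>min n m. \<beta> n k * \<beta> m k)"
    using cholesky nm by (simp add: cholesky_factor_def)
  also have "\<dots> = (\<Sum>k<N. \<beta> n k * \<beta> m k)"
    using nm \<beta>_triangular by (intro sum.mono_neutral_left) auto
  finally show ?thesis .
qed

lemma \<eta>_eq: "n < N \<Longrightarrow> \<eta> n \<omega> = (\<Sum>k<N. \<gamma> n k * \<xi> k \<omega>)"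
  unfolding innovation_def using \<gamma>_triangular by (intro sum.mono_neutral_left) auto

text \<open>Inverts the innovation map: \<open>\<beta>\<close> times \<open>\<gamma>\<close> is the
  identity, and triangularity cuts the sum off after \<open>n\<close>.\<close>

lemma \<xi>_eq:
  assumes n: "n < N"
  shows "\<xi> n \<omega> = (\<Sum>k<n. \<beta> n k * \<eta> k \<omega>) + \<beta> n n * \<eta> n \<omega>"
proof -
  have "(\<Sum>j<N. \<beta> n j * \<eta> j \<omega>) = (\<Sum>j<N. \<Sum>i<N. \<beta> n j * \<gamma> j i * \<xi> i \<omega>)"
    by (intro sum.cong refl) (simp add: \<eta>_eq sum_distrib_left mult.assoc)
  also have "\<dots> = (\<Sum>i<N. (\<Sum>j<N. \<beta> n j * \<gamma> j i) * \<xi> i \<omega>)"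
    by (subst sum.swap) (simp add: sum_distrib_right)
  also have "\<dots> = (\<Sum>i<N. if i = n then \<xi> n \<omega> else 0)"
    using inverse n by (intro sum.cong refl) (auto simp: inverse_matrices_def)
  also have "\<dots> = \<xi> n \<omega>" using n by simp
  finally have "\<xi> n \<omega> = (\<Sum>j<N. \<beta> n j * \<eta> j \<omega>)" by simp
  also have "\<dots> = (\<Sum>j<Suc n. \<beta> n j * \<eta> j \<omega>)"
    using n \<beta>_triangular by (intro sum.mono_neutral_right) auto
  finally show ?thesis by simp
qed

text \<open>The covariance matrix of the innovations is
  \<open>\<gamma> \<Sigma> \<gamma>\<^sup>T\<close> with
  \<open>\<Sigma> = \<beta> \<beta>\<^sup>T\<close>, hence the identity; the sums are reordered
  until the two factors \<open>\<gamma> \<beta>\<close> appear.\<close>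

lemma expectation_\<eta>_mult:
  assumes "n < N" "m < N"
  shows "expectation (\<lambda>\<omega>. \<eta> n \<omega> * \<eta> m \<omega>) = (if n = m then 1 else 0)"
proof -
  have "expectation (\<lambda>\<omega>. \<eta> n \<omega> * \<eta> m \<omega>)
      = expectation (\<lambda>\<omega>. \<Sum>i<N. \<Sum>j<N. \<gamma> n i * \<gamma> m j * (\<xi> i \<omega> * \<xi> j \<omega>))"
    using assms by (intro Bochner_Integration.integral_cong refl) (simp add: \<eta>_eq sum_product mult.assoc mult.left_commute[of "\<xi> _ _"])
  also have "\<dots> = (\<Sum>i<N. \<Sum>j<N. \<gamma> n i * \<gamma> m j * fgn_cov H i j)"
    using integrable_combination_mult[OF \<xi>_combination \<xi>_combination]
    by (simp add: Bochner_Integration.integral_sum expectation_\<xi>_mult)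
  also have "\<dots> = (\<Sum>i<N. \<Sum>j<N. \<Sum>k<N. (\<gamma> n i * \<beta> i k) * (\<gamma> m j * \<beta> j k))"
    by (intro sum.cong refl) (simp add: fgn_cov_eq sum_distrib_left ac_simps)
  also have "\<dots> = (\<Sum>i<N. \<Sum>k<N. \<Sum>j<N. (\<gamma> n i * \<beta> i k) * (\<gamma> m j * \<beta> j k))"
    by (rule sum.cong[OF refl]) (rule sum.swap)
  also have "\<dots> = (\<Sum>k<N. \<Sum>i<N. \<Sum>j<N. (\<gamma> n i * \<beta> i k) * (\<gamma> m j * \<beta> j k))"
    by (rule sum.swap)
  also have "\<dots> = (\<Sum>k<N. (\<Sum>i<N. \<gamma> n i * \<beta> i k) * (\<Sum>j<N. \<gamma> m j * \<beta> j k))"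
    by (intro sum.cong refl) (rule sum_product[symmetric])
  also have "\<dots> = (\<Sum>k<N. if k = n then (if n = m then 1 else 0) else 0)"
    using inverse assms by (intro sum.cong refl) (auto simp: inverse_matrices_def)
  also have "\<dots> = (if n = m then 1 else 0)" using assms by simp
  finally show ?thesis .
qed

text \<open>\<open>\<xi> k\<close> involves the innovations up to and including
  \<open>\<eta> k\<close>, so it is known from time \<open>k + 1\<close> on but in general not at
  time \<open>k\<close>.\<close>

lemma measurable_\<xi>_filtration:
  assumes "k < n" "n \<le> N"
  shows "\<xi> k \<in> borel_measurable (F n)"
proof -
  have "(\<lambda>\<omega>. (\<Sum>j<k. \<beta> k j * \<eta> j \<omega>) + \<beta> k k * \<eta> k \<omega>) \<in> borel_measurable (F n)"
    using assms by (auto intro!: borel_measurable_add borel_measurable_sum borel_measurable_times measurable_noise_filtration)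
  moreover have "\<xi> k = (\<lambda>\<omega>. (\<Sum>j<k. \<beta> k j * \<eta> j \<omega>) + \<beta> k k * \<eta> k \<omega>)"
    using assms \<xi>_eq by (intro ext) simp
  ultimately show ?thesis by simp
qed

lemma subalgebra_F: "subalgebra M (F n)"
  by (intro subalgebra_noise_filtration measurable_\<eta>)

lemma sigma_finite_subalgebra_F: "sigma_finite_subalgebra M (F n)"
proof -
  interpret finite_measure_subalgebra M "F n"
    by unfold_locales (rule subalgebra_F)
  show ?thesis by unfold_locales
qed

lemma cond_exp_\<eta>:
  assumes n: "n < N"
  shows "AE \<omega> in M. real_cond_exp M (F n) (\<eta> n) \<omega> = 0"
proof (rule cond_exp_orthogonal_gaussian)
  have comb: "(\<lambda>\<omega>. s * \<eta> n \<omega> + (\<Sum>k<n. t k * \<eta> k \<omega>)) \<in> \<B>" for s t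
    by (intro finite_combinations_add finite_combinations_cmult finite_combinations_sum \<eta>_combination) auto
  show "gaussian_rv M (\<lambda>\<omega>. s * \<eta> n \<omega> + (\<Sum>k<n. t k * \<eta> k \<omega>))" for s t
    by (rule gaussian_combination[OF comb])
  show "expectation (\<lambda>\<omega>. s * \<eta> n \<omega> + (\<Sum>k<n. t k * \<eta> k \<omega>)) = 0" for s t
    by (rule expectation_combination[OF comb])
  have "expectation (\<lambda>\<omega>. \<eta> n \<omega> * (\<Sum>k<n. t k * \<eta> k \<omega>)) = (\<Sum>k<n. t k * expectation (\<lambda>\<omega>. \<eta> n \<omega> * \<eta> k \<omega>))" for t
    using integrable_combination_mult[OF \<eta>_combination \<eta>_combination]
    by (simp add: sum_distrib_left mult.left_commute Bochner_Integration.integral_sum)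
  then show "expectation (\<lambda>\<omega>. \<eta> n \<omega> * (\<Sum>k<n. t k * \<eta> k \<omega>)) = 0" for t
    using n by (simp add: expectation_\<eta>_mult)
qed (rule measurable_\<eta>)

text \<open>\<open>\<xi>_eq\<close> splits the noise pathwise with an explicit sum, whereas the
  adjoint equation uses a conditional expectation. They agree almost everywhere: the sum over
  \<open>k < n\<close> is \<open>F n\<close>-measurable and the remaining innovation has conditional
  mean zero.\<close>

lemma \<xi>_decomposition:
  assumes n: "n < N"
  shows "AE \<omega> in M. \<xi> n \<omega> = real_cond_exp M (F n) (\<xi> n) \<omega> + \<beta> n n * \<eta> n \<omega>"
proof -
  interpret sigma_finite_subalgebra M "F n" by (rule sigma_finite_subalgebra_F)
  let ?Z = "\<lambda>\<omega>. \<Sum>k<n. \<beta> n k * \<eta> k \<omega>"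
  have i: "integrable M ?Z" "integrable M (\<eta> n)"
    by (intro integrable_combination finite_combinations_sum \<eta>_combination; simp)+
  have "?Z \<in> borel_measurable (F n)"
    by (auto intro!: borel_measurable_sum borel_measurable_times measurable_noise_filtration)
  then have "AE \<omega> in M. real_cond_exp M (F n) ?Z \<omega> = ?Z \<omega>"
    using i by (intro real_cond_exp_F_meas)
  moreover have "AE \<omega> in M. real_cond_exp M (F n) (\<lambda>\<omega>. ?Z \<omega> + \<beta> n n * \<eta> n \<omega>) \<omega>
      = real_cond_exp M (F n) ?Z \<omega> + real_cond_exp M (F n) (\<lambda>\<omega>. \<beta> n n * \<eta> n \<omega>) \<omega>"
    using i by (intro real_cond_exp_add) auto
  moreover have "AE \<omega> in M. real_cond_exp M (F n) (\<lambda>\<omega>. \<beta> n n * \<eta> n \<omega>) \<omega> = \<beta> n n * real_cond_exp M (F n) (\<eta> n) \<omega>"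
    using i by (intro real_cond_exp_cmult)
  moreover have "(\<lambda>\<omega>. ?Z \<omega> + \<beta> n n * \<eta> n \<omega>) = \<xi> n"
    using n \<xi>_eq by (intro ext) simp
  moreover note cond_exp_\<eta>[OF n]
  ultimately have "AE \<omega> in M. real_cond_exp M (F n) (\<xi> n) \<omega> = ?Z \<omega>"
    by (elim AE_mp) (auto intro!: AE_I2)
  then show ?thesis by eventually_elim (use \<xi>_eq[OF n] in simp)
qed

end

section \<open>Conditional expectations of random vectors\<close>

text \<open>Bounds are known for the Jacobians, but the adjoint recursion uses their transposes.
  Testing with \<open>z = transpose A *v x\<close> gives
  \<open>\<parallel>z\<parallel>\<^sup>2 = x \<bullet> (A *v z)\<close>, after which one factor
  \<open>\<parallel>z\<parallel>\<close> is cancelled.\<close>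

lemma norm_transpose_le:
  fixes A :: "real ^ 'n ^ 'm"
  assumes C: "\<And>y. norm (A *v y) \<le> C * norm y"
  shows "norm (transpose A *v x) \<le> C * norm x"
proof -
  let ?z = "transpose A *v x"
  have "(norm ?z)\<^sup>2 = ?z \<bullet> ?z" by (simp add: power2_norm_eq_inner)
  also have "\<dots> = x \<bullet> (A *v ?z)" by (simp add: dot_lmul_matrix)
  also have "\<dots> \<le> norm x * norm (A *v ?z)" by (rule norm_cauchy_schwarz)
  also have "\<dots> \<le> norm x * (C * norm ?z)" by (intro mult_left_mono C) simp
  finally have "norm ?z * norm ?z \<le> (C * norm x) * norm ?z" by (simp add: power2_eq_square ac_simps)
  \<comment> \<open>This settles the case \<open>?z = 0\<close>, where no factor can be cancelled;
    the sign of \<open>C\<close> comes from the bound at a unit vector.\<close>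
  moreover have "0 \<le> C * norm x"
  proof -
    have "0 \<le> C * norm (axis undefined 1 :: real ^ 'n)" by (rule order_trans[OF norm_ge_zero C])
    then show ?thesis by simp
  qed
  ultimately show ?thesis by (cases "norm ?z = 0") (auto simp: mult_le_cancel_right)
qed

lemma abs_matrix_entry_le:
  fixes A :: "real ^ 'n ^ 'm"
  assumes C: "\<And>y. norm (A *v y) \<le> C * norm y"
  shows "\<bar>A $ i $ j\<bar> \<le> C"
proof -
  have eq: "A $ i $ j = (A *v axis j 1) $ i"
    by (simp add: matrix_vector_mul_component inner_axis)
  have "\<bar>A $ i $ j\<bar> \<le> norm (A *v axis j 1)"
    unfolding eq by (rule component_le_norm_cart)
  also have "\<dots> \<le> C" using C[of "axis j 1"] by simp
  finally show ?thesis .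
qed

lemma borel_measurable_vec:
  fixes f :: "'a \<Rightarrow> real ^ 'n"
  assumes "\<And>i. (\<lambda>\<omega>. f \<omega> $ i) \<in> borel_measurable M"
  shows "f \<in> borel_measurable M"
  using assms by (subst borel_measurable_euclidean_space) (auto simp: Basis_vec_def inner_axis)

lemma borel_measurable_vec_nth [measurable (raw)]:
  fixes f :: "'a \<Rightarrow> ('b::real_normed_vector) ^ 'n"
  shows "f \<in> borel_measurable M \<Longrightarrow> (\<lambda>\<omega>. f \<omega> $ i) \<in> borel_measurable M"
  by (rule borel_measurable_continuous_on[OF linear_continuous_on[OF bounded_linear_vec_nth]])

lemma borel_measurable_matrix_vector_mult [measurable (raw)]:
  fixes A :: "'a \<Rightarrow> real ^ 'n ^ 'm"
  assumes [measurable]: "A \<in> borel_measurable M" "y \<in> borel_measurable M"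
  shows "(\<lambda>\<omega>. A \<omega> *v y \<omega>) \<in> borel_measurable M"
  by (rule borel_measurable_vec) (simp add: matrix_vector_mult_def)

lemma borel_measurable_transpose [measurable (raw)]:
  fixes A :: "'a \<Rightarrow> real ^ 'n ^ 'm"
  assumes [measurable]: "A \<in> borel_measurable M"
  shows "(\<lambda>\<omega>. transpose (A \<omega>)) \<in> borel_measurable M"
proof (rule borel_measurable_continuous_on[OF _ assms])
  show "continuous_on UNIV (transpose :: real ^ 'n ^ 'm \<Rightarrow> _)"
    unfolding transpose_def by (intro continuous_intros)
qed

lemma integrable_vec_nth:
  fixes f :: "'a \<Rightarrow> real ^ 'n"
  shows "integrable M f \<Longrightarrow> integrable M (\<lambda>\<omega>. f \<omega> $ i)"
  by (rule integrable_bounded_linear[OF bounded_linear_vec_nth])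

lemma AE_vec_eqI:
  fixes f g :: "'a \<Rightarrow> real ^ 'n"
  assumes "\<And>i. AE \<omega> in M. f \<omega> $ i = g \<omega> $ i"
  shows "AE \<omega> in M. f \<omega> = g \<omega>"
proof -
  have "AE \<omega> in M. \<forall>i\<in>UNIV. f \<omega> $ i = g \<omega> $ i"
    by (rule AE_finite_allI) (auto intro: assms)
  then show ?thesis by eventually_elim (simp add: vec_eq_iff)
qed

context sigma_finite_subalgebra
begin

lemma vec_cond_exp_nth: "vec_cond_exp M F Y \<omega> $ i = real_cond_exp M F (\<lambda>\<omega>. Y \<omega> $ i) \<omega>"
  by (simp add: vec_cond_exp_def)

lemma borel_measurable_vec_cond_exp: "vec_cond_exp M F Y \<in> borel_measurable F"
  by (rule borel_measurable_vec) (simp add: vec_cond_exp_nth)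

lemma vec_cond_exp_cong:
  assumes "AE \<omega> in M. Y \<omega> = Z \<omega>" and [measurable]: "Y \<in> borel_measurable M" "Z \<in> borel_measurable M"
  shows "AE \<omega> in M. vec_cond_exp M F Y \<omega> = vec_cond_exp M F Z \<omega>"
proof (rule AE_vec_eqI, unfold vec_cond_exp_nth, rule real_cond_exp_cong)
  show "AE \<omega> in M. Y \<omega> $ i = Z \<omega> $ i" for i using assms(1) by eventually_elim simp
qed measurable

lemma vec_cond_exp_tower:
  assumes "subalgebra M G" "subalgebra G F" "integrable M Y"
  shows "AE \<omega> in M. vec_cond_exp M F (vec_cond_exp M G Y) \<omega> = vec_cond_exp M F Y \<omega>"
  by (rule AE_vec_eqI) (simp add: vec_cond_exp_def real_cond_exp_nested_subalg[OF assms(1,2) integrable_vec_nth[OF assms(3)]])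

lemma vec_cond_exp_scaleR:
  assumes "g \<in> borel_measurable F" "Y \<in> borel_measurable M" "integrable M (\<lambda>\<omega>. g \<omega> *\<^sub>R Y \<omega>)"
  shows "AE \<omega> in M. vec_cond_exp M F (\<lambda>\<omega>. g \<omega> *\<^sub>R Y \<omega>) \<omega> = g \<omega> *\<^sub>R vec_cond_exp M F Y \<omega>"
proof (rule AE_vec_eqI, unfold vec_cond_exp_nth)
  fix i
  have "AE \<omega> in M. real_cond_exp M F (\<lambda>\<omega>. g \<omega> * (Y \<omega> $ i)) \<omega> = g \<omega> * real_cond_exp M F (\<lambda>\<omega>. Y \<omega> $ i) \<omega>"
    by (rule real_cond_exp_mult) (use assms integrable_vec_nth[OF assms(3), of i] in auto)
  then show "AE \<omega> in M. real_cond_exp M F (\<lambda>\<omega>. (g \<omega> *\<^sub>R Y \<omega>) $ i) \<omega> = (g \<omega> *\<^sub>R vec_cond_exp M F Y \<omega>) $ i"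
    by (simp add: vec_cond_exp_nth)
qed

lemma vec_cond_exp_add:
  assumes "integrable M Y" "integrable M Z"
  shows "AE \<omega> in M. vec_cond_exp M F (\<lambda>\<omega>. Y \<omega> + Z \<omega>) \<omega> = vec_cond_exp M F Y \<omega> + vec_cond_exp M F Z \<omega>"
  by (rule AE_vec_eqI) (simp add: vec_cond_exp_nth real_cond_exp_add[OF integrable_vec_nth[OF assms(1)] integrable_vec_nth[OF assms(2)]])

lemma vec_cond_exp_F_meas:
  assumes "integrable M Y" "Y \<in> borel_measurable F"
  shows "AE \<omega> in M. vec_cond_exp M F Y \<omega> = Y \<omega>"
  by (rule AE_vec_eqI) (simp add: vec_cond_exp_nth, intro real_cond_exp_F_meas integrable_vec_nth borel_measurable_vec_nth assms)

lemma integrable_matrix_entry_mult: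
  fixes P :: "'a \<Rightarrow> real ^ 'n ^ 'm"
  assumes P: "P \<in> borel_measurable M" and C: "\<And>\<omega> y. norm (P \<omega> *v y) \<le> C * norm y"
    and Y: "integrable M Y"
  shows "integrable M (\<lambda>\<omega>. P \<omega> $ i $ j * Y \<omega> $ j)"
proof (rule Bochner_Integration.integrable_bound)
  show "integrable M (\<lambda>\<omega>. C * Y \<omega> $ j)" using integrable_vec_nth[OF Y] by simp
  have "Y \<in> borel_measurable M" using Y by auto
  with P show "(\<lambda>\<omega>. P \<omega> $ i $ j * Y \<omega> $ j) \<in> borel_measurable M" by measurable
  show "AE \<omega> in M. norm (P \<omega> $ i $ j * Y \<omega> $ j) \<le> norm (C * Y \<omega> $ j)"
    using abs_matrix_entry_le[OF C]
    by (intro always_eventually allI) (auto simp: abs_mult intro!: mult_right_mono intro: order_trans[OF _ abs_ge_self])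
qed

lemma integrable_matrix_vector_mult:
  fixes P :: "'a \<Rightarrow> real ^ 'n ^ 'm"
  assumes P: "P \<in> borel_measurable M" and C: "\<And>\<omega> y. norm (P \<omega> *v y) \<le> C * norm y"
    and Y: "integrable M Y"
  shows "integrable M (\<lambda>\<omega>. P \<omega> *v Y \<omega>)"
proof (rule Bochner_Integration.integrable_bound)
  show "integrable M (\<lambda>\<omega>. C *\<^sub>R Y \<omega>)" using Y by simp
  have "Y \<in> borel_measurable M" using Y by auto
  with P show "(\<lambda>\<omega>. P \<omega> *v Y \<omega>) \<in> borel_measurable M" by measurable
  show "AE \<omega> in M. norm (P \<omega> *v Y \<omega>) \<le> norm (C *\<^sub>R Y \<omega>)"
    by (intro always_eventually allI order_trans[OF C]) (auto intro!: mult_right_mono)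
qed

text \<open>Conditioning is coordinatewise, so the matrix is pulled out entry by entry. The operator
  bound makes each entry bounded by \<open>C\<close>, which provides the integrable products that
  this requires.\<close>

lemma vec_cond_exp_matrix_vector_mult:
  fixes P :: "'a \<Rightarrow> real ^ 'n ^ 'm"
  assumes P [measurable]: "P \<in> borel_measurable F" and C: "\<And>\<omega> y. norm (P \<omega> *v y) \<le> C * norm y"
    and Y: "integrable M Y"
  shows "AE \<omega> in M. vec_cond_exp M F (\<lambda>\<omega>. P \<omega> *v Y \<omega>) \<omega> = P \<omega> *v vec_cond_exp M F Y \<omega>"
proof (rule AE_vec_eqI)
  fix i
  note PM = measurable_from_subalg[OF subalg P]
  have [measurable]: "Y \<in> borel_measurable M" using Y by auto
  have "AE \<omega> in M. real_cond_exp M F (\<lambda>\<omega>. \<Sum>j\<in>UNIV. P \<omega> $ i $ j * Y \<omega> $ j) \<omega>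
      = (\<Sum>j\<in>UNIV. real_cond_exp M F (\<lambda>\<omega>. P \<omega> $ i $ j * Y \<omega> $ j) \<omega>)"
    by (intro real_cond_exp_sum integrable_matrix_entry_mult[OF PM C Y])
  moreover have "AE \<omega> in M. \<forall>j\<in>UNIV. real_cond_exp M F (\<lambda>\<omega>. P \<omega> $ i $ j * Y \<omega> $ j) \<omega>
      = P \<omega> $ i $ j * real_cond_exp M F (\<lambda>\<omega>. Y \<omega> $ j) \<omega>"
    by (intro AE_finite_allI real_cond_exp_mult integrable_matrix_entry_mult[OF PM C Y]) auto
  ultimately show "AE \<omega> in M. vec_cond_exp M F (\<lambda>\<omega>. P \<omega> *v Y \<omega>) \<omega> $ i = (P \<omega> *v vec_cond_exp M F Y \<omega>) $ i"
    by eventually_elim (simp add: vec_cond_exp_nth matrix_vector_mult_def)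
qed

text \<open>The common shape of the costate recursion and of \<open>\<Gamma>\<close>: adapted
  bounded matrices acting on the costate and on noise times costate, plus an adapted source.\<close>

lemma vec_cond_exp_affine:
  fixes P Q :: "'a \<Rightarrow> real ^ 'n ^ 'm"
  assumes P: "P \<in> borel_measurable F" "\<And>\<omega> y. norm (P \<omega> *v y) \<le> C * norm y"
    and Q: "Q \<in> borel_measurable F" "\<And>\<omega> y. norm (Q \<omega> *v y) \<le> D * norm y"
    and a: "a \<in> borel_measurable F" "integrable M a"
    and Y: "integrable M Y" and Z: "integrable M Z"
  shows "AE \<omega> in M. vec_cond_exp M F (\<lambda>\<omega>. P \<omega> *v Y \<omega> + Q \<omega> *v Z \<omega> + a \<omega>) \<omega>
    = P \<omega> *v vec_cond_exp M F Y \<omega> + Q \<omega> *v vec_cond_exp M F Z \<omega> + a \<omega>"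
proof -
  have i: "integrable M (\<lambda>\<omega>. P \<omega> *v Y \<omega>)" "integrable M (\<lambda>\<omega>. Q \<omega> *v Z \<omega>)"
    using integrable_matrix_vector_mult[OF measurable_from_subalg[OF subalg P(1)] P(2) Y]
      integrable_matrix_vector_mult[OF measurable_from_subalg[OF subalg Q(1)] Q(2) Z] by auto
  show ?thesis
    using vec_cond_exp_add[OF Bochner_Integration.integrable_add[OF i] a(2)] vec_cond_exp_add[OF i]
      vec_cond_exp_F_meas[OF a(2,1)] vec_cond_exp_matrix_vector_mult[OF P Y] vec_cond_exp_matrix_vector_mult[OF Q Z]
    by eventually_elim simp
qed

text \<open>The characterisation of conditional expectation by bounded adapted test functions,
  summed over coordinates. It lets the conditioned gradient replace the pathwise one in the
  derivative formula.\<close>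

lemma integral_vec_cond_exp_inner:
  fixes v :: "'a \<Rightarrow> real ^ 'n"
  assumes v: "v \<in> borel_measurable F" "AE \<omega> in M. norm (v \<omega>) \<le> C" and Y: "integrable M Y"
  shows "integrable M (\<lambda>\<omega>. Y \<omega> \<bullet> v \<omega>)" "integrable M (\<lambda>\<omega>. vec_cond_exp M F Y \<omega> \<bullet> v \<omega>)"
    "(\<integral>\<omega>. vec_cond_exp M F Y \<omega> \<bullet> v \<omega> \<partial>M) = (\<integral>\<omega>. Y \<omega> \<bullet> v \<omega> \<partial>M)"
proof -
  have [measurable]: "Y \<in> borel_measurable M" using Y by auto
  have [measurable]: "v \<in> borel_measurable M" using v(1) measurable_from_subalg[OF subalg] by auto
  have vi: "(\<lambda>\<omega>. v \<omega> $ i) \<in> borel_measurable F" for i using v(1) by measurable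
  have int: "integrable M (\<lambda>\<omega>. v \<omega> $ i * Y \<omega> $ i)" for i
  proof (rule Bochner_Integration.integrable_bound)
    show "integrable M (\<lambda>\<omega>. C * Y \<omega> $ i)" using integrable_vec_nth[OF Y] by simp
    show "AE \<omega> in M. norm (v \<omega> $ i * Y \<omega> $ i) \<le> norm (C * Y \<omega> $ i)"
      using v(2)
    proof eventually_elim
      case (elim \<omega>)
      then have "\<bar>v \<omega> $ i\<bar> \<le> \<bar>C\<bar>" using component_le_norm_cart[of "v \<omega>" i] by linarith
      then show ?case by (auto simp: abs_mult intro: mult_right_mono)
    qed
  qed measurable
  have ce: "integrable M (\<lambda>\<omega>. v \<omega> $ i * vec_cond_exp M F Y \<omega> $ i)"
    "(\<integral>\<omega>. v \<omega> $ i * vec_cond_exp M F Y \<omega> $ i \<partial>M) = (\<integral>\<omega>. v \<omega> $ i * Y \<omega> $ i \<partial>M)" for i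
    unfolding vec_cond_exp_nth by (intro real_cond_exp_intg int vi; measurable)+
  have inner: "x \<bullet> y = (\<Sum>i\<in>UNIV. y $ i * x $ i)" for x y :: "real ^ 'n"
    by (simp add: inner_vec_def mult.commute)
  show "integrable M (\<lambda>\<omega>. Y \<omega> \<bullet> v \<omega>)" "integrable M (\<lambda>\<omega>. vec_cond_exp M F Y \<omega> \<bullet> v \<omega>)"
    unfolding inner using int ce(1) by auto
  show "(\<integral>\<omega>. vec_cond_exp M F Y \<omega> \<bullet> v \<omega> \<partial>M) = (\<integral>\<omega>. Y \<omega> \<bullet> v \<omega> \<partial>M)"
    unfolding inner by (simp add: Bochner_Integration.integral_sum int ce)
qed

end

section \<open>Jacobians and gradients\<close>

text \<open>The hypothesis bounds partial derivatives only. Expanding a direction in the basis turns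
  this into an operator bound at the price of the dimension factor, and the mean value inequality
  then gives the Lipschitz constant.\<close>

lemma C2_derivative:
  fixes f :: "'a::euclidean_space \<Rightarrow> 'b::real_normed_vector"
  assumes "C2_bounded_lipschitz L K f"
  obtains D :: "'a \<Rightarrow> 'a \<Rightarrow>\<^sub>L 'b" where "\<And>z. (f has_derivative D z) (at z)" "continuous_on UNIV D"
    "\<And>z y. norm (D z y) \<le> L * DIM('a) * norm y" "\<And>z z'. norm (f z - f z') \<le> L * DIM('a) * norm (z - z')"
proof -
  obtain D :: "'a \<Rightarrow> 'a \<Rightarrow>\<^sub>L 'b" and D2 :: "'a \<Rightarrow> 'a \<Rightarrow>\<^sub>L 'a \<Rightarrow>\<^sub>L 'b" where
    D: "\<And>z. (f has_derivative D z) (at z)" and D2: "\<And>z. (D has_derivative D2 z) (at z)"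
    and L: "\<And>i z. i \<in> Basis \<Longrightarrow> norm (D z i) \<le> L"
    using assms unfolding C2_bounded_lipschitz_def by blast
  have cont: "continuous_on UNIV D"
    using D2 by (intro continuous_at_imp_continuous_on) (auto intro: has_derivative_continuous)
  have bound: "norm (D z y) \<le> L * DIM('a) * norm y" for z y
  proof -
    have "norm (D z y) = norm (\<Sum>i\<in>Basis. (y \<bullet> i) *\<^sub>R D z i)"
      by (subst euclidean_representation[symmetric, of y]) (simp add: blinfun.sum_right blinfun.scaleR_right)
    also have "\<dots> \<le> (\<Sum>i\<in>(Basis::'a set). norm y * L)"
      by (intro sum_norm_le) (auto intro!: mult_mono L Basis_le_norm)
    finally show ?thesis by (simp add: ac_simps)
  qed
  moreover have "norm (f z - f z') \<le> L * DIM('a) * norm (z - z')" for z z'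
    using D bound by (intro differentiable_bound[of UNIV]) (auto intro!: onorm_le)
  ultimately show ?thesis using that D cont by blast
qed

lemma jacobian_eq_matrix:
  fixes f :: "real ^ 'n \<Rightarrow> real ^ 'm"
  assumes "(f has_derivative f') (at x)"
  shows "jacobian f (at x) = matrix f'" "jacobian f (at x) *v y = f' y"
proof -
  show "jacobian f (at x) = matrix f'"
    unfolding jacobian_def using frechet_derivative_at[OF assms] by simp
  have "(f has_derivative (*v) (jacobian f (at x))) (at x)"
    using jacobian_works[of f "at x"] differentiableI[OF assms] by blast
  then have "(*v) (jacobian f (at x)) = f'" using assms by (rule has_derivative_unique)
  then show "jacobian f (at x) *v y = f' y" by (rule fun_cong)
qed

lemma gradient_inner:
  assumes "(f has_derivative f') (at x)"
  shows "gradient f x = (\<chi> i. f' (axis i 1))" "gradient f x \<bullet> y = f' y"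
proof -
  show g: "gradient f x = (\<chi> i. f' (axis i 1))"
    unfolding gradient_def using frechet_derivative_at[OF assms] by simp
  have "f' y = f' (\<Sum>i\<in>UNIV. y $ i *\<^sub>R axis i 1)"
    by (simp add: basis_expansion scalar_mult_eq_scaleR[symmetric])
  also have "\<dots> = (\<Sum>i\<in>UNIV. y $ i * f' (axis i 1))"
    using has_derivative_linear[OF assms] by (simp add: linear_sum linear_scale)
  finally show "gradient f x \<bullet> y = f' y"
    by (simp add: g inner_vec_def mult.commute)
qed

lemma has_derivative_partial:
  assumes "(f has_derivative f') (at (x, u))"
  shows "((\<lambda>x. f (x, u)) has_derivative (\<lambda>y. f' (y, 0))) (at x)"
    "((\<lambda>u. f (x, u)) has_derivative (\<lambda>v. f' (0, v))) (at u)"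
proof -
  have "((\<lambda>x. (x, u)) has_derivative (\<lambda>y. (y, 0))) (at x)"
    "((\<lambda>u. (x, u)) has_derivative (\<lambda>v. (0, v))) (at u)"
    by (auto intro!: derivative_eq_intros)
  from this[THEN has_derivative_compose, of f] assms
  show "((\<lambda>x. f (x, u)) has_derivative (\<lambda>y. f' (y, 0))) (at x)"
    "((\<lambda>u. f (x, u)) has_derivative (\<lambda>v. f' (0, v))) (at u)" by auto
qed

text \<open>The total derivative on the product space is split into its two partial Jacobians. Their
  entries are read off from the jointly continuous \<open>D\<close>, so they are jointly continuous
  themselves; this makes the Jacobians along adapted processes adapted.\<close>

lemma C2_jacobians:
  fixes f :: "real ^ 'd \<Rightarrow> real ^ 'p \<Rightarrow> real ^ 'm" and L K :: real
  defines "fx \<equiv> \<lambda>(x, u). jacobian (\<lambda>x. f x u) (at x)" and "fu \<equiv> \<lambda>(x, u). jacobian (\<lambda>u. f x u) (at u)"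
    and "C \<equiv> L * DIM((real ^ 'd) \<times> (real ^ 'p))"
  assumes f: "C2_bounded_lipschitz L K (\<lambda>(x, u). f x u)"
  shows "((\<lambda>(x, u). f x u) has_derivative (\<lambda>(y, v). fx (x, u) *v y + fu (x, u) *v v)) (at (x, u))"
    and "continuous_on UNIV fx" and "continuous_on UNIV fu"
    and "norm (fx (x, u) *v y) \<le> C * norm y" and "norm (fu (x, u) *v v) \<le> C * norm v"
    and "norm (f x u - f x' u') \<le> C * (norm (x - x') + norm (u - u'))"
proof -
  obtain D :: "(real ^ 'd) \<times> (real ^ 'p) \<Rightarrow> ((real ^ 'd) \<times> (real ^ 'p)) \<Rightarrow>\<^sub>L (real ^ 'm)" where
    D: "\<And>z. ((\<lambda>(x, u). f x u) has_derivative D z) (at z)" and cont: "continuous_on UNIV D"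
    and bound: "\<And>z y. norm (D z y) \<le> C * norm y"
    and lip: "\<And>z z'. norm ((case z of (x, u) \<Rightarrow> f x u) - (case z' of (x, u) \<Rightarrow> f x u)) \<le> C * norm (z - z')"
    unfolding C_def by (rule C2_derivative[OF f]) blast
  have px: "((\<lambda>x. f x u) has_derivative (\<lambda>y. D (x, u) (y, 0))) (at x)"
    and pu: "((\<lambda>u. f x u) has_derivative (\<lambda>v. D (x, u) (0, v))) (at u)" for x u
    using has_derivative_partial[OF D[of "(x, u)"]] by auto
  have fx: "fx (x, u) *v y = D (x, u) (y, 0)" and fu: "fu (x, u) *v v = D (x, u) (0, v)" for x u y v
    by (simp_all add: fx_def fu_def jacobian_eq_matrix(2)[OF px] jacobian_eq_matrix(2)[OF pu])
  have "blinfun_apply (D (x, u)) = (\<lambda>(y, v). fx (x, u) *v y + fu (x, u) *v v)"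
    unfolding fx fu by (auto simp: blinfun.add_right[symmetric])
  with D[of "(x, u)"]
  show "((\<lambda>(x, u). f x u) has_derivative (\<lambda>(y, v). fx (x, u) *v y + fu (x, u) *v v)) (at (x, u))" by simp
  have "fx = (\<lambda>z. \<chi> i j. D z (axis j 1, 0) $ i)"
    by (auto simp: fx_def jacobian_eq_matrix(1)[OF px] matrix_def)
  then show "continuous_on UNIV fx" using cont by (auto intro!: continuous_intros)
  have "fu = (\<lambda>z. \<chi> i j. D z (0, axis j 1) $ i)"
    by (auto simp: fu_def jacobian_eq_matrix(1)[OF pu] matrix_def)
  then show "continuous_on UNIV fu" using cont by (auto intro!: continuous_intros)
  show "norm (fx (x, u) *v y) \<le> C * norm y" "norm (fu (x, u) *v v) \<le> C * norm v"
    using bound[of "(x, u)" "(y, 0)"] bound[of "(x, u)" "(0, v)"] by (simp_all add: fx fu norm_Pair)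
  have "0 \<le> C" using order_trans[OF norm_ge_zero bound[of 0 "(axis undefined 1, 0)"]] by (simp add: norm_Pair)
  then show "norm (f x u - f x' u') \<le> C * (norm (x - x') + norm (u - u'))"
    using lip[of "(x, u)" "(x', u')"] norm_Pair_le[of "x - x'" "u - u'"]
    by (auto intro: order_trans mult_left_mono)
qed

lemma C2_gradients:
  fixes f :: "real ^ 'd \<Rightarrow> real ^ 'p \<Rightarrow> real" and L K :: real
  defines "fx \<equiv> \<lambda>(x, u). gradient (\<lambda>x. f x u) x" and "fu \<equiv> \<lambda>(x, u). gradient (\<lambda>u. f x u) u"
    and "C \<equiv> L * DIM((real ^ 'd) \<times> (real ^ 'p))"
  assumes f: "C2_bounded_lipschitz L K (\<lambda>(x, u). f x u)"
  shows "((\<lambda>(x, u). f x u) has_derivative (\<lambda>(y, v). fx (x, u) \<bullet> y + fu (x, u) \<bullet> v)) (at (x, u))"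
    and "continuous_on UNIV fx" and "continuous_on UNIV fu"
    and "norm (fx (x, u)) \<le> C" and "norm (fu (x, u)) \<le> C"
    and "\<bar>f x u - f x' u'\<bar> \<le> C * (norm (x - x') + norm (u - u'))"
proof -
  obtain D :: "(real ^ 'd) \<times> (real ^ 'p) \<Rightarrow> ((real ^ 'd) \<times> (real ^ 'p)) \<Rightarrow>\<^sub>L real" where
    D: "\<And>z. ((\<lambda>(x, u). f x u) has_derivative D z) (at z)" and cont: "continuous_on UNIV D"
    and bound: "\<And>z y. norm (D z y) \<le> C * norm y"
    and lip: "\<And>z z'. norm ((case z of (x, u) \<Rightarrow> f x u) - (case z' of (x, u) \<Rightarrow> f x u)) \<le> C * norm (z - z')"
    unfolding C_def by (rule C2_derivative[OF f]) blast
  have px: "((\<lambda>x. f x u) has_derivative (\<lambda>y. D (x, u) (y, 0))) (at x)"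
    and pu: "((\<lambda>u. f x u) has_derivative (\<lambda>v. D (x, u) (0, v))) (at u)" for x u
    using has_derivative_partial[OF D[of "(x, u)"]] by auto
  have fx: "fx (x, u) \<bullet> y = D (x, u) (y, 0)" and fu: "fu (x, u) \<bullet> v = D (x, u) (0, v)" for x u y v
    by (simp_all add: fx_def fu_def gradient_inner(2)[OF px] gradient_inner(2)[OF pu])
  have "blinfun_apply (D (x, u)) = (\<lambda>(y, v). fx (x, u) \<bullet> y + fu (x, u) \<bullet> v)"
    unfolding fx fu by (auto simp: blinfun.add_right[symmetric])
  with D[of "(x, u)"]
  show "((\<lambda>(x, u). f x u) has_derivative (\<lambda>(y, v). fx (x, u) \<bullet> y + fu (x, u) \<bullet> v)) (at (x, u))" by simp
  have "fx = (\<lambda>z. \<chi> i. D z (axis i 1, 0))"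
    by (auto simp: fx_def gradient_inner(1)[OF px])
  then show "continuous_on UNIV fx" using cont by (auto intro!: continuous_intros)
  have "fu = (\<lambda>z. \<chi> i. D z (0, axis i 1))"
    by (auto simp: fu_def gradient_inner(1)[OF pu])
  then show "continuous_on UNIV fu" using cont by (auto intro!: continuous_intros)
  have C: "0 \<le> C" using order_trans[OF norm_ge_zero bound[of 0 "(axis undefined 1, 0)"]] by (simp add: norm_Pair)
  \<comment> \<open>A functional bounded by \<open>C\<close> has a representing vector of norm at
    most \<open>C\<close>: it is tested with the vector itself.\<close>
  have norm_le: "norm a \<le> C" if "\<And>y. \<bar>a \<bullet> y\<bar> \<le> C * norm y" for a :: "real ^ 'k"
    using that[of a] C by (cases "a = 0") (auto simp: dot_square_norm power2_eq_square mult_le_cancel_right)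
  show "norm (fx (x, u)) \<le> C"
    using bound[of "(x, u)" "(_, 0)"] by (intro norm_le) (simp add: fx norm_Pair)
  show "norm (fu (x, u)) \<le> C"
    using bound[of "(x, u)" "(0, _)"] by (intro norm_le) (simp add: fu norm_Pair)
  show "\<bar>f x u - f x' u'\<bar> \<le> C * (norm (x - x') + norm (u - u'))"
    using lip[of "(x, u)" "(x', u')"] norm_Pair_le[of "x - x'" "u - u'"] C
    by (auto intro: order_trans mult_left_mono)
qed

lemma C2_gradient:
  fixes f :: "real ^ 'd \<Rightarrow> real" and L K :: real
  defines "C \<equiv> L * DIM(real ^ 'd)"
  assumes f: "C2_bounded_lipschitz L K f"
  shows "(f has_derivative (\<lambda>y. gradient f x \<bullet> y)) (at x)"
    and "continuous_on UNIV (gradient f)"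
    and "norm (gradient f x) \<le> C"
    and "\<bar>f x - f x'\<bar> \<le> C * norm (x - x')"
proof -
  obtain D :: "real ^ 'd \<Rightarrow> (real ^ 'd) \<Rightarrow>\<^sub>L real" where
    D: "\<And>z. (f has_derivative D z) (at z)" and cont: "continuous_on UNIV D"
    and bound: "\<And>z y. norm (D z y) \<le> C * norm y"
    and lip: "\<And>z z'. norm (f z - f z') \<le> C * norm (z - z')"
    unfolding C_def by (rule C2_derivative[OF f]) blast
  show "(f has_derivative (\<lambda>y. gradient f x \<bullet> y)) (at x)"
    using D[of x] unfolding gradient_inner(2)[OF D] by simp
  have "gradient f = (\<lambda>z. \<chi> i. D z (axis i 1))"
    by (auto simp: gradient_inner(1)[OF D])
  then show "continuous_on UNIV (gradient f)" using cont by (auto intro!: continuous_intros)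
  have C: "0 \<le> C" using order_trans[OF norm_ge_zero bound[of 0 "axis undefined 1"]] by simp
  have "\<bar>gradient f x \<bullet> gradient f x\<bar> \<le> C * norm (gradient f x)"
    using bound[of x "gradient f x"] by (simp add: gradient_inner(2)[OF D])
  then show "norm (gradient f x) \<le> C"
    using C by (cases "gradient f x = 0") (auto simp: dot_square_norm power2_eq_square mult_le_cancel_right)
  show "\<bar>f x - f x'\<bar> \<le> C * norm (x - x')" using lip by simp
qed

section \<open>Sensitivity of the controlled state\<close>

lemma has_vector_derivative_compose:
  assumes "(g has_vector_derivative g') (at t)" "(f has_derivative f') (at (g t))"
  shows "((\<lambda>s. f (g s)) has_vector_derivative f' g') (at t)"
proof -
  have "((\<lambda>s. f (g s)) has_derivative (\<lambda>s. f' (s *\<^sub>R g'))) (at t)"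
    using assms by (auto simp: has_vector_derivative_def intro: has_derivative_compose)
  moreover have "f' (s *\<^sub>R g') = s *\<^sub>R f' g'" for s
    using has_derivative_linear[OF assms(2)] by (rule linear_scale)
  ultimately show ?thesis by (simp add: has_vector_derivative_def)
qed

lemma C2_continuous: "C2_bounded_lipschitz L K f \<Longrightarrow> continuous_on UNIV f"
  unfolding C2_bounded_lipschitz_def
  by (auto intro!: continuous_at_imp_continuous_on intro: has_derivative_continuous)

locale control_problem = fractional_noise M B H h N \<beta> \<gamma>
  for M :: "'w measure" and B :: "real \<Rightarrow> 'w \<Rightarrow> real" and H h :: real and N :: nat
    and \<beta> \<gamma> :: "nat \<Rightarrow> nat \<Rightarrow> real" +
  fixes L K L' :: real and x0 :: "real ^ 'd"
    and b \<sigma> :: "nat \<Rightarrow> real ^ 'd \<Rightarrow> real ^ 'p \<Rightarrow> real ^ 'd"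
    and \<Phi> :: "real ^ 'd \<Rightarrow> real" and l :: "nat \<Rightarrow> real ^ 'd \<Rightarrow> real ^ 'p \<Rightarrow> real"
    and us :: "nat \<Rightarrow> 'w \<Rightarrow> real ^ 'p"
  assumes L_pos: "0 < L" and L'_pos: "0 < L'"
    and C2_\<Phi>: "C2_bounded_lipschitz L K \<Phi>"
    and C2_b: "n < N \<Longrightarrow> C2_bounded_lipschitz L K (\<lambda>(x, u). b n x u)"
    and C2_\<sigma>: "n < N \<Longrightarrow> C2_bounded_lipschitz L K (\<lambda>(x, u). \<sigma> n x u)"
    and C2_l: "n < N \<Longrightarrow> C2_bounded_lipschitz L K (\<lambda>(x, u). l n x u)"
    and growth_b: "n < N \<Longrightarrow> norm (b n x u) \<le> L' * (1 + norm x + norm u)"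
    and bounded_\<sigma>: "n < N \<Longrightarrow> norm (\<sigma> n x u) \<le> L'"
    and us_adapted: "us \<in> adapted_controls M (noise_filtration M (innovation \<gamma> (fgn H h B))) N"
begin

abbreviation "\<X> \<equiv> state h b \<sigma> x0 \<xi>"
abbreviation "X \<equiv> \<X> us"

definition "lip = L * DIM((real ^ 'd) \<times> (real ^ 'p))"
definition "lip\<Phi> = L * DIM(real ^ 'd)"
text \<open>Chosen so that \<open>growth * R\<close> dominates twice the random Lipschitz factor of
  one time step, with \<open>R\<close> in place of \<open>\<bar>\<xi> n\<bar>\<close>. The second
  half of it absorbs the source term in \<open>costate_bound\<close>.\<close>

definition "growth = 2 * (1 + h * lip + sqrt h * lip)"
definition "R \<omega> = 1 + (\<Sum>k<N. \<bar>\<xi> k \<omega>\<bar>)"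

definition "bx n \<omega> = jacobian (\<lambda>x. b n x (us n \<omega>)) (at (X n \<omega>))"
definition "bu n \<omega> = jacobian (\<lambda>u. b n (X n \<omega>) u) (at (us n \<omega>))"
definition "\<sigma>x n \<omega> = jacobian (\<lambda>x. \<sigma> n x (us n \<omega>)) (at (X n \<omega>))"
definition "\<sigma>u n \<omega> = jacobian (\<lambda>u. \<sigma> n (X n \<omega>) u) (at (us n \<omega>))"
definition "lx n \<omega> = gradient (\<lambda>x. l n x (us n \<omega>)) (X n \<omega>)"
definition "lu n \<omega> = gradient (\<lambda>u. l n (X n \<omega>) u) (us n \<omega>)"

definition "stepA n \<omega> = mat 1 + h *\<^sub>R bx n \<omega>"
definition "stepB n \<omega> = sqrt h *\<^sub>R \<sigma>x n \<omega>"

text \<open>The recursion runs backwards in time, so it is counted by the number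
  \<open>k = N - n\<close> of steps left to the horizon; the step to \<open>Suc k\<close> uses the
  coefficients at time \<open>N - Suc k\<close>.\<close>

primrec costate_rev :: "nat \<Rightarrow> 'w \<Rightarrow> real ^ 'd" where
  "costate_rev 0 \<omega> = gradient \<Phi> (X N \<omega>)"
| "costate_rev (Suc k) \<omega> = (let n = N - Suc k in
    transpose (stepA n \<omega>) *v costate_rev k \<omega> + transpose (stepB n \<omega>) *v (\<xi> n \<omega> *\<^sub>R costate_rev k \<omega>)
      + h *\<^sub>R lx n \<omega>)"

text \<open>The pathwise costate: the adjoint recursion without conditioning, so it is not adapted.\<close>

definition "costate n = costate_rev (N - n)"

definition "\<Gamma> n \<omega> = transpose (bu n \<omega>) *v costate (Suc n) \<omega> + lu n \<omega>
  + h powr (- 1 / 2) *\<^sub>R (transpose (\<sigma>u n \<omega>) *v (\<xi> n \<omega> *\<^sub>R costate (Suc n) \<omega>))"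

text \<open>The first variation of the state: the state equation linearised along the reference
  control in direction \<open>v\<close>. It starts at 0 because the initial state is not
  varied.\<close>

primrec tangent :: "(nat \<Rightarrow> 'w \<Rightarrow> real ^ 'p) \<Rightarrow> nat \<Rightarrow> 'w \<Rightarrow> real ^ 'd" where
  "tangent v 0 \<omega> = 0"
| "tangent v (Suc n) \<omega> = tangent v n \<omega> + h *\<^sub>R (bx n \<omega> *v tangent v n \<omega> + bu n \<omega> *v v n \<omega>)
    + (sqrt h * \<xi> n \<omega>) *\<^sub>R (\<sigma>x n \<omega> *v tangent v n \<omega> + \<sigma>u n \<omega> *v v n \<omega>)"

lemma costate_N: "costate N \<omega> = gradient \<Phi> (X N \<omega>)"
  by (simp add: costate_def)

lemma costate_step:
  assumes "n < N"
  shows "costate n \<omega> = transpose (stepA n \<omega>) *v costate (Suc n) \<omega>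
    + transpose (stepB n \<omega>) *v (\<xi> n \<omega> *\<^sub>R costate (Suc n) \<omega>) + h *\<^sub>R lx n \<omega>"
proof -
  have "N - n = Suc (N - Suc n)" "N - Suc (N - Suc n) = n" using assms by simp_all
  then show ?thesis unfolding costate_def by (simp only: costate_rev.simps Let_def)
qed

section \<open>Pathwise constants and their moments\<close>

lemma lip_nonneg: "0 \<le> lip" "0 \<le> lip\<Phi>"
  using L_pos by (simp_all add: lip_def lip\<Phi>_def)

lemma lip_coefficients:
  assumes "n < N"
  shows "norm (b n x u - b n x' u') \<le> lip * (norm (x - x') + norm (u - u'))"
    "norm (\<sigma> n x u - \<sigma> n x' u') \<le> lip * (norm (x - x') + norm (u - u'))"
    "\<bar>l n x u - l n x' u'\<bar> \<le> lip * (norm (x - x') + norm (u - u'))"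
  unfolding lip_def
  by (rule C2_jacobians(6)[OF C2_b[OF assms]] C2_jacobians(6)[OF C2_\<sigma>[OF assms]]
      C2_gradients(6)[OF C2_l[OF assms]])+

lemma lip_\<Phi>: "\<bar>\<Phi> x - \<Phi> x'\<bar> \<le> lip\<Phi> * norm (x - x')"
  unfolding lip\<Phi>_def by (rule C2_gradient(4)[OF C2_\<Phi>])

lemma R_ge_1: "1 \<le> R \<omega>"
  by (simp add: R_def sum_nonneg)

lemma abs_\<xi>_le_R: "n < N \<Longrightarrow> \<bar>\<xi> n \<omega>\<bar> \<le> R \<omega>"
  unfolding R_def using member_le_sum[of n "{..<N}" "\<lambda>k. \<bar>\<xi> k \<omega>\<bar>"] by simp

lemma growth_ge_2: "2 \<le> growth"
  using lip_nonneg h_pos by (simp add: growth_def)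

lemma growth_R_ge_1: "1 \<le> growth * R \<omega>"
  using mult_mono[of 1 growth 1 "R \<omega>"] R_ge_1[of \<omega>] growth_ge_2 by simp

text \<open>Since \<open>1 \<le> R\<close>, the deterministic part of the factor may be multiplied
  by \<open>R\<close> as well.\<close>

lemma growth_R_factor:
  assumes "n < N"
  shows "2 * (1 + h * lip + sqrt h * \<bar>\<xi> n \<omega>\<bar> * lip) \<le> growth * R \<omega>"
proof -
  have "sqrt h * lip * \<bar>\<xi> n \<omega>\<bar> \<le> sqrt h * lip * R \<omega>"
    using abs_\<xi>_le_R[OF assms, of \<omega>] lip_nonneg h_pos by (intro mult_left_mono) auto
  moreover have "(1 + h * lip) * 1 \<le> (1 + h * lip) * R \<omega>"
    using R_ge_1[of \<omega>] lip_nonneg h_pos by (intro mult_left_mono) auto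
  ultimately show ?thesis by (simp add: growth_def algebra_simps)
qed

lemma measurable_R [measurable]: "R \<in> borel_measurable M"
  unfolding R_def[abs_def] by measurable

lemma integrable_R_power: "integrable M (\<lambda>\<omega>. R \<omega> ^ k)"
  unfolding R_def by (rule integrable_power_sum) (auto intro: moments_combination[OF \<xi>_combination])

text \<open>\<open>R\<close> has all moments, so a pathwise bound by a power of
  \<open>growth * R\<close> is all that integrability of the costate needs besides
  measurability.\<close>

lemma integrable_growth:
  fixes Y :: "'w \<Rightarrow> 'b::{banach, second_countable_topology}"
  assumes "Y \<in> borel_measurable M" "\<And>\<omega>. norm (Y \<omega>) \<le> D * (growth * R \<omega>) ^ k"
  shows "integrable M Y"
proof (rule Bochner_Integration.integrable_bound)
  show "integrable M (\<lambda>\<omega>. D * (growth * R \<omega>) ^ k)"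
    using integrable_R_power[of k] by (simp add: power_mult_distrib)
  show "AE \<omega> in M. norm (Y \<omega>) \<le> norm (D * (growth * R \<omega>) ^ k)"
    using assms(2) by (intro always_eventually allI) (auto intro: order_trans[OF _ abs_ge_self])
qed (rule assms(1))

lemma continuous_coefficients:
  assumes "n < N"
  shows "continuous_on UNIV (\<lambda>(x, u). b n x u)" "continuous_on UNIV (\<lambda>(x, u). \<sigma> n x u)"
    "continuous_on UNIV (\<lambda>(x, u). l n x u)" "continuous_on UNIV \<Phi>"
  using assms by (auto intro!: C2_continuous C2_b C2_\<sigma> C2_l C2_\<Phi>)

lemma measurable_F_M: "Y \<in> borel_measurable (F n) \<Longrightarrow> Y \<in> borel_measurable M"
  using measurable_from_subalg[OF subalgebra_F] .

lemma measurable_F_Suc: "Y \<in> borel_measurable (F n) \<Longrightarrow> Y \<in> borel_measurable (F (Suc n))"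
  using measurable_from_subalg[OF subalgebra_noise_filtration_mono[of n "Suc n"]] by simp

lemma measurable_pair_compose:
  fixes Y :: "'q \<Rightarrow> 'y::second_countable_topology" and Z :: "'q \<Rightarrow> 'z::second_countable_topology"
  assumes "continuous_on UNIV f" "Y \<in> borel_measurable Q" "Z \<in> borel_measurable Q"
  shows "(\<lambda>\<omega>. f (Y \<omega>, Z \<omega>)) \<in> borel_measurable Q"
  by (rule borel_measurable_continuous_on[OF assms(1) borel_measurable_Pair[OF assms(2,3)]])

section \<open>Adaptedness and integrability of states and costs\<close>

text \<open>The coefficients at step \<open>n\<close> are known at time \<open>n\<close> and
  \<open>\<xi> n\<close> at time \<open>n + 1\<close>, which matches the index shift of the
  recursion.\<close>

lemma measurable_state:
  assumes u: "u \<in> adapted_controls M F N" and "n \<le> N"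
  shows "\<X> u n \<in> borel_measurable (F n)"
  using \<open>n \<le> N\<close>
proof (induction n)
  case (Suc n)
  have u: "u n \<in> borel_measurable (F n)" using u Suc.prems by (simp add: adapted_controls_def)
  have X: "\<X> u n \<in> borel_measurable (F n)" using Suc by simp
  have [measurable]: "\<X> u n \<in> borel_measurable (F (Suc n))"
    "(\<lambda>\<omega>. b n (\<X> u n \<omega>) (u n \<omega>)) \<in> borel_measurable (F (Suc n))"
    "(\<lambda>\<omega>. \<sigma> n (\<X> u n \<omega>) (u n \<omega>)) \<in> borel_measurable (F (Suc n))"
    using X measurable_pair_compose[OF continuous_coefficients(1) X u] Suc.prems
      measurable_pair_compose[OF continuous_coefficients(2) X u]
    by (auto intro: measurable_F_Suc)
  have [measurable]: "\<xi> n \<in> borel_measurable (F (Suc n))"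
    using Suc.prems by (intro measurable_\<xi>_filtration) auto
  show ?case by (simp add: Let_def)
qed simp

lemma integrable_adapted:
  assumes u: "u \<in> adapted_controls M F N" and "n < N"
  shows "integrable M (u n)"
proof (rule Bochner_Integration.integrable_bound)
  show "integrable M (\<lambda>\<omega>. 1 + (norm (u n \<omega>))\<^sup>2)" using assms by (simp add: adapted_controls_def)
  show "u n \<in> borel_measurable M" using assms by (auto simp: adapted_controls_def intro: measurable_F_M)
  have "x \<le> 1 + x\<^sup>2" for x :: real
    using sum_squares_bound[of x 1] by (cases "0 \<le> x") (auto intro: add_nonneg_nonneg order_trans[of x 0])
  then show "AE \<omega> in M. norm (u n \<omega>) \<le> norm (1 + (norm (u n \<omega>))\<^sup>2)"
    by (intro always_eventually allI) (auto intro: order_trans[OF _ abs_ge_self])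
qed

text \<open>Boundedness of \<open>\<sigma>\<close> is decisive: it dominates the noise term by a
  multiple of \<open>\<bar>\<xi> n\<bar>\<close> alone, so no product of noise and state has to be
  controlled. First moments suffice because the costs are Lipschitz.\<close>

lemma integrable_state:
  assumes u: "u \<in> adapted_controls M F N" and "n \<le> N"
  shows "integrable M (\<X> u n)"
  using \<open>n \<le> N\<close>
proof (induction n)
  case (Suc n)
  then have n: "n < N" and X: "integrable M (\<X> u n)" by simp_all
  have ui: "integrable M (u n)" by (rule integrable_adapted[OF u n])
  have Xm: "\<X> u n \<in> borel_measurable M" and um: "u n \<in> borel_measurable M" using X ui by auto
  have "integrable M (\<lambda>\<omega>. b n (\<X> u n \<omega>) (u n \<omega>))"
  proof (rule Bochner_Integration.integrable_bound)
    show "integrable M (\<lambda>\<omega>. L' * (1 + norm (\<X> u n \<omega>) + norm (u n \<omega>)))" using X ui by simp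
    show "(\<lambda>\<omega>. b n (\<X> u n \<omega>) (u n \<omega>)) \<in> borel_measurable M"
      using measurable_pair_compose[OF continuous_coefficients(1)[OF n] Xm um] by simp
    show "AE \<omega> in M. norm (b n (\<X> u n \<omega>) (u n \<omega>)) \<le> norm (L' * (1 + norm (\<X> u n \<omega>) + norm (u n \<omega>)))"
      using growth_b[OF n] by (intro always_eventually allI) (auto simp del: abs_mult intro: order_trans[OF _ abs_ge_self])
  qed
  moreover have "integrable M (\<lambda>\<omega>. (sqrt h * \<xi> n \<omega>) *\<^sub>R \<sigma> n (\<X> u n \<omega>) (u n \<omega>))"
  proof (rule Bochner_Integration.integrable_bound)
    show "integrable M (\<lambda>\<omega>. (sqrt h * L') * \<xi> n \<omega>)" using integrable_combination[OF \<xi>_combination] by simp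
    have "(\<lambda>\<omega>. \<sigma> n (\<X> u n \<omega>) (u n \<omega>)) \<in> borel_measurable M"
      using measurable_pair_compose[OF continuous_coefficients(2)[OF n] Xm um] by simp
    then show "(\<lambda>\<omega>. (sqrt h * \<xi> n \<omega>) *\<^sub>R \<sigma> n (\<X> u n \<omega>) (u n \<omega>)) \<in> borel_measurable M" by measurable
    have "sqrt h * \<bar>\<xi> n \<omega>\<bar> * norm (\<sigma> n (\<X> u n \<omega>) (u n \<omega>)) \<le> sqrt h * \<bar>\<xi> n \<omega>\<bar> * L'" for \<omega>
      using h_pos by (intro mult_left_mono bounded_\<sigma> n) simp
    then show "AE \<omega> in M. norm ((sqrt h * \<xi> n \<omega>) *\<^sub>R \<sigma> n (\<X> u n \<omega>) (u n \<omega>)) \<le> norm ((sqrt h * L') * \<xi> n \<omega>)"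
      using L'_pos h_pos by (intro always_eventually allI) (simp add: abs_mult ac_simps)
  qed
  ultimately show ?case using X by (simp add: Let_def)
qed simp

lemma integrable_running_cost:
  assumes u: "u \<in> adapted_controls M F N" and n: "n < N"
  shows "integrable M (\<lambda>\<omega>. l n (\<X> u n \<omega>) (u n \<omega>))"
proof (rule Bochner_Integration.integrable_bound)
  have X: "integrable M (\<X> u n)" and ui: "integrable M (u n)"
    using integrable_state[OF u] integrable_adapted[OF u] n by auto
  then show "integrable M (\<lambda>\<omega>. \<bar>l n 0 0\<bar> + lip * (norm (\<X> u n \<omega>) + norm (u n \<omega>)))" by simp
  show "(\<lambda>\<omega>. l n (\<X> u n \<omega>) (u n \<omega>)) \<in> borel_measurable M"
    using measurable_pair_compose[OF continuous_coefficients(3)[OF n]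
        borel_measurable_integrable[OF X] borel_measurable_integrable[OF ui]] by simp
  have "\<bar>l n x y\<bar> \<le> \<bar>l n 0 0\<bar> + lip * (norm x + norm y)" for x y
    using lip_coefficients(3)[OF n, of x y 0 0] by simp
  then show "AE \<omega> in M. norm (l n (\<X> u n \<omega>) (u n \<omega>)) \<le> norm (\<bar>l n 0 0\<bar> + lip * (norm (\<X> u n \<omega>) + norm (u n \<omega>)))"
    by (intro always_eventually allI) (auto intro: order_trans[OF _ abs_ge_self])
qed

lemma integrable_terminal_cost:
  assumes u: "u \<in> adapted_controls M F N"
  shows "integrable M (\<lambda>\<omega>. \<Phi> (\<X> u N \<omega>))"
proof (rule Bochner_Integration.integrable_bound)
  have X: "integrable M (\<X> u N)" using integrable_state[OF u] by auto
  then show "integrable M (\<lambda>\<omega>. \<bar>\<Phi> 0\<bar> + lip\<Phi> * norm (\<X> u N \<omega>))" by simp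
  show "(\<lambda>\<omega>. \<Phi> (\<X> u N \<omega>)) \<in> borel_measurable M"
    using X by (intro borel_measurable_continuous_on[OF C2_continuous[OF C2_\<Phi>]]) auto
  have "\<bar>\<Phi> x\<bar> \<le> \<bar>\<Phi> 0\<bar> + lip\<Phi> * norm x" for x
    using lip_\<Phi>[of x 0] by simp
  then show "AE \<omega> in M. norm (\<Phi> (\<X> u N \<omega>)) \<le> norm (\<bar>\<Phi> 0\<bar> + lip\<Phi> * norm (\<X> u N \<omega>))"
    by (intro always_eventually allI) (auto intro: order_trans[OF _ abs_ge_self])
qed

lemma perturb_adapted:
  assumes v: "v \<in> adapted_controls M F N"
  shows "perturb us \<epsilon> v \<in> adapted_controls M F N"
proof -
  have "perturb us \<epsilon> v n \<in> borel_measurable (F n) \<and> integrable M (\<lambda>\<omega>. (norm (perturb us \<epsilon> v n \<omega>))\<^sup>2)" if n: "n < N" for n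
  proof
    have [measurable]: "us n \<in> borel_measurable (F n)" "v n \<in> borel_measurable (F n)"
      using us_adapted v n by (auto simp: adapted_controls_def)
    then show meas: "perturb us \<epsilon> v n \<in> borel_measurable (F n)" by (simp add: perturb_def)
    show "integrable M (\<lambda>\<omega>. (norm (perturb us \<epsilon> v n \<omega>))\<^sup>2)"
    proof (rule Bochner_Integration.integrable_bound)
      show "integrable M (\<lambda>\<omega>. 2 * (norm (us n \<omega>))\<^sup>2 + 2 * \<epsilon>\<^sup>2 * (norm (v n \<omega>))\<^sup>2)"
        using us_adapted v n by (simp add: adapted_controls_def)
      show "(\<lambda>\<omega>. (norm (perturb us \<epsilon> v n \<omega>))\<^sup>2) \<in> borel_measurable M"
        using measurable_F_M[OF meas] by measurable
      have "(norm (x + \<epsilon> *\<^sub>R y))\<^sup>2 \<le> 2 * (norm x)\<^sup>2 + 2 * \<epsilon>\<^sup>2 * (norm y)\<^sup>2" for x y :: "real ^ 'p"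
      proof -
        have "(norm (x + \<epsilon> *\<^sub>R y))\<^sup>2 \<le> (norm x + \<bar>\<epsilon>\<bar> * norm y)\<^sup>2"
          using norm_triangle_ineq[of x "\<epsilon> *\<^sub>R y"] by (intro power_mono) auto
        also have "\<dots> \<le> 2 * (norm x)\<^sup>2 + 2 * (\<bar>\<epsilon>\<bar> * norm y)\<^sup>2"
          using sum_squares_bound[of "norm x" "\<bar>\<epsilon>\<bar> * norm y"] by (simp add: power2_sum)
        finally show ?thesis by (simp add: power_mult_distrib)
      qed
      then show "AE \<omega> in M. norm ((norm (perturb us \<epsilon> v n \<omega>))\<^sup>2) \<le> norm (2 * (norm (us n \<omega>))\<^sup>2 + 2 * \<epsilon>\<^sup>2 * (norm (v n \<omega>))\<^sup>2)"
        by (intro always_eventually allI) (auto simp: perturb_def intro: order_trans[OF _ abs_ge_self])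
    qed
  qed
  then show ?thesis by (simp add: adapted_controls_def)
qed

section \<open>First variation of state and cost\<close>

text \<open>Carrying the summand \<open>\<bar>\<epsilon>\<bar> * V\<close> along makes the estimate purely multiplicative; it costs the
  factor \<open>2\<close> in \<open>growth\<close>.\<close>

lemma state_perturb_bound:
  assumes v: "\<And>k. k < N \<Longrightarrow> norm (v k \<omega>) \<le> V" and "0 \<le> V" and "n \<le> N"
  shows "norm (\<X> (perturb us \<epsilon> v) n \<omega> - X n \<omega>) + \<bar>\<epsilon>\<bar> * V \<le> (growth * R \<omega>) ^ n * (\<bar>\<epsilon>\<bar> * V)"
  using \<open>n \<le> N\<close>
proof (induction n)
  case (Suc n)
  then have n: "n < N" by simp
  let ?X' = "\<X> (perturb us \<epsilon> v) n \<omega>" and ?u' = "perturb us \<epsilon> v n \<omega>"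
  let ?e = "norm (?X' - X n \<omega>) + \<bar>\<epsilon>\<bar> * V"
  have e0: "0 \<le> ?e" using \<open>0 \<le> V\<close> by simp
  have u: "norm (?u' - us n \<omega>) \<le> \<bar>\<epsilon>\<bar> * V"
    using v[OF n] by (auto simp: perturb_def intro: mult_left_mono)
  have db: "norm (b n ?X' ?u' - b n (X n \<omega>) (us n \<omega>)) \<le> lip * ?e"
    using u lip_nonneg by (intro order_trans[OF lip_coefficients(1)[OF n]] mult_left_mono) auto
  have ds: "norm (\<sigma> n ?X' ?u' - \<sigma> n (X n \<omega>) (us n \<omega>)) \<le> lip * ?e"
    using u lip_nonneg by (intro order_trans[OF lip_coefficients(2)[OF n]] mult_left_mono) auto
  have "\<X> (perturb us \<epsilon> v) (Suc n) \<omega> - X (Suc n) \<omega> = (?X' - X n \<omega>)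
      + h *\<^sub>R (b n ?X' ?u' - b n (X n \<omega>) (us n \<omega>))
      + (sqrt h * \<xi> n \<omega>) *\<^sub>R (\<sigma> n ?X' ?u' - \<sigma> n (X n \<omega>) (us n \<omega>))"
    by (simp add: Let_def scaleR_diff_right)
  then have "norm (\<X> (perturb us \<epsilon> v) (Suc n) \<omega> - X (Suc n) \<omega>)
      \<le> norm (?X' - X n \<omega>) + h * norm (b n ?X' ?u' - b n (X n \<omega>) (us n \<omega>))
        + (sqrt h * \<bar>\<xi> n \<omega>\<bar>) * norm (\<sigma> n ?X' ?u' - \<sigma> n (X n \<omega>) (us n \<omega>))"
    using h_pos by (auto intro!: order_trans[OF norm_triangle_ineq] add_mono simp: abs_mult)
  also have "\<dots> \<le> norm (?X' - X n \<omega>) + h * (lip * ?e) + (sqrt h * \<bar>\<xi> n \<omega>\<bar>) * (lip * ?e)"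
    using h_pos by (intro add_mono mult_left_mono db ds) auto
  finally have "norm (\<X> (perturb us \<epsilon> v) (Suc n) \<omega> - X (Suc n) \<omega>) + \<bar>\<epsilon>\<bar> * V
      \<le> (1 + h * lip + sqrt h * \<bar>\<xi> n \<omega>\<bar> * lip) * ?e"
    by (simp add: algebra_simps)
  also have "\<dots> \<le> (growth * R \<omega>) * ?e"
  proof (rule mult_right_mono[OF _ e0])
    \<comment> \<open>Only half of the bound in \<open>growth_R_factor\<close> is needed
      here.\<close>
    have "t \<le> 2 * t" if "0 \<le> t" for t :: real using that by simp
    from order_trans[OF this growth_R_factor[OF n]]
    show "1 + h * lip + sqrt h * \<bar>\<xi> n \<omega>\<bar> * lip \<le> growth * R \<omega>"
      using h_pos lip_nonneg by simp
  qed
  also have "\<dots> \<le> (growth * R \<omega>) * ((growth * R \<omega>) ^ n * (\<bar>\<epsilon>\<bar> * V))"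
    using Suc.IH n growth_R_ge_1[of \<omega>] by (intro mult_left_mono) auto
  finally show ?case by (simp add: mult.assoc)
qed simp

lemma state_perturb_derivative:
  assumes "n \<le> N"
  shows "((\<lambda>\<epsilon>. \<X> (perturb us \<epsilon> v) n \<omega>) has_vector_derivative tangent v n \<omega>) (at 0)"
  using assms
proof (induction n)
  case (Suc n)
  then have n: "n < N" and IH: "((\<lambda>\<epsilon>. \<X> (perturb us \<epsilon> v) n \<omega>) has_vector_derivative tangent v n \<omega>) (at 0)"
    by simp_all
  have u0: "perturb us 0 v = us" by (simp add: perturb_def)
  have "((\<lambda>\<epsilon>. perturb us \<epsilon> v n \<omega>) has_vector_derivative v n \<omega>) (at 0)"
    unfolding perturb_def by (auto intro!: derivative_eq_intros)
  then have pair: "((\<lambda>\<epsilon>. (\<X> (perturb us \<epsilon> v) n \<omega>, perturb us \<epsilon> v n \<omega>))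
      has_vector_derivative (tangent v n \<omega>, v n \<omega>)) (at 0)"
    by (rule has_vector_derivative_Pair[OF IH])
  have "((\<lambda>\<epsilon>. b n (\<X> (perturb us \<epsilon> v) n \<omega>) (perturb us \<epsilon> v n \<omega>))
      has_vector_derivative (bx n \<omega> *v tangent v n \<omega> + bu n \<omega> *v v n \<omega>)) (at 0)"
    using has_vector_derivative_compose[OF pair, unfolded u0, OF C2_jacobians(1)[OF C2_b[OF n]]]
    by (simp add: bx_def bu_def)
  moreover have "((\<lambda>\<epsilon>. \<sigma> n (\<X> (perturb us \<epsilon> v) n \<omega>) (perturb us \<epsilon> v n \<omega>))
      has_vector_derivative (\<sigma>x n \<omega> *v tangent v n \<omega> + \<sigma>u n \<omega> *v v n \<omega>)) (at 0)"
    using has_vector_derivative_compose[OF pair, unfolded u0, OF C2_jacobians(1)[OF C2_\<sigma>[OF n]]]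
    by (simp add: \<sigma>x_def \<sigma>u_def)
  ultimately show ?case
    unfolding state.simps tangent.simps Let_def
    by (intro has_vector_derivative_add IH bounded_linear.has_vector_derivative[OF bounded_linear_scaleR_right])
qed simp

definition "path_cost u \<omega> = \<Phi> (\<X> u N \<omega>) + h * (\<Sum>n<N. l n (\<X> u n \<omega>) (u n \<omega>))"

definition "path_cost_derivative v \<omega> = gradient \<Phi> (X N \<omega>) \<bullet> tangent v N \<omega>
  + h * (\<Sum>n<N. lx n \<omega> \<bullet> tangent v n \<omega> + lu n \<omega> \<bullet> v n \<omega>)"

lemma integrable_path_cost: "u \<in> adapted_controls M F N \<Longrightarrow> integrable M (path_cost u)"
  unfolding path_cost_def[abs_def]
  by (intro Bochner_Integration.integrable_add integrable_mult_right Bochner_Integration.integrable_sum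
      integrable_terminal_cost integrable_running_cost) auto

lemma path_cost_derivative:
  "((\<lambda>\<epsilon>. path_cost (perturb us \<epsilon> v) \<omega>) has_vector_derivative path_cost_derivative v \<omega>) (at 0)"
proof -
  have u0: "perturb us 0 v = us" by (simp add: perturb_def)
  have "((\<lambda>\<epsilon>. \<Phi> (\<X> (perturb us \<epsilon> v) N \<omega>)) has_vector_derivative gradient \<Phi> (X N \<omega>) \<bullet> tangent v N \<omega>) (at 0)"
    using has_vector_derivative_compose[OF state_perturb_derivative[of N v \<omega>], unfolded u0, OF _ C2_gradient(1)[OF C2_\<Phi>]]
    by simp
  moreover have "((\<lambda>\<epsilon>. l n (\<X> (perturb us \<epsilon> v) n \<omega>) (perturb us \<epsilon> v n \<omega>))
      has_vector_derivative (lx n \<omega> \<bullet> tangent v n \<omega> + lu n \<omega> \<bullet> v n \<omega>)) (at 0)" if n: "n < N" for n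
  proof -
    have "((\<lambda>\<epsilon>. perturb us \<epsilon> v n \<omega>) has_vector_derivative v n \<omega>) (at 0)"
      unfolding perturb_def by (auto intro!: derivative_eq_intros)
    from has_vector_derivative_Pair[OF state_perturb_derivative this]
    have "((\<lambda>\<epsilon>. (\<X> (perturb us \<epsilon> v) n \<omega>, perturb us \<epsilon> v n \<omega>))
        has_vector_derivative (tangent v n \<omega>, v n \<omega>)) (at 0)" using n by simp
    from has_vector_derivative_compose[OF this, unfolded u0, OF C2_gradients(1)[OF C2_l[OF n]]]
    show ?thesis by (simp add: lx_def lu_def)
  qed
  ultimately show ?thesis
    unfolding path_cost_def path_cost_derivative_def
    by (intro has_vector_derivative_add has_vector_derivative_sum bounded_linear.has_vector_derivative[OF bounded_linear_mult_right]) auto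
qed

text \<open>Supplies the dominating function for the difference quotients: after division by
  \<open>\<bar>\<epsilon>\<bar>\<close> the bound no longer depends on \<open>\<epsilon>\<close>,
  and it is integrable by the moments of \<open>R\<close>.\<close>

lemma path_cost_bound:
  assumes v: "\<And>k. k < N \<Longrightarrow> norm (v k \<omega>) \<le> V" and "0 \<le> V"
  shows "\<bar>path_cost (perturb us \<epsilon> v) \<omega> - path_cost us \<omega>\<bar>
    \<le> \<bar>\<epsilon>\<bar> * ((lip\<Phi> + h * N * lip) * V * (growth * R \<omega>) ^ N)"
proof -
  let ?Q = "(growth * R \<omega>) ^ N * (\<bar>\<epsilon>\<bar> * V)"
  have bound: "norm (\<X> (perturb us \<epsilon> v) n \<omega> - X n \<omega>) + \<bar>\<epsilon>\<bar> * V \<le> ?Q" if "n \<le> N" for n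
  proof -
    \<comment> \<open>As \<open>growth * R\<close> is at least 1, the largest exponent
      \<open>N\<close> serves all times.\<close>
    have "(growth * R \<omega>) ^ n * (\<bar>\<epsilon>\<bar> * V) \<le> ?Q"
      using that growth_R_ge_1[of \<omega>] \<open>0 \<le> V\<close> by (intro mult_right_mono power_increasing) auto
    then show ?thesis using state_perturb_bound[where v = v and V = V, OF v \<open>0 \<le> V\<close> that] by (meson order_trans)
  qed
  have "\<bar>\<Phi> (\<X> (perturb us \<epsilon> v) N \<omega>) - \<Phi> (X N \<omega>)\<bar> \<le> lip\<Phi> * norm (\<X> (perturb us \<epsilon> v) N \<omega> - X N \<omega>)"
    by (rule lip_\<Phi>)
  also have "\<dots> \<le> lip\<Phi> * ?Q"
  proof (rule mult_left_mono)
    have "0 \<le> \<bar>\<epsilon>\<bar> * V" using \<open>0 \<le> V\<close> by simp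
    then show "norm (\<X> (perturb us \<epsilon> v) N \<omega> - X N \<omega>) \<le> ?Q" using bound[of N] by simp
  qed (rule lip_nonneg)
  finally have t: "\<bar>\<Phi> (\<X> (perturb us \<epsilon> v) N \<omega>) - \<Phi> (X N \<omega>)\<bar> \<le> lip\<Phi> * ?Q" .
  have r: "\<bar>l n (\<X> (perturb us \<epsilon> v) n \<omega>) (perturb us \<epsilon> v n \<omega>) - l n (X n \<omega>) (us n \<omega>)\<bar> \<le> lip * ?Q" if n: "n < N" for n
  proof -
    have "norm (perturb us \<epsilon> v n \<omega> - us n \<omega>) \<le> \<bar>\<epsilon>\<bar> * V"
      using v[OF n] by (auto simp: perturb_def intro: mult_left_mono)
    then have "norm (\<X> (perturb us \<epsilon> v) n \<omega> - X n \<omega>) + norm (perturb us \<epsilon> v n \<omega> - us n \<omega>) \<le> ?Q"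
      using bound[of n] n by simp
    then have "lip * (norm (\<X> (perturb us \<epsilon> v) n \<omega> - X n \<omega>) + norm (perturb us \<epsilon> v n \<omega> - us n \<omega>)) \<le> lip * ?Q"
      using lip_nonneg by (intro mult_left_mono)
    then show ?thesis by (rule order_trans[OF lip_coefficients(3)[OF n]])
  qed
  have "\<bar>path_cost (perturb us \<epsilon> v) \<omega> - path_cost us \<omega>\<bar>
    = \<bar>(\<Phi> (\<X> (perturb us \<epsilon> v) N \<omega>) - \<Phi> (X N \<omega>))
       + h * (\<Sum>n<N. l n (\<X> (perturb us \<epsilon> v) n \<omega>) (perturb us \<epsilon> v n \<omega>) - l n (X n \<omega>) (us n \<omega>))\<bar>"
    by (simp add: path_cost_def sum_subtractf algebra_simps)
  also have "\<dots> \<le> lip\<Phi> * ?Q + h * (\<Sum>n<N. lip * ?Q)"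
  proof (rule order_trans[OF abs_triangle_ineq add_mono[OF t]])
    let ?d = "\<lambda>n. l n (\<X> (perturb us \<epsilon> v) n \<omega>) (perturb us \<epsilon> v n \<omega>) - l n (X n \<omega>) (us n \<omega>)"
    have "\<bar>\<Sum>n<N. ?d n\<bar> \<le> (\<Sum>n<N. lip * ?Q)"
      by (rule order_trans[OF sum_abs sum_mono]) (rule r, simp)
    then show "\<bar>h * (\<Sum>n<N. ?d n)\<bar> \<le> h * (\<Sum>n<N. lip * ?Q)"
      using h_pos by (simp only: abs_mult abs_of_pos mult_left_mono less_imp_le)
  qed
  also have "\<dots> = \<bar>\<epsilon>\<bar> * ((lip\<Phi> + h * N * lip) * V * (growth * R \<omega>) ^ N)"
    by (simp add: algebra_simps)
  finally show ?thesis .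
qed

section \<open>The costate and the adapted adjoint\<close>

lemma measurable_us: "n < N \<Longrightarrow> us n \<in> borel_measurable (F n)"
  using us_adapted by (simp add: adapted_controls_def)

lemma measurable_X: "n \<le> N \<Longrightarrow> X n \<in> borel_measurable (F n)"
  by (rule measurable_state[OF us_adapted])

lemma measurable_coefficients:
  assumes n: "n < N"
  shows "bx n \<in> borel_measurable (F n)" "bu n \<in> borel_measurable (F n)"
    "\<sigma>x n \<in> borel_measurable (F n)" "\<sigma>u n \<in> borel_measurable (F n)"
    "lx n \<in> borel_measurable (F n)" "lu n \<in> borel_measurable (F n)"
  unfolding bx_def[abs_def] bu_def[abs_def] \<sigma>x_def[abs_def] \<sigma>u_def[abs_def] lx_def[abs_def] lu_def[abs_def]
  using measurable_pair_compose[OF _ measurable_X[OF less_imp_le[OF n]] measurable_us[OF n]]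
    C2_jacobians(2,3)[OF C2_b[OF n]] C2_jacobians(2,3)[OF C2_\<sigma>[OF n]] C2_gradients(2,3)[OF C2_l[OF n]]
  by fastforce+

lemma coefficient_bounds:
  assumes n: "n < N"
  shows "norm (bx n \<omega> *v y) \<le> lip * norm y" "norm (bu n \<omega> *v v) \<le> lip * norm v"
    "norm (\<sigma>x n \<omega> *v y) \<le> lip * norm y" "norm (\<sigma>u n \<omega> *v v) \<le> lip * norm v"
    "norm (lx n \<omega>) \<le> lip" "norm (lu n \<omega>) \<le> lip"
  using C2_jacobians(4,5)[OF C2_b[OF n]] C2_jacobians(4,5)[OF C2_\<sigma>[OF n]] C2_gradients(4,5)[OF C2_l[OF n]]
  unfolding bx_def bu_def \<sigma>x_def \<sigma>u_def lx_def lu_def lip_def by (simp_all only: split_conv)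

lemma measurable_step:
  assumes n: "n < N"
  shows "(\<lambda>\<omega>. transpose (stepA n \<omega>)) \<in> borel_measurable (F n)" "(\<lambda>\<omega>. transpose (stepB n \<omega>)) \<in> borel_measurable (F n)"
  unfolding stepA_def stepB_def using measurable_coefficients[OF n] by measurable

lemma step_bounds:
  assumes n: "n < N"
  shows "norm (transpose (stepA n \<omega>) *v y) \<le> (1 + h * lip) * norm y"
    "norm (transpose (stepB n \<omega>) *v y) \<le> (sqrt h * lip) * norm y"
proof -
  have "norm (stepA n \<omega> *v x) \<le> (1 + h * lip) * norm x" for x
  proof -
    have "norm (stepA n \<omega> *v x) = norm (x + h *\<^sub>R (bx n \<omega> *v x))"
      by (simp add: stepA_def matrix_vector_mult_add_rdistrib scaleR_matrix_vector_assoc)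
    also have "\<dots> \<le> norm x + h * norm (bx n \<omega> *v x)"
      using norm_triangle_ineq[of x "h *\<^sub>R (bx n \<omega> *v x)"] h_pos by simp
    also have "\<dots> \<le> norm x + h * (lip * norm x)"
      using coefficient_bounds(1)[OF n] h_pos by simp
    finally show ?thesis by (simp add: algebra_simps)
  qed
  then show "norm (transpose (stepA n \<omega>) *v y) \<le> (1 + h * lip) * norm y"
    by (rule norm_transpose_le)
  have "norm (stepB n \<omega> *v x) \<le> (sqrt h * lip) * norm x" for x
  proof -
    have "norm (stepB n \<omega> *v x) = sqrt h * norm (\<sigma>x n \<omega> *v x)"
      using h_pos by (simp add: stepB_def scaleR_matrix_vector_assoc[symmetric])
    also have "\<dots> \<le> sqrt h * (lip * norm x)"
      using coefficient_bounds(3)[OF n] h_pos by simp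
    finally show ?thesis by (simp add: mult.assoc)
  qed
  then show "norm (transpose (stepB n \<omega>) *v y) \<le> (sqrt h * lip) * norm y"
    by (rule norm_transpose_le)
qed

text \<open>Carrying \<open>h * lip\<close>, the bound of the source
  \<open>h *\<^sub>R lx n\<close>, along turns the affine recursion into a multiplicative one. The
  source then occurs twice on the right, which is what the factor 2 in \<open>growth\<close> pays
  for.\<close>

lemma costate_bound:
  assumes "n \<le> N"
  shows "norm (costate n \<omega>) + h * lip \<le> (lip\<Phi> + h * lip) * (growth * R \<omega>) ^ (N - n)"
  using assms
proof (induction n rule: inc_induct)
  case base
  show ?case using C2_gradient(3)[OF C2_\<Phi>] by (simp add: costate_N lip\<Phi>_def)
next
  case (step n)
  let ?c = "norm (costate (Suc n) \<omega>)" and ?f = "1 + h * lip + sqrt h * \<bar>\<xi> n \<omega>\<bar> * lip"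
  have "norm (costate n \<omega>) \<le> norm (transpose (stepA n \<omega>) *v costate (Suc n) \<omega>)
      + norm (transpose (stepB n \<omega>) *v (\<xi> n \<omega> *\<^sub>R costate (Suc n) \<omega>)) + norm (h *\<^sub>R lx n \<omega>)"
    unfolding costate_step[OF step(2)] by (intro order_trans[OF norm_triangle_ineq] add_mono order_refl norm_triangle_ineq)
  also have "\<dots> \<le> (1 + h * lip) * ?c + (sqrt h * lip) * norm (\<xi> n \<omega> *\<^sub>R costate (Suc n) \<omega>) + h * lip"
    using coefficient_bounds(5)[OF step(2)] h_pos by (intro add_mono step_bounds step) simp
  finally have 1: "norm (costate n \<omega>) + h * lip \<le> ?f * ?c + 2 * (h * lip)"
    by (simp add: algebra_simps)
  have f: "1 \<le> ?f" and hl: "0 \<le> h * lip" using h_pos lip_nonneg by simp_all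
  have "?f * ?c + 2 * (h * lip) \<le> 2 * ?f * (?c + h * lip)"
  proof -
    have "h * lip \<le> ?f * (h * lip)" using mult_right_mono[OF f hl] by simp
    moreover have "0 \<le> ?f * ?c" using f by (intro mult_nonneg_nonneg) auto
    moreover have "2 * ?f * (?c + h * lip) = 2 * (?f * ?c) + 2 * (?f * (h * lip))" by (simp add: algebra_simps)
    ultimately show ?thesis by linarith
  qed
  also have "\<dots> \<le> (growth * R \<omega>) * (?c + h * lip)"
    using growth_R_factor[OF step(2)] hl by (intro mult_right_mono add_nonneg_nonneg) auto
  also have "\<dots> \<le> (growth * R \<omega>) * ((lip\<Phi> + h * lip) * (growth * R \<omega>) ^ (N - Suc n))"
    using step(3) growth_R_ge_1[of \<omega>] by (intro mult_left_mono) auto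
  also have "\<dots> = (lip\<Phi> + h * lip) * (growth * R \<omega>) ^ (N - n)"
  proof -
    have "N - n = Suc (N - Suc n)" using step(2) by simp
    then show ?thesis by simp
  qed
  finally show ?case using 1 by simp
qed

lemma measurable_costate:
  assumes "n \<le> N"
  shows "costate n \<in> borel_measurable M"
  using assms
proof (induction n rule: inc_induct)
  case base
  have "continuous_on UNIV (gradient \<Phi>)" by (rule C2_gradient(2)[OF C2_\<Phi>])
  then show ?case unfolding costate_N[abs_def]
    using measurable_F_M[OF measurable_X[of N]] by (intro borel_measurable_continuous_on[of "gradient \<Phi>"]) auto
next
  case (step n)
  note [measurable] = step.IH measurable_F_M[OF measurable_step(1)[OF step(2)]]
    measurable_F_M[OF measurable_step(2)[OF step(2)]] measurable_F_M[OF measurable_coefficients(5)[OF step(2)]]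
  show ?case unfolding costate_step[OF step(2), abs_def] by measurable
qed

lemma integrable_costate: "n \<le> N \<Longrightarrow> integrable M (costate n)"
proof (rule integrable_growth[OF measurable_costate])
  fix \<omega> assume "n \<le> N"
  moreover have "0 \<le> h * lip" using h_pos lip_nonneg by simp
  ultimately show "norm (costate n \<omega>) \<le> (lip\<Phi> + h * lip) * (growth * R \<omega>) ^ (N - n)"
    using costate_bound[of n \<omega>] by linarith
qed

text \<open>Meant for \<open>\<xi> n\<close> and \<open>\<eta> n\<close>: both are at most a
  multiple of \<open>R\<close>, so the product costs just one more power of
  \<open>growth * R\<close>.\<close>

lemma integrable_scaleR_costate:
  assumes n: "n \<le> N" and [measurable]: "g \<in> borel_measurable M" and g: "\<And>\<omega>. \<bar>g \<omega>\<bar> \<le> D * R \<omega>"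
  shows "integrable M (\<lambda>\<omega>. g \<omega> *\<^sub>R costate n \<omega>)"
proof (rule integrable_growth)
  show "(\<lambda>\<omega>. g \<omega> *\<^sub>R costate n \<omega>) \<in> borel_measurable M" using measurable_costate[OF n] by measurable
  fix \<omega>
  have D: "0 \<le> D * R \<omega>" by (rule order_trans[OF abs_ge_zero g])
  then have D0: "0 \<le> D" using R_ge_1[of \<omega>] by (simp add: zero_le_mult_iff)
  have hl: "0 \<le> h * lip" using h_pos lip_nonneg by simp
  have "norm (g \<omega> *\<^sub>R costate n \<omega>) \<le> (D * R \<omega>) * ((lip\<Phi> + h * lip) * (growth * R \<omega>) ^ (N - n))"
    using costate_bound[OF n, of \<omega>] hl D by (simp, intro mult_mono g) auto
  also have "\<dots> \<le> (D * (growth * R \<omega>)) * ((lip\<Phi> + h * lip) * (growth * R \<omega>) ^ (N - n))"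
  proof (rule mult_right_mono)
    have "1 * R \<omega> \<le> growth * R \<omega>" using growth_ge_2 R_ge_1[of \<omega>] by (intro mult_right_mono) auto
    then show "D * R \<omega> \<le> D * (growth * R \<omega>)" using D0 by (intro mult_left_mono) auto
    show "0 \<le> (lip\<Phi> + h * lip) * (growth * R \<omega>) ^ (N - n)"
      using hl lip_nonneg growth_ge_2 R_ge_1[of \<omega>] by (intro mult_nonneg_nonneg zero_le_power) auto
  qed
  finally show "norm (g \<omega> *\<^sub>R costate n \<omega>) \<le> (D * (lip\<Phi> + h * lip)) * (growth * R \<omega>) ^ Suc (N - n)"
    by (simp add: ac_simps)
qed

lemma integrable_\<xi>_costate: "n < N \<Longrightarrow> integrable M (\<lambda>\<omega>. \<xi> n \<omega> *\<^sub>R costate (Suc n) \<omega>)"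
  by (rule integrable_scaleR_costate[where D = 1]) (auto intro: abs_\<xi>_le_R)

lemma integrable_\<eta>_costate:
  assumes n: "n < N"
  shows "integrable M (\<lambda>\<omega>. \<eta> n \<omega> *\<^sub>R costate (Suc n) \<omega>)"
proof (rule integrable_scaleR_costate)
  fix \<omega>
  have "\<bar>\<eta> n \<omega>\<bar> \<le> (\<Sum>k\<le>n. \<bar>\<gamma> n k\<bar> * \<bar>\<xi> k \<omega>\<bar>)"
    unfolding innovation_def by (rule order_trans[OF sum_abs]) (simp add: abs_mult)
  also have "\<dots> \<le> (\<Sum>k\<le>n. \<bar>\<gamma> n k\<bar> * R \<omega>)"
    using n by (intro sum_mono mult_left_mono abs_\<xi>_le_R) auto
  finally show "\<bar>\<eta> n \<omega>\<bar> \<le> (\<Sum>k\<le>n. \<bar>\<gamma> n k\<bar>) * R \<omega>" by (simp add: sum_distrib_right)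
qed (use n in auto)

section \<open>Duality between tangent and costate\<close>

text \<open>The costate recursion is the transpose of the homogeneous tangent dynamics, so
  everything quadratic in costate and tangent cancels. What survives is the action of the control
  direction, collected in \<open>\<Gamma>\<close>, and the source \<open>lx\<close>.\<close>

lemma duality_step:
  assumes n: "n < N"
  shows "costate (Suc n) \<omega> \<bullet> tangent v (Suc n) \<omega> - costate n \<omega> \<bullet> tangent v n \<omega>
    = h * (\<Gamma> n \<omega> \<bullet> v n \<omega>) - h * (lx n \<omega> \<bullet> tangent v n \<omega> + lu n \<omega> \<bullet> v n \<omega>)"
proof -
  let ?c = "costate (Suc n) \<omega>" and ?Y = "tangent v n \<omega>"
  have T: "(transpose A *v x) \<bullet> y = x \<bullet> (A *v y)" for A :: "real ^ 'i ^ 'j" and x y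
    by (simp add: dot_lmul_matrix)
  have A: "stepA n \<omega> *v ?Y = ?Y + h *\<^sub>R (bx n \<omega> *v ?Y)"
    by (simp add: stepA_def matrix_vector_mult_add_rdistrib scaleR_matrix_vector_assoc)
  have B: "stepB n \<omega> *v ?Y = sqrt h *\<^sub>R (\<sigma>x n \<omega> *v ?Y)"
    by (simp add: stepB_def scaleR_matrix_vector_assoc)
  \<comment> \<open>The weight in \<open>\<Gamma>\<close> is chosen so that the common factor
    \<open>h\<close> restores the \<open>sqrt h\<close> of the noise term.\<close>
  have "h * h powr (- 1 / 2) = sqrt h"
    using h_pos by (simp add: powr_half_sqrt[symmetric] powr_mult_base)
  then have hh: "h * (h powr (- 1 / 2) * z) = sqrt h * z" for z by (simp add: mult.assoc[symmetric])
  have "h * (\<Gamma> n \<omega> \<bullet> v n \<omega>) = h * (?c \<bullet> (bu n \<omega> *v v n \<omega>)) + h * (lu n \<omega> \<bullet> v n \<omega>)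
      + sqrt h * (\<xi> n \<omega> * (?c \<bullet> (\<sigma>u n \<omega> *v v n \<omega>)))"
    unfolding \<Gamma>_def inner_add_left inner_scaleR_left T distrib_left hh by simp
  moreover have "costate n \<omega> \<bullet> ?Y = ?c \<bullet> ?Y + h * (?c \<bullet> (bx n \<omega> *v ?Y))
      + \<xi> n \<omega> * (sqrt h * (?c \<bullet> (\<sigma>x n \<omega> *v ?Y))) + h * (lx n \<omega> \<bullet> ?Y)"
    unfolding costate_step[OF n] inner_add_left inner_scaleR_left T A B inner_add_right inner_scaleR_right by simp
  ultimately show ?thesis
    unfolding tangent.simps inner_add_right inner_scaleR_right by (simp add: algebra_simps)
qed

text \<open>Telescoping \<open>duality_step\<close>: the boundary term at 0 vanishes with the
  tangent, the one at \<open>N\<close> is the terminal cost derivative, and the subtracted source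
  terms are the running cost derivative.\<close>

lemma path_cost_derivative_eq: "path_cost_derivative v \<omega> = h * (\<Sum>n<N. \<Gamma> n \<omega> \<bullet> v n \<omega>)"
proof -
  let ?a = "\<lambda>n. costate n \<omega> \<bullet> tangent v n \<omega>"
  have "?a N - ?a 0 = (\<Sum>n<N. ?a (Suc n) - ?a n)" by (rule sum_lessThan_telescope[of ?a N, symmetric])
  also have "\<dots> = (\<Sum>n<N. h * (\<Gamma> n \<omega> \<bullet> v n \<omega>) - h * (lx n \<omega> \<bullet> tangent v n \<omega> + lu n \<omega> \<bullet> v n \<omega>))"
    by (intro sum.cong refl duality_step) simp
  finally show ?thesis
    by (simp only: path_cost_derivative_def costate_N sum_subtractf sum_distrib_left[symmetric])
      (simp add: algebra_simps)
qed

text \<open>Rearranged into the shape required by \<open>vec_cond_exp_affine\<close>.\<close>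

lemma \<Gamma>_eq: "\<Gamma> n \<omega> = transpose (bu n \<omega>) *v costate (Suc n) \<omega>
    + (h powr (- 1 / 2) *\<^sub>R transpose (\<sigma>u n \<omega>)) *v (\<xi> n \<omega> *\<^sub>R costate (Suc n) \<omega>) + lu n \<omega>"
  by (simp only: \<Gamma>_def scaleR_matrix_vector_assoc add.assoc add.commute[of "lu n \<omega>"])

lemma measurable_\<Gamma>_coefficients:
  assumes n: "n < N"
  shows "(\<lambda>\<omega>. transpose (bu n \<omega>)) \<in> borel_measurable (F n)"
    "(\<lambda>\<omega>. h powr (- 1 / 2) *\<^sub>R transpose (\<sigma>u n \<omega>)) \<in> borel_measurable (F n)"
  using measurable_coefficients[OF n] by measurable

lemma \<Gamma>_coefficient_bounds:
  assumes n: "n < N"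
  shows "norm (transpose (bu n \<omega>) *v y) \<le> lip * norm y"
    "norm ((h powr (- 1 / 2) *\<^sub>R transpose (\<sigma>u n \<omega>)) *v y) \<le> (h powr (- 1 / 2) * lip) * norm y"
proof -
  show "norm (transpose (bu n \<omega>) *v y) \<le> lip * norm y"
    by (intro norm_transpose_le coefficient_bounds n)
  have "norm (transpose (\<sigma>u n \<omega>) *v y) \<le> lip * norm y"
    by (intro norm_transpose_le coefficient_bounds n)
  then show "norm ((h powr (- 1 / 2) *\<^sub>R transpose (\<sigma>u n \<omega>)) *v y) \<le> (h powr (- 1 / 2) * lip) * norm y"
    unfolding scaleR_matrix_vector_assoc[symmetric] norm_scaleR mult.assoc
    by (simp only: abs_of_nonneg[OF powr_ge_zero]) (rule mult_left_mono, auto)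
qed

lemma integrable_bounded_coefficient:
  fixes Y :: "'w \<Rightarrow> 'b::{banach, second_countable_topology}"
  assumes "Y \<in> borel_measurable (F n)" "\<And>\<omega>. norm (Y \<omega>) \<le> C"
  shows "integrable M Y"
  using assms by (intro integrable_const_bound[where B = C] measurable_F_M) auto

lemma integrable_\<Gamma>:
  assumes n: "n < N"
  shows "integrable M (\<Gamma> n)"
proof -
  interpret sigma_finite_subalgebra M "F n" by (rule sigma_finite_subalgebra_F)
  show ?thesis
    unfolding \<Gamma>_eq[abs_def]
    by (intro Bochner_Integration.integrable_add
        integrable_matrix_vector_mult[OF measurable_F_M[OF measurable_\<Gamma>_coefficients(1)[OF n]] \<Gamma>_coefficient_bounds(1)[OF n]]
        integrable_matrix_vector_mult[OF measurable_F_M[OF measurable_\<Gamma>_coefficients(2)[OF n]] \<Gamma>_coefficient_bounds(2)[OF n]]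
        integrable_costate integrable_\<xi>_costate n Suc_leI
        integrable_bounded_coefficient[OF measurable_coefficients(6)[OF n] coefficient_bounds(6)[OF n]])
qed

text \<open>Both signs of \<open>\<epsilon>\<close> are meaningful, since the coefficients are
  defined for all control values. The limit is tested along arbitrary null sequences so that
  dominated convergence applies.\<close>

lemma directional_derivative_cost:
  assumes v: "v \<in> adapted_controls M F N" and V: "\<And>n. n < N \<Longrightarrow> AE \<omega> in M. norm (v n \<omega>) \<le> V"
  shows "has_directional_derivative (cost M N h b \<sigma> x0 \<Phi> l \<xi>) us v (h * (\<Sum>n<N. \<integral>\<omega>. \<Gamma> n \<omega> \<bullet> v n \<omega> \<partial>M))"
proof -
  let ?J = "cost M N h b \<sigma> x0 \<Phi> l \<xi>"
  \<comment> \<open>A nonnegative bound, as \<open>path_cost_bound\<close> requires.\<close>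
  define W where "W = \<bar>V\<bar>"
  have J: "?J u = (\<integral>\<omega>. path_cost u \<omega> \<partial>M)" for u
    by (simp add: cost_def path_cost_def)
  have int: "integrable M (path_cost (perturb us \<epsilon> v))" for \<epsilon>
    by (intro integrable_path_cost perturb_adapted v)
  have int0: "integrable M (path_cost us)"
    by (intro integrable_path_cost us_adapted)
  have AE_V: "AE \<omega> in M. \<forall>n\<in>{..<N}. norm (v n \<omega>) \<le> W"
  proof (rule AE_finite_allI)
    fix n assume "n \<in> {..<N}"
    then have "AE \<omega> in M. norm (v n \<omega>) \<le> V" by (intro V) simp
    then show "AE \<omega> in M. norm (v n \<omega>) \<le> W" by eventually_elim (simp add: W_def)
  qed simp
  have "((\<lambda>\<epsilon>. (?J (perturb us \<epsilon> v) - ?J us) / \<epsilon>) \<longlongrightarrow> (\<integral>\<omega>. path_cost_derivative v \<omega> \<partial>M)) (at 0)"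
  proof (rule tendsto_at_iff_sequentially[THEN iffD2], intro allI impI)
    fix e :: "nat \<Rightarrow> real" assume e: "\<forall>i. e i \<in> UNIV - {0}" "e \<longlonglongrightarrow> 0"
    let ?q = "\<lambda>i \<omega>. (path_cost (perturb us (e i) v) \<omega> - path_cost us \<omega>) / e i"
    have lim: "(\<lambda>i. ?q i \<omega>) \<longlonglongrightarrow> path_cost_derivative v \<omega>" for \<omega>
    proof -
      have "perturb us 0 v = us" by (simp add: perturb_def)
      then have "((\<lambda>\<epsilon>. (path_cost (perturb us \<epsilon> v) \<omega> - path_cost us \<omega>) / \<epsilon>) \<longlongrightarrow> path_cost_derivative v \<omega>) (at 0)"
        using path_cost_derivative[of v \<omega>]
        by (simp add: has_real_derivative_iff_has_vector_derivative[symmetric] has_field_derivative_iff)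
      moreover have "filterlim e (at 0) sequentially"
        using e by (intro filterlim_atI) auto
      ultimately show ?thesis by (rule filterlim_compose)
    qed
    have meas: "?q i \<in> borel_measurable M" for i using int[of "e i"] int0 by auto
    have "(\<lambda>i. \<integral>\<omega>. ?q i \<omega> \<partial>M) \<longlonglongrightarrow> (\<integral>\<omega>. path_cost_derivative v \<omega> \<partial>M)"
    proof (rule integral_dominated_convergence)
      show "path_cost_derivative v \<in> borel_measurable M"
        by (rule borel_measurable_LIMSEQ_real[OF lim meas])
      show "integrable M (\<lambda>\<omega>. (lip\<Phi> + h * N * lip) * W * (growth * R \<omega>) ^ N)"
        using integrable_R_power[of N] by (simp add: power_mult_distrib)
      show "AE \<omega> in M. norm (?q i \<omega>) \<le> (lip\<Phi> + h * N * lip) * W * (growth * R \<omega>) ^ N" for i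
        using AE_V
      proof eventually_elim
        case (elim \<omega>)
        then have "\<bar>path_cost (perturb us (e i) v) \<omega> - path_cost us \<omega>\<bar>
            \<le> \<bar>e i\<bar> * ((lip\<Phi> + h * N * lip) * W * (growth * R \<omega>) ^ N)"
          by (intro path_cost_bound) (auto simp: W_def)
        then show ?case using e(1)[rule_format, of i] by (simp add: abs_divide divide_le_eq mult.commute)
      qed
    qed (use meas lim in auto)
    then show "((\<lambda>\<epsilon>. (?J (perturb us \<epsilon> v) - ?J us) / \<epsilon>) \<circ> e) \<longlonglongrightarrow> (\<integral>\<omega>. path_cost_derivative v \<omega> \<partial>M)"
      using int int0 by (simp add: o_def J)
  qed
  moreover have "(\<integral>\<omega>. path_cost_derivative v \<omega> \<partial>M) = h * (\<Sum>n<N. \<integral>\<omega>. \<Gamma> n \<omega> \<bullet> v n \<omega> \<partial>M)"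
  proof -
    have "integrable M (\<lambda>\<omega>. \<Gamma> n \<omega> \<bullet> v n \<omega>)" if n: "n < N" for n
    proof -
      interpret sigma_finite_subalgebra M "F n" by (rule sigma_finite_subalgebra_F)
      show ?thesis
        using v n by (intro integral_vec_cond_exp_inner(1)[OF _ V[OF n] integrable_\<Gamma>[OF n]]) (simp add: adapted_controls_def)
    qed
    then show ?thesis by (simp add: path_cost_derivative_eq Bochner_Integration.integral_sum)
  qed
  ultimately show ?thesis by (simp add: has_directional_derivative_def)
qed

section \<open>Conditioning the costate\<close>

text \<open>\<open>\<eta> n\<close> is known at time \<open>n + 1\<close>, so it moves inside the
  conditional expectation that represents \<open>p'\<close>, and the tower property descends to time
  \<open>n\<close>. The decomposition of \<open>\<xi> n\<close> then merges the \<open>pbar\<close>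
  and \<open>q\<close> terms into one conditional expectation. Integrability is only ever asked of
  products with the costate.\<close>

lemma adjoint_cond_exp_step:
  assumes n: "n < N"
    and p: "AE \<omega> in M. p' \<omega> = vec_cond_exp M (F (Suc n)) (costate (Suc n)) \<omega>"
    and pm: "p' \<in> borel_measurable (F (Suc n))"
    and pbar: "AE \<omega> in M. pbar \<omega> = vec_cond_exp M (F n) p' \<omega>"
    and q: "AE \<omega> in M. q \<omega> = vec_cond_exp M (F n) (\<lambda>\<omega>. \<eta> n \<omega> *\<^sub>R p' \<omega>) \<omega>"
  shows "AE \<omega> in M. pbar \<omega> = vec_cond_exp M (F n) (costate (Suc n)) \<omega>"
    and "AE \<omega> in M. real_cond_exp M (F n) (\<xi> n) \<omega> *\<^sub>R pbar \<omega> + \<beta> n n *\<^sub>R q \<omega>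
      = vec_cond_exp M (F n) (\<lambda>\<omega>. \<xi> n \<omega> *\<^sub>R costate (Suc n) \<omega>) \<omega>"
proof -
  interpret F: sigma_finite_subalgebra M "F n" by (rule sigma_finite_subalgebra_F)
  interpret F': sigma_finite_subalgebra M "F (Suc n)" by (rule sigma_finite_subalgebra_F)
  let ?c = "costate (Suc n)" and ?\<zeta> = "real_cond_exp M (F n) (\<xi> n)"
  have cm [measurable]: "?c \<in> borel_measurable M" and ci: "integrable M ?c"
    using n by (auto intro: measurable_costate integrable_costate)
  have pM [measurable]: "p' \<in> borel_measurable M" by (rule measurable_F_M[OF pm])
  have ce [measurable]: "vec_cond_exp M (F (Suc n)) ?c \<in> borel_measurable M"
    by (rule measurable_F_M[OF F'.borel_measurable_vec_cond_exp])
  have sub: "subalgebra (F (Suc n)) (F n)" by (rule subalgebra_noise_filtration_mono) simp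
  have \<eta>i: "integrable M (\<lambda>\<omega>. \<eta> n \<omega> *\<^sub>R ?c \<omega>)" by (rule integrable_\<eta>_costate[OF n])
  have \<xi>i: "integrable M (\<lambda>\<omega>. \<xi> n \<omega> *\<^sub>R ?c \<omega>)" by (rule integrable_\<xi>_costate[OF n])
  show pbar_eq: "AE \<omega> in M. pbar \<omega> = vec_cond_exp M (F n) ?c \<omega>"
    using pbar F.vec_cond_exp_cong[OF p pM ce] F.vec_cond_exp_tower[OF subalgebra_F sub ci]
    by eventually_elim simp
  have "AE \<omega> in M. \<eta> n \<omega> *\<^sub>R p' \<omega> = vec_cond_exp M (F (Suc n)) (\<lambda>\<omega>. \<eta> n \<omega> *\<^sub>R ?c \<omega>) \<omega>"
  proof -
    have "\<eta> n \<in> borel_measurable (F (Suc n))" by (rule measurable_noise_filtration) simp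
    from F'.vec_cond_exp_scaleR[OF this cm \<eta>i] p show ?thesis by eventually_elim simp
  qed
  moreover have "vec_cond_exp M (F (Suc n)) (\<lambda>\<omega>. \<eta> n \<omega> *\<^sub>R ?c \<omega>) \<in> borel_measurable M"
    by (rule measurable_F_M[OF F'.borel_measurable_vec_cond_exp])
  ultimately have "AE \<omega> in M. vec_cond_exp M (F n) (\<lambda>\<omega>. \<eta> n \<omega> *\<^sub>R p' \<omega>) \<omega>
      = vec_cond_exp M (F n) (vec_cond_exp M (F (Suc n)) (\<lambda>\<omega>. \<eta> n \<omega> *\<^sub>R ?c \<omega>)) \<omega>"
    by (intro F.vec_cond_exp_cong) auto
  then have q_eq: "AE \<omega> in M. q \<omega> = vec_cond_exp M (F n) (\<lambda>\<omega>. \<eta> n \<omega> *\<^sub>R ?c \<omega>) \<omega>"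
    using q F.vec_cond_exp_tower[OF subalgebra_F sub \<eta>i] by eventually_elim simp
  have \<zeta>F: "?\<zeta> \<in> borel_measurable (F n)" by simp
  have [measurable]: "?\<zeta> \<in> borel_measurable M" by (rule measurable_F_M[OF \<zeta>F])
  have split: "AE \<omega> in M. \<xi> n \<omega> *\<^sub>R ?c \<omega> = ?\<zeta> \<omega> *\<^sub>R ?c \<omega> + \<beta> n n *\<^sub>R (\<eta> n \<omega> *\<^sub>R ?c \<omega>)"
    using \<xi>_decomposition[OF n] by eventually_elim (simp only: scaleR_add_left scaleR_scaleR)
  \<comment> \<open>No pathwise bound on the conditional expectation is at hand; its product with
    the costate is almost everywhere the difference of two products already known to be
    integrable.\<close>
  have \<zeta>i: "integrable M (\<lambda>\<omega>. ?\<zeta> \<omega> *\<^sub>R ?c \<omega>)"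
  proof (rule integrable_cong_AE[THEN iffD1])
    show "integrable M (\<lambda>\<omega>. \<xi> n \<omega> *\<^sub>R ?c \<omega> - \<beta> n n *\<^sub>R (\<eta> n \<omega> *\<^sub>R ?c \<omega>))"
      by (intro Bochner_Integration.integrable_diff integrable_scaleR_right \<xi>i \<eta>i)
    show "AE \<omega> in M. \<xi> n \<omega> *\<^sub>R ?c \<omega> - \<beta> n n *\<^sub>R (\<eta> n \<omega> *\<^sub>R ?c \<omega>) = ?\<zeta> \<omega> *\<^sub>R ?c \<omega>"
      using split by eventually_elim simp
  qed measurable
  have \<beta>i: "integrable M (\<lambda>\<omega>. \<beta> n n *\<^sub>R (\<eta> n \<omega> *\<^sub>R ?c \<omega>))" by (intro integrable_scaleR_right \<eta>i)
  have "AE \<omega> in M. vec_cond_exp M (F n) (\<lambda>\<omega>. \<xi> n \<omega> *\<^sub>R ?c \<omega>) \<omega>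
      = vec_cond_exp M (F n) (\<lambda>\<omega>. ?\<zeta> \<omega> *\<^sub>R ?c \<omega> + \<beta> n n *\<^sub>R (\<eta> n \<omega> *\<^sub>R ?c \<omega>)) \<omega>"
    by (rule F.vec_cond_exp_cong[OF split]) auto
  moreover note F.vec_cond_exp_add[OF \<zeta>i \<beta>i] F.vec_cond_exp_scaleR[OF \<zeta>F cm \<zeta>i]
    F.vec_cond_exp_scaleR[OF _ borel_measurable_integrable[OF \<eta>i] \<beta>i, simplified]
  ultimately show "AE \<omega> in M. ?\<zeta> \<omega> *\<^sub>R pbar \<omega> + \<beta> n n *\<^sub>R q \<omega>
      = vec_cond_exp M (F n) (\<lambda>\<omega>. \<xi> n \<omega> *\<^sub>R ?c \<omega>) \<omega>"
    using pbar_eq q_eq by eventually_elim simp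
qed

lemma cond_exp_costate:
  assumes n: "n < N"
  shows "AE \<omega> in M. vec_cond_exp M (F n) (costate n) \<omega>
    = transpose (stepA n \<omega>) *v vec_cond_exp M (F n) (costate (Suc n)) \<omega>
    + transpose (stepB n \<omega>) *v vec_cond_exp M (F n) (\<lambda>\<omega>. \<xi> n \<omega> *\<^sub>R costate (Suc n) \<omega>) \<omega> + h *\<^sub>R lx n \<omega>"
proof -
  interpret sigma_finite_subalgebra M "F n" by (rule sigma_finite_subalgebra_F)
  have lx: "(\<lambda>\<omega>. h *\<^sub>R lx n \<omega>) \<in> borel_measurable (F n)" "integrable M (\<lambda>\<omega>. h *\<^sub>R lx n \<omega>)"
    using measurable_coefficients(5)[OF n] integrable_bounded_coefficient[OF measurable_coefficients(5)[OF n] coefficient_bounds(5)[OF n]]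
    by auto
  show ?thesis
    unfolding costate_step[OF n, abs_def]
    by (rule vec_cond_exp_affine[OF measurable_step(1)[OF n] step_bounds(1)[OF n]
        measurable_step(2)[OF n] step_bounds(2)[OF n] lx integrable_costate[OF Suc_leI[OF n]] integrable_\<xi>_costate[OF n]])
qed

lemma cond_exp_\<Gamma>:
  assumes n: "n < N"
  shows "AE \<omega> in M. vec_cond_exp M (F n) (\<Gamma> n) \<omega>
    = transpose (bu n \<omega>) *v vec_cond_exp M (F n) (costate (Suc n)) \<omega> + lu n \<omega>
    + h powr (- 1 / 2) *\<^sub>R (transpose (\<sigma>u n \<omega>) *v vec_cond_exp M (F n) (\<lambda>\<omega>. \<xi> n \<omega> *\<^sub>R costate (Suc n) \<omega>) \<omega>)"
proof -
  interpret sigma_finite_subalgebra M "F n" by (rule sigma_finite_subalgebra_F)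
  note lu = measurable_coefficients(6)[OF n]
  have "AE \<omega> in M. vec_cond_exp M (F n) (\<Gamma> n) \<omega>
    = transpose (bu n \<omega>) *v vec_cond_exp M (F n) (costate (Suc n)) \<omega>
    + (h powr (- 1 / 2) *\<^sub>R transpose (\<sigma>u n \<omega>)) *v vec_cond_exp M (F n) (\<lambda>\<omega>. \<xi> n \<omega> *\<^sub>R costate (Suc n) \<omega>) \<omega> + lu n \<omega>"
    unfolding \<Gamma>_eq[abs_def]
    by (rule vec_cond_exp_affine[OF measurable_\<Gamma>_coefficients(1)[OF n] \<Gamma>_coefficient_bounds(1)[OF n]
        measurable_\<Gamma>_coefficients(2)[OF n] \<Gamma>_coefficient_bounds(2)[OF n]
        lu integrable_bounded_coefficient[OF lu coefficient_bounds(6)[OF n]]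
        integrable_costate[OF Suc_leI[OF n]] integrable_\<xi>_costate[OF n]])
  then show ?thesis
    by eventually_elim (simp only: scaleR_matrix_vector_assoc add.assoc add.commute[of "lu n _"])
qed

lemma adjoint_eq_cond_exp_costate:
  assumes adj: "adjoint_solution M F N h b \<sigma> \<Phi> l \<beta> \<eta> (\<lambda>n. real_cond_exp M (F n) (\<xi> n)) X us p pbar q"
    and "n \<le> N"
  shows "AE \<omega> in M. p n \<omega> = vec_cond_exp M (F n) (costate n) \<omega>"
  using \<open>n \<le> N\<close>
proof (induction n rule: inc_induct)
  case base
  interpret sigma_finite_subalgebra M "F N" by (rule sigma_finite_subalgebra_F)
  \<comment> \<open>Only at the horizon is the costate seen to be adapted, so there conditioning
    changes nothing.\<close>
  have "costate N \<in> borel_measurable (F N)"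
    unfolding costate_N[abs_def]
    using measurable_X[of N] by (intro borel_measurable_continuous_on[OF C2_gradient(2)[OF C2_\<Phi>]]) auto
  from vec_cond_exp_F_meas[OF integrable_costate this]
  have "AE \<omega> in M. vec_cond_exp M (F N) (costate N) \<omega> = costate N \<omega>" by simp
  moreover have "AE \<omega> in M. p N \<omega> = costate N \<omega>"
    using adj by (simp add: adjoint_solution_def costate_N)
  ultimately show ?case by eventually_elim simp
next
  case (step n)
  note n = step(2)
  have "p (Suc n) \<in> borel_measurable (F (Suc n))"
    and "AE \<omega> in M. pbar n \<omega> = vec_cond_exp M (F n) (p (Suc n)) \<omega>"
    and "AE \<omega> in M. q n \<omega> = vec_cond_exp M (F n) (\<lambda>\<omega>. \<eta> n \<omega> *\<^sub>R p (Suc n) \<omega>) \<omega>"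
    and eq: "AE \<omega> in M. p n \<omega> = transpose (stepA n \<omega>) *v pbar n \<omega>
      + transpose (stepB n \<omega>) *v (real_cond_exp M (F n) (\<xi> n) \<omega> *\<^sub>R pbar n \<omega> + \<beta> n n *\<^sub>R q n \<omega>) + h *\<^sub>R lx n \<omega>"
    using adj n unfolding adjoint_solution_def Let_def stepA_def stepB_def bx_def \<sigma>x_def lx_def
    by (simp_all only: Suc_le_eq)
  note adjoint_cond_exp_step[OF n step.IH this(1-3)]
  with eq cond_exp_costate[OF n] show ?case by eventually_elim (simp only:)
qed

lemma hamiltonian_gradient_eq_cond_exp:
  assumes adj: "adjoint_solution M F N h b \<sigma> \<Phi> l \<beta> \<eta> (\<lambda>n. real_cond_exp M (F n) (\<xi> n)) X us p pbar q"
    and n: "n < N"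
  shows "AE \<omega> in M. transpose (bu n \<omega>) *v pbar n \<omega> + lu n \<omega> + h powr (- 1 / 2) *\<^sub>R
      (transpose (\<sigma>u n \<omega>) *v (real_cond_exp M (F n) (\<xi> n) \<omega> *\<^sub>R pbar n \<omega> + \<beta> n n *\<^sub>R q n \<omega>))
    = vec_cond_exp M (F n) (\<Gamma> n) \<omega>"
proof -
  have p: "p (Suc n) \<in> borel_measurable (F (Suc n))"
    and pbar: "AE \<omega> in M. pbar n \<omega> = vec_cond_exp M (F n) (p (Suc n)) \<omega>"
    and q: "AE \<omega> in M. q n \<omega> = vec_cond_exp M (F n) (\<lambda>\<omega>. \<eta> n \<omega> *\<^sub>R p (Suc n) \<omega>) \<omega>"
    using adj n unfolding adjoint_solution_def by (simp_all only: Suc_le_eq)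
  note adjoint_cond_exp_step[OF n adjoint_eq_cond_exp_costate[OF adj Suc_leI[OF n]] p pbar q]
  with cond_exp_\<Gamma>[OF n] show ?thesis by eventually_elim (simp only:)
qed

section \<open>First-order conditions at a local minimiser\<close>

text \<open>The perturbed control lies on the segment from \<open>us n\<close> to
  \<open>us n + v n\<close>, so feasibility at the endpoint yields feasibility for all smaller
  steps.\<close>

lemma perturb_admissible_if_convex:
  assumes us: "us \<in> admissible_controls M F N U" and v: "v \<in> adapted_controls M F N"
    and U: "convex U" and feasible: "\<And>n. n < N \<Longrightarrow> AE \<omega> in M. us n \<omega> + v n \<omega> \<in> U"
    and \<epsilon>: "0 \<le> \<epsilon>" "\<epsilon> \<le> 1"
  shows "perturb us \<epsilon> v \<in> admissible_controls M F N U"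
  unfolding admissible_controls_def
proof (intro CollectI conjI allI impI perturb_adapted v)
  fix n assume n: "n < N"
  have "AE \<omega> in M. us n \<omega> \<in> U" using us n by (simp add: admissible_controls_def)
  with feasible[OF n] show "AE \<omega> in M. perturb us \<epsilon> v n \<omega> \<in> U"
  proof eventually_elim
    case (elim \<omega>)
    then have "(1 - \<epsilon>) *\<^sub>R us n \<omega> + \<epsilon> *\<^sub>R (us n \<omega> + v n \<omega>) \<in> U"
      using U \<epsilon> by (intro convexD) auto
    then show ?case by (simp add: perturb_def algebra_simps)
  qed
qed

text \<open>The control norm of the perturbation is proportional to
  \<open>\<bar>\<epsilon>\<bar>\<close>, so small steps stay in the ball of local minimality.
  Admissibility is known only for \<open>\<epsilon> > 0\<close>, hence the right-hand limit and an
  inequality instead of an equation.\<close>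

lemma directional_derivative_nonneg:
  assumes min: "local_minimiser M F N h U J us"
    and v: "bounded_feasible_perturbation M F N U us v"
    and D: "has_directional_derivative J us v D"
  shows "0 \<le> D"
proof -
  obtain \<delta> where \<delta>: "0 < \<delta>" and min: "\<And>w. w \<in> admissible_controls M F N U \<Longrightarrow>
      control_norm M N h (\<lambda>n \<omega>. w n \<omega> - us n \<omega>) < \<delta> \<Longrightarrow> J us \<le> J w"
    using min unfolding local_minimiser_def by blast
  have norm: "control_norm M N h (\<lambda>n \<omega>. perturb us \<epsilon> v n \<omega> - us n \<omega>) = \<bar>\<epsilon>\<bar> * control_norm M N h v" for \<epsilon>
  proof -
    have "h * (\<Sum>n<N. \<integral>\<omega>. (norm (perturb us \<epsilon> v n \<omega> - us n \<omega>))\<^sup>2 \<partial>M) = \<epsilon>\<^sup>2 * (h * (\<Sum>n<N. \<integral>\<omega>. (norm (v n \<omega>))\<^sup>2 \<partial>M))"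
      by (simp add: perturb_def power_mult_distrib sum_distrib_left mult.left_commute)
    then show ?thesis by (simp only: control_norm_def real_sqrt_mult[of "\<epsilon>\<^sup>2"] real_sqrt_abs)
  qed
  have "((\<lambda>\<epsilon>. \<bar>\<epsilon>\<bar> * control_norm M N h v) \<longlongrightarrow> \<bar>0\<bar> * control_norm M N h v) (at_right 0)"
    by (intro tendsto_intros)
  then have "\<forall>\<^sub>F \<epsilon> in at_right 0. \<bar>\<epsilon>\<bar> * control_norm M N h v < \<delta>"
    using \<delta> by (intro order_tendstoD(2)) auto
  moreover have "\<forall>\<^sub>F \<epsilon> in at_right 0. perturb us \<epsilon> v \<in> admissible_controls M F N U"
    using v by (simp add: bounded_feasible_perturbation_def)
  moreover have "\<forall>\<^sub>F \<epsilon> in at_right (0::real). 0 < \<epsilon>"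
    by (rule eventually_at_right_less)
  ultimately have "\<forall>\<^sub>F \<epsilon> in at_right 0. 0 \<le> (J (perturb us \<epsilon> v) - J us) / \<epsilon>"
    by eventually_elim (simp add: min norm)
  moreover have "((\<lambda>\<epsilon>. (J (perturb us \<epsilon> v) - J us) / \<epsilon>) \<longlongrightarrow> D) (at_right 0)"
    using D unfolding has_directional_derivative_def by (rule filterlim_at_split[THEN iffD1, THEN conjunct2])
  ultimately show ?thesis by (intro tendsto_lowerbound) auto
qed

end

section \<open>The normal cone inclusion\<close>

text \<open>From an interior point a short step along \<open>g\<close> itself stays in
  \<open>U\<close>, which forces \<open>g \<bullet> g \<le> 0\<close>.\<close>

lemma normal_cone_interior_eq_0:
  assumes w: "w \<in> interior U" and g: "g \<in> normal_cone U w"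
  shows "g = 0"
proof (rule ccontr)
  assume "g \<noteq> 0"
  obtain e where e: "0 < e" "cball w e \<subseteq> U" using w by (auto simp: mem_interior_cball)
  let ?y = "w + (e / norm g) *\<^sub>R g"
  have "?y \<in> U" using e \<open>g \<noteq> 0\<close> by (intro subsetD[OF e(2)]) (simp add: dist_norm)
  then have "g \<bullet> (?y - w) \<le> 0" using g unfolding normal_cone_def by blast
  moreover have "g \<bullet> (?y - w) = e / norm g * (norm g)\<^sup>2" by (simp add: power2_norm_eq_inner)
  ultimately have "e / norm g * (norm g)\<^sup>2 \<le> 0" by (simp only:)
  then show False using e \<open>g \<noteq> 0\<close> by (simp add: mult_le_0_iff divide_le_0_iff)
qed

text \<open>Localises an integrated variational inequality. Since \<open>g\<close> and
  \<open>w\<close> are \<open>F\<close>-measurable, the event where the pointwise inequality fails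
  is an admissible event for test directions; this is why the conditioned gradient, and not the
  pathwise one, satisfies the inclusion.\<close>

lemma (in finite_measure) AE_normal_cone:
  fixes g w :: "'a \<Rightarrow> 'b::euclidean_space"
  assumes sub: "subalgebra M F" and g [measurable]: "g \<in> borel_measurable F"
    and w [measurable]: "w \<in> borel_measurable F" and wU: "AE \<omega> in M. w \<omega> \<in> U"
    and test: "\<And>v C. v \<in> borel_measurable F \<Longrightarrow> (\<And>\<omega>. norm (v \<omega>) \<le> C) \<Longrightarrow> (AE \<omega> in M. w \<omega> + v \<omega> \<in> U) \<Longrightarrow>
      integrable M (\<lambda>\<omega>. g \<omega> \<bullet> v \<omega>) \<and> 0 \<le> (\<integral>\<omega>. g \<omega> \<bullet> v \<omega> \<partial>M)"
  shows "AE \<omega> in M. - g \<omega> \<in> normal_cone U (w \<omega>)"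
proof -
  obtain S where S: "countable S" "S \<subseteq> U" "U \<subseteq> closure S" using separable by blast
  have nonneg: "AE \<omega> in M. norm (w \<omega>) \<le> real k \<longrightarrow> 0 \<le> g \<omega> \<bullet> (y - w \<omega>)" if y: "y \<in> U" for y and k :: nat
  proof -
    \<comment> \<open>The cutoff at level \<open>k\<close> keeps the test direction bounded although
      \<open>w\<close> need not be.\<close>
    define A where "A = {\<omega> \<in> space F. norm (w \<omega>) \<le> real k \<and> g \<omega> \<bullet> (y - w \<omega>) < 0}"
    have A [measurable]: "A \<in> sets F" unfolding A_def by measurable
    \<comment> \<open>The displaced point \<open>w + v\<close> is \<open>y\<close> on
      \<open>A\<close> and \<open>w\<close> elsewhere, hence feasible without convexity.\<close>
    define v where "v \<omega> = indicator A \<omega> *\<^sub>R (y - w \<omega>)" for \<omega>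
    have "integrable M (\<lambda>\<omega>. g \<omega> \<bullet> v \<omega>) \<and> 0 \<le> (\<integral>\<omega>. g \<omega> \<bullet> v \<omega> \<partial>M)"
    proof (rule test)
      show "v \<in> borel_measurable F" unfolding v_def by measurable
      show "norm (v \<omega>) \<le> norm y + real k" for \<omega>
        using norm_triangle_ineq4[of y "w \<omega>"] by (auto simp: v_def A_def indicator_def)
      show "AE \<omega> in M. w \<omega> + v \<omega> \<in> U" using wU by eventually_elim (auto simp: v_def indicator_def y)
    qed
    then have int: "integrable M (\<lambda>\<omega>. - (g \<omega> \<bullet> v \<omega>))" and le: "(\<integral>\<omega>. - (g \<omega> \<bullet> v \<omega>) \<partial>M) \<le> 0" by auto
    \<comment> \<open>By the choice of \<open>A\<close> the integrand has the sign opposite to that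
      of its integral, so it vanishes almost everywhere.\<close>
    have nn: "0 \<le> - (g \<omega> \<bullet> v \<omega>)" for \<omega> by (auto simp: v_def A_def indicator_def)
    have "(\<integral>\<omega>. - (g \<omega> \<bullet> v \<omega>) \<partial>M) = 0"
      using le nn by (intro antisym integral_nonneg_AE) auto
    then have "AE \<omega> in M. - (g \<omega> \<bullet> v \<omega>) = 0"
      using integral_nonneg_eq_0_iff_AE[OF int] nn by auto
    then show ?thesis
    proof (rule AE_mp, intro AE_I2 impI)
      fix \<omega> assume "\<omega> \<in> space M" "- (g \<omega> \<bullet> v \<omega>) = 0" "norm (w \<omega>) \<le> real k"
      then show "0 \<le> g \<omega> \<bullet> (y - w \<omega>)"
        using sub by (cases "g \<omega> \<bullet> (y - w \<omega>) < 0") (auto simp: v_def A_def subalgebra_def)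
    qed
  qed
  \<comment> \<open>The exceptional null set depends on \<open>y\<close> and \<open>k\<close>, so
    only countably many may be combined; closedness of the half-space afterwards reaches all of
    \<open>U\<close>.\<close>
  have "AE \<omega> in M. \<forall>y\<in>S. \<forall>k::nat. norm (w \<omega>) \<le> real k \<longrightarrow> 0 \<le> g \<omega> \<bullet> (y - w \<omega>)"
    unfolding AE_ball_countable[OF S(1)] AE_all_countable using S(2) by (intro ballI allI nonneg) blast
  with wU show ?thesis
  proof eventually_elim
    case (elim \<omega>)
    obtain k :: nat where "norm (w \<omega>) \<le> real k" using real_arch_simple by blast
    with elim have "S \<subseteq> {y. 0 \<le> g \<omega> \<bullet> (y - w \<omega>)}" by auto
    moreover have "closed {y. 0 \<le> g \<omega> \<bullet> (y - w \<omega>)}"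
      by (intro closed_Collect_le continuous_intros)
    ultimately have "U \<subseteq> {y. 0 \<le> g \<omega> \<bullet> (y - w \<omega>)}" using S(3) closure_minimal by blast
    with elim show ?case by (auto simp: normal_cone_def)
  qed
qed

theorem theorem13:
  fixes M :: "'w measure"
    and B :: "real \<Rightarrow> 'w \<Rightarrow> real"
    and H h L K L' :: real
    and N :: nat
    and \<beta> \<gamma> :: "nat \<Rightarrow> nat \<Rightarrow> real"
    and \<xi> \<eta> \<zeta> :: "nat \<Rightarrow> 'w \<Rightarrow> real"
    and F :: "nat \<Rightarrow> 'w measure"
    and U :: "(real ^ 'p) set"
    and x0 :: "real ^ 'd"
    and b \<sigma> :: "nat \<Rightarrow> real ^ 'd \<Rightarrow> real ^ 'p \<Rightarrow> real ^ 'd"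
    and \<Phi> :: "real ^ 'd \<Rightarrow> real"
    and l :: "nat \<Rightarrow> real ^ 'd \<Rightarrow> real ^ 'p \<Rightarrow> real"
    and J :: "(nat \<Rightarrow> 'w \<Rightarrow> real ^ 'p) \<Rightarrow> real"
    and us :: "nat \<Rightarrow> 'w \<Rightarrow> real ^ 'p"
    and X p pbar q :: "nat \<Rightarrow> 'w \<Rightarrow> real ^ 'd"
    and G :: "nat \<Rightarrow> 'w \<Rightarrow> real ^ 'p"
  assumes prob: "prob_space M" and complete: "complete_measure M"
    and params: "0 < H" "H < 1" "1 \<le> N" "0 < h"
    and fbm: "fractional_brownian_motion M H B"
    and xi: "\<xi> = fgn H h B"
    and beta: "cholesky_factor N (fgn_cov H) \<beta>"
    and gamma: "inverse_matrices N \<beta> \<gamma>"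
    and eta: "\<eta> = innovation \<gamma> \<xi>"
    and filt: "F = noise_filtration M \<eta>"
    and zeta: "\<zeta> = (\<lambda>n. real_cond_exp M (F n) (\<xi> n))"
    and U: "closed U" "convex U" "0 \<in> U"
    and A1: "0 < L"
      "C2_bounded_lipschitz L K \<Phi>"
      "\<forall>n<N. C2_bounded_lipschitz L K (\<lambda>(x, u). b n x u)"
      "\<forall>n<N. C2_bounded_lipschitz L K (\<lambda>(x, u). \<sigma> n x u)"
      "\<forall>n<N. C2_bounded_lipschitz L K (\<lambda>(x, u). l n x u)"
    and A2: "0 < L'"
      "\<forall>n<N. \<forall>x u. norm (b n x u) \<le> L' * (1 + norm x + norm u)"
      "\<forall>n<N. \<forall>x u. norm (\<sigma> n x u) \<le> L'"
    and J: "J = cost M N h b \<sigma> x0 \<Phi> l \<xi>"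
    and minimiser: "local_minimiser M F N h U J us"
    and state: "X = state h b \<sigma> x0 \<xi> us"
    and adjoint: "adjoint_solution M F N h b \<sigma> \<Phi> l \<beta> \<eta> \<zeta> X us p pbar q"
    and G: "G = (\<lambda>n \<omega>.
      transpose (jacobian (\<lambda>u. b n (X n \<omega>) u) (at (us n \<omega>))) *v pbar n \<omega>
      + gradient (\<lambda>u. l n (X n \<omega>) u) (us n \<omega>)
      + h powr (- 1 / 2) *\<^sub>R
          (transpose (jacobian (\<lambda>u. \<sigma> n (X n \<omega>) u) (at (us n \<omega>)))
            *v (\<zeta> n \<omega> *\<^sub>R pbar n \<omega> + \<beta> n n *\<^sub>R q n \<omega>)))"
  shows "(\<forall>v. bounded_feasible_perturbation M F N U us v \<longrightarrow>
            (\<forall>n<N. integrable M (\<lambda>\<omega>. G n \<omega> \<bullet> v n \<omega>)) \<and>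
            has_directional_derivative J us v (h * (\<Sum>n<N. \<integral>\<omega>. G n \<omega> \<bullet> v n \<omega> \<partial>M)))
       \<and> (\<forall>n<N. (AE \<omega> in M. us n \<omega> \<in> interior U) \<longrightarrow> (AE \<omega> in M. G n \<omega> = 0))
       \<and> (\<forall>n<N. AE \<omega> in M. - G n \<omega> \<in> normal_cone U (us n \<omega>))"
proof -
  have us: "us \<in> admissible_controls M F N U"
    using minimiser by (simp add: local_minimiser_def)
  interpret control_problem M B H h N \<beta> \<gamma> L K L' x0 b \<sigma> \<Phi> l us
    using prob params fbm beta gamma A1 A2 us
    by (simp add: control_problem_def control_problem_axioms_def fractional_noise_def
        fractional_noise_axioms_def admissible_controls_def filt eta xi)
  have F: "F = noise_filtration M (innovation \<gamma> (fgn H h B))" by (simp only: filt eta xi)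
  have adj: "adjoint_solution M F N h b \<sigma> \<Phi> l \<beta> (innovation \<gamma> (fgn H h B))
      (\<lambda>n. real_cond_exp M (F n) (fgn H h B n)) (state h b \<sigma> x0 (fgn H h B) us) us p pbar q"
    using adjoint by (simp only: eta zeta xi state)
  have Gdef: "G n \<omega> = transpose (bu n \<omega>) *v pbar n \<omega> + lu n \<omega> + h powr (- 1 / 2) *\<^sub>R
      (transpose (\<sigma>u n \<omega>) *v (real_cond_exp M (F n) (fgn H h B n) \<omega> *\<^sub>R pbar n \<omega> + \<beta> n n *\<^sub>R q n \<omega>))" for n \<omega>
    by (simp only: G bu_def lu_def \<sigma>u_def state zeta xi)
  have G_eq: "AE \<omega> in M. G n \<omega> = vec_cond_exp M (F n) (\<Gamma> n) \<omega>" if "n < N" for n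
    using hamiltonian_gradient_eq_cond_exp[OF adj[unfolded F] that] unfolding Gdef F .
  \<comment> \<open>The almost-everywhere identity \<open>G_eq\<close> cannot give this, as
    \<open>F n\<close> is not augmented by null sets; the adjoint processes and the coefficients are
    measurable for \<open>F n\<close> itself.\<close>
  have G_meas: "G n \<in> borel_measurable (F n)" if n: "n < N" for n
  proof -
    have [measurable]: "pbar n \<in> borel_measurable (F n)" "q n \<in> borel_measurable (F n)"
      using adj n unfolding adjoint_solution_def by blast+
    note [measurable] = measurable_coefficients(2,4,6)[OF n, folded F]
    show ?thesis unfolding Gdef by measurable
  qed
  have test: "integrable M (\<lambda>\<omega>. G n \<omega> \<bullet> w \<omega>)" "(\<integral>\<omega>. G n \<omega> \<bullet> w \<omega> \<partial>M) = (\<integral>\<omega>. \<Gamma> n \<omega> \<bullet> w \<omega> \<partial>M)"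
    if n: "n < N" and w: "w \<in> borel_measurable (F n)" and C: "AE \<omega> in M. norm (w \<omega>) \<le> C" for n w C
  proof -
    interpret sigma_finite_subalgebra M "F n" unfolding F by (rule sigma_finite_subalgebra_F)
    note ce = integral_vec_cond_exp_inner[OF w C integrable_\<Gamma>[OF n]]
    have [measurable]: "G n \<in> borel_measurable M" "w \<in> borel_measurable M"
      "vec_cond_exp M (F n) (\<Gamma> n) \<in> borel_measurable M"
      using G_meas[OF n] w borel_measurable_vec_cond_exp by (auto intro: measurable_from_subalg[OF subalg])
    have ae: "AE \<omega> in M. G n \<omega> \<bullet> w \<omega> = vec_cond_exp M (F n) (\<Gamma> n) \<omega> \<bullet> w \<omega>"
      using G_eq[OF n] by eventually_elim simp
    then show "integrable M (\<lambda>\<omega>. G n \<omega> \<bullet> w \<omega>)"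
      using ce(2) by (subst integrable_cong_AE) auto
    show "(\<integral>\<omega>. G n \<omega> \<bullet> w \<omega> \<partial>M) = (\<integral>\<omega>. \<Gamma> n \<omega> \<bullet> w \<omega> \<partial>M)"
      using ae by (subst integral_cong_AE[where g = "\<lambda>\<omega>. vec_cond_exp M (F n) (\<Gamma> n) \<omega> \<bullet> w \<omega>"]) (auto simp: ce(3))
  qed
  have deriv: "(\<forall>n<N. integrable M (\<lambda>\<omega>. G n \<omega> \<bullet> v n \<omega>)) \<and>
      has_directional_derivative J us v (h * (\<Sum>n<N. \<integral>\<omega>. G n \<omega> \<bullet> v n \<omega> \<partial>M))"
    if v: "bounded_feasible_perturbation M F N U us v" for v
  proof
    have adapted: "v \<in> adapted_controls M F N" using v by (simp add: bounded_feasible_perturbation_def)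
    then have vm: "v n \<in> borel_measurable (F n)" if "n < N" for n using that by (simp add: adapted_controls_def)
    obtain C where C: "\<And>n. n < N \<Longrightarrow> AE \<omega> in M. norm (v n \<omega>) \<le> C"
      using v by (auto simp: bounded_feasible_perturbation_def)
    show "\<forall>n<N. integrable M (\<lambda>\<omega>. G n \<omega> \<bullet> v n \<omega>)" using test(1) vm C by blast
    have "(\<Sum>n<N. \<integral>\<omega>. G n \<omega> \<bullet> v n \<omega> \<partial>M) = (\<Sum>n<N. \<integral>\<omega>. \<Gamma> n \<omega> \<bullet> v n \<omega> \<partial>M)"
      by (intro sum.cong refl test(2)[OF _ vm C]) auto
    then show "has_directional_derivative J us v (h * (\<Sum>n<N. \<integral>\<omega>. G n \<omega> \<bullet> v n \<omega> \<partial>M))"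
      using directional_derivative_cost[OF adapted[unfolded F] C] by (simp add: J xi)
  qed
  have cone: "AE \<omega> in M. - G n \<omega> \<in> normal_cone U (us n \<omega>)" if n: "n < N" for n
  proof (rule AE_normal_cone[OF _ G_meas[OF n]])
    show "subalgebra M (F n)" unfolding F by (rule subalgebra_F)
    show "us n \<in> borel_measurable (F n)" unfolding F by (rule measurable_us[OF n])
    show "AE \<omega> in M. us n \<omega> \<in> U" using us n by (simp add: admissible_controls_def)
    fix v :: "'w \<Rightarrow> real ^ 'p" and C
    assume v: "v \<in> borel_measurable (F n)" "\<And>\<omega>. norm (v \<omega>) \<le> C" "AE \<omega> in M. us n \<omega> + v \<omega> \<in> U"
    \<comment> \<open>Acting at the single time \<open>n\<close> isolates one summand of the
      derivative, which turns the summed inequality into one for each time.\<close>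
    define w where "w m = (if m = n then v else (\<lambda>_. 0))" for m
    have C0: "0 \<le> C" by (rule order_trans[OF norm_ge_zero v(2)])
    have vM: "v \<in> borel_measurable M" using v(1) unfolding F by (rule measurable_F_M)
    have "(norm (v \<omega>))\<^sup>2 \<le> C\<^sup>2" for \<omega> using v(2) by (intro power_mono) auto
    then have "integrable M (\<lambda>\<omega>. (norm (v \<omega>))\<^sup>2)"
      using vM by (intro integrable_const_bound[where B = "C\<^sup>2"]) auto
    then have w_adapted: "w \<in> adapted_controls M F N"
      using v(1) by (simp add: adapted_controls_def w_def)
    have wU: "AE \<omega> in M. us m \<omega> + w m \<omega> \<in> U" if "m < N" for m
      using us v(3) that by (auto simp: w_def admissible_controls_def)
    have w: "bounded_feasible_perturbation M F N U us w"
      unfolding bounded_feasible_perturbation_def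
    proof (intro conjI w_adapted exI[of _ C] allI impI)
      show "AE \<omega> in M. norm (w m \<omega>) \<le> C" for m using v(2) C0 by (simp add: w_def)
      have "\<forall>\<^sub>F \<epsilon> in at_right (0::real). \<epsilon> \<in> {0<..<1}" by (rule eventually_at_rightI[of 0 1]) auto
      then show "\<forall>\<^sub>F \<epsilon> in at_right 0. perturb us \<epsilon> w \<in> admissible_controls M F N U"
      proof eventually_elim
        case (elim \<epsilon>)
        then show ?case
          using perturb_admissible_if_convex[OF us[unfolded F] w_adapted[unfolded F] U(2) wU, of \<epsilon>]
          by (simp add: F)
      qed
    qed
    have "0 \<le> h * (\<Sum>m<N. \<integral>\<omega>. G m \<omega> \<bullet> w m \<omega> \<partial>M)"
      using directional_derivative_nonneg[OF minimiser[unfolded F] w[unfolded F]] deriv[OF w] by blast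
    moreover have "(\<Sum>m<N. \<integral>\<omega>. G m \<omega> \<bullet> w m \<omega> \<partial>M) = (\<Sum>m<N. if m = n then \<integral>\<omega>. G n \<omega> \<bullet> v \<omega> \<partial>M else 0)"
      by (intro sum.cong refl) (simp add: w_def)
    ultimately have "0 \<le> (\<integral>\<omega>. G n \<omega> \<bullet> v \<omega> \<partial>M)"
      using n params(4) by (simp add: zero_le_mult_iff)
    moreover have "integrable M (\<lambda>\<omega>. G n \<omega> \<bullet> v \<omega>)"
      by (rule test(1)[OF n v(1) AE_I2[OF v(2)]])
    ultimately show "integrable M (\<lambda>\<omega>. G n \<omega> \<bullet> v \<omega>) \<and> 0 \<le> (\<integral>\<omega>. G n \<omega> \<bullet> v \<omega> \<partial>M)" by simp
  qed
  have "AE \<omega> in M. G n \<omega> = 0" if n: "n < N" and int: "AE \<omega> in M. us n \<omega> \<in> interior U" for n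
    using cone[OF n] int
  proof eventually_elim
    case (elim \<omega>)
    then show ?case using normal_cone_interior_eq_0[of "us n \<omega>" U "- G n \<omega>"] by simp
  qed
  with deriv cone show ?thesis by blast
qed

end
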